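(* (Multi-Hamiltonian structure of the positive vector Kaup–Newell hierarchy.) Let $\omega=(\mathbf q^{\mathrm T},\mathbf r^{\mathrm T})^{\mathrm T}$, let $W$ be the formal solution $a=\sum_{n\ge0}a_n\lambda^{2n}$, $\mathbf d=\sum_{n\ge0}\mathbf d_n\lambda^{2n}$, $\mathbf b=\sum_{n\ge0}\mathbf b_n\lambda^{2n+1}$, $\mathbf c=\sum_{n\ge0}\mathbf c_n\lambda^{2n+1}$ of the stationary zero-curvature equation $W_x=[U,W]$ described in the context. Put $$H_0^{+}=\alpha_0\int \mathbf q^{\mathrm T}\mathbf r\,dx,\qquad H_n^{+}=-\frac1{2n}\int\Big[2\mathrm i\,(a_{n+1}-\mathrm{tr}\,\mathbf d_{n+1})+\mathbf c_n^{\mathrm T}\mathbf q+\mathbf r^{\mathrm T}\mathbf b_n\Big]dx\quad(n\ge1).$$ Then (formally) for every $n\ge0$ $$\begin{pmatrix}\mathbf c_n\\ \mathbf b_n\end{pmatrix}=\frac{\delta H_n^{+}}{\delta\omega},$$ and the zero-curvature equation $U_t-V_x+[U,V]=0$ with $V=(\lambda^{-2(n+1)}W)_-$ (the part with strictly negative powers of $\lambda$) is equivalent to $$\omega_t=J\frac{\delta H_n^{+}}{\delta\omega}=JL^{n}\frac{\delta H_0^{+}}{\delta\omega},$$ where $J=\begin{pmatrix}0&\partial_x\\ \partial_x&0\end{pmatrix}$ and $L=\begin{pmatrix}0&I_N\\ I_N&0\end{pmatrix}L_1\begin{pmatrix}0&I_N\\ I_N&0\end{pmatrix}\partial_x$.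 Moreover the operators $J$ and $JL^{k}$ ($k\ge1$) are skew-symmetric.
   Context: $\mathbf q=(q_1,\dots,q_N)^{\mathrm T}$, $\mathbf r=(r_1,\dots,r_N)^{\mathrm T}$ are vector functions of $(x,t)$, and $U(\lambda)=\mathrm i\lambda^{-2}\sigma_3+\lambda^{-1}Q$ with $\sigma_3=\mathrm{diag}(1,-I_N)$, $Q=\begin{pmatrix}0&\mathbf r^{\mathrm T}\\ \mathbf q&0\end{pmatrix}$. Write $W=\begin{pmatrix}a&\mathbf c^{\mathrm T}\\ \mathbf b&\mathbf d\end{pmatrix}$ with $a$ scalar, $\mathbf b,\mathbf c$ of size $N\times1$, $\mathbf d$ of size $N\times N$. For a constant $\alpha_0\in\mathbb C$ the coefficients of $W$ are fixed by $a_0=\mathrm i\alpha_0$, $\mathbf d_0=-\mathrm i\alpha_0I_N$, $\mathbf b_0=\alpha_0\mathbf q$, $\mathbf c_0=\alpha_0\mathbf r$ and, for $n\ge0$, $$a_{n+1,x}=\tfrac{\mathrm i}{2}(\mathbf r^{\mathrm T}\mathbf b_{n,x}+\mathbf c_{n,x}^{\mathrm T}\mathbf q),\quad \mathbf d_{n+1,x}-\tfrac{\mathrm i}{2}[\mathbf q\mathbf r^{\mathrm T},\mathbf d_{n+1}]=-\tfrac{\mathrm i}{2}(\mathbf b_{n,x}\mathbf r^{\mathrm T}+\mathbf q\mathbf c_{n,x}^{\mathrm T}),$$ $$\mathrm i\mathbf b_{n+1}=-\tfrac12\mathbf b_{n,x}+\tfrac12(\mathbf q a_{n+1}-\mathbf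 d_{n+1}\mathbf q),\quad \mathrm i\mathbf c_{n+1}=\tfrac12\mathbf c_{n,x}-\tfrac12(\mathbf d_{n+1}^{\mathrm T}\mathbf r-\mathbf r a_{n+1}).$$ The operator $L_1$ is $$L_1=\frac{\mathrm i}{2}\begin{pmatrix}I_N&0\\0&-I_N\end{pmatrix}+\frac14\begin{pmatrix}\mathbf q\partial_x^{-1}\mathbf r^{\mathrm T}+A&\mathbf q\partial_x^{-1}\mathbf q^{\mathrm T}+C\\ \mathbf r\partial_x^{-1}\mathbf r^{\mathrm T}+D&\mathbf r\partial_x^{-1}\mathbf q^{\mathrm T}+B\end{pmatrix},$$ where, with $\mathrm{ad}_X(Y)=[X,Y]$, $A(f)=[(\partial_x-\frac{\mathrm i}{2}\mathrm{ad}_{\mathbf q\mathbf r^{\mathrm T}})^{-1}(f\mathbf r^{\mathrm T})]\mathbf q$, $B(f)=[(\partial_x+\frac{\mathrm i}{2}\mathrm{ad}_{\mathbf r\mathbf q^{\mathrm T}})^{-1}(f\mathbf q^{\mathrm T})]\mathbf r$, $C(f)=[(\partial_x-\frac{\mathrm i}{2}\mathrm{ad}_{\mathbf q\mathbf r^{\mathrm T}})^{-1}(\mathbf q f^{\mathrm T})]\mathbf q$, $D(f)=[(\partial_x+\frac{\mathrm i}{2}\mathrm{ad}_{\mathbf r\mathbf q^{\mathrm T}})^{-1}(\mathbf r f^{\mathrm T})]\mathbf r$. Conventions (formal calculus): the inverses of $\partial_x$ and $\partial_x\pm\frac{\mathrm i}{2}\mathrm{ad}$ are formal inverses with zero integration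 constants, and integration by parts produces no boundary terms; the variational derivative is defined by $\frac{d}{d\epsilon}H(\omega+\epsilon\eta)|_{\epsilon=0}=\int\eta^{\mathrm T}\frac{\delta H}{\delta\omega}dx$; skew-symmetry is with respect to the bilinear pairing $\int f^{\mathrm T}g\,dx$. *)

theory Defs
  imports "HOL-Analysis.Analysis"
begin

section \<open>Formal calculus on decaying functions of a real variable\<close>

definition Dx :: "(real \<Rightarrow> 'a::real_normed_vector) \<Rightarrow> real \<Rightarrow> 'a" where
  "Dx f = (\<lambda>x. vector_derivative f (at x))"

text \<open>
  The formal calculus is realised on the smooth functions all of whose derivatives are Lebesgue
  integrable on the line.  Such a function tends to 0 at both ends together with all its
  derivatives, so integration by parts has no boundary terms.  The class contains the Schwartz
  functions and the smooth functions of compact support, and it is closed under products.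
\<close>

definition admissible :: "(real \<Rightarrow> 'a::euclidean_space) \<Rightarrow> bool" where
  "admissible f \<longleftrightarrow>
     (\<forall>k. (\<forall>x. (Dx ^^ k) f differentiable at x) \<and> integrable lborel ((Dx ^^ k) f))"

text \<open>
  Formal inverse, with zero integration constant, of a first-order operator such as \<open>Dx\<close> or
  \<open>Dx + c ad\<close>: the mean of the solution of \<open>P F = f\<close> vanishing at \<open>-\<infinity>\<close> and of the one
  vanishing at \<open>+\<infinity>\<close>.  For \<open>P = Dx\<close> this is
  \<open>(1/2) (integral from -\<infinity> to x - integral from x to \<infinity>)\<close>.  If \<open>P F = f\<close> has a
  solution that vanishes at both ends, then that solution is the inverse.  For a general
  admissible \<open>f\<close> the primitive need not decay; the mean is the choice for which integration by
  parts between two such primitives still has no boundary term.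
\<close>

definition inverse_from ::
  "real filter \<Rightarrow> ((real \<Rightarrow> 'a::real_normed_vector) \<Rightarrow> real \<Rightarrow> 'a) \<Rightarrow> (real \<Rightarrow> 'a) \<Rightarrow> real \<Rightarrow> 'a" where
  "inverse_from Z P f = (THE F. (\<forall>x. F differentiable at x) \<and> P F = f \<and> (F \<longlongrightarrow> 0) Z)"

definition formal_inverse ::
  "((real \<Rightarrow> 'a::real_normed_vector) \<Rightarrow> real \<Rightarrow> 'a) \<Rightarrow> (real \<Rightarrow> 'a) \<Rightarrow> real \<Rightarrow> 'a" where
  "formal_inverse P f =
     (\<lambda>x. (1/2) *\<^sub>R (inverse_from at_bot P f x + inverse_from at_top P f x))"


section \<open>Matrices\<close>

definition mscale :: "complex \<Rightarrow> complex^'m^'n \<Rightarrow> complex^'m^'n" (infixr "*\<^sub>M" 75) where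
  "c *\<^sub>M A = (\<chi> i j. c * A $ i $ j)"

definition outer :: "complex^'n \<Rightarrow> complex^'m \<Rightarrow> complex^'m^'n" where
  "outer u v = (\<chi> i j. u $ i * v $ j)"  \<comment> \<open>\<open>u v\<^sup>T\<close>\<close>

definition comm :: "complex^'n^'n \<Rightarrow> complex^'n^'n \<Rightarrow> complex^'n^'n" where
  "comm A B = A ** B - B ** A"

text \<open>The \<open>(1+N) \<times> (1+N)\<close> block matrix with rows \<open>(a, c\<^sup>T)\<close> and \<open>(b, d)\<close>; the index
  \<open>None\<close> is the scalar slot.\<close>

definition blk ::
  "complex \<Rightarrow> complex^'n \<Rightarrow> complex^'n \<Rightarrow> complex^'n^'n \<Rightarrow> complex^('n option)^('n option)" where
  "blk a c b d = (\<chi> i j. case i of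
       None \<Rightarrow> (case j of None \<Rightarrow> a | Some l \<Rightarrow> c $ l)
     | Some k \<Rightarrow> (case j of None \<Rightarrow> b $ k | Some l \<Rightarrow> d $ k $ l))"

definition sigma3 :: "complex^('n::finite option)^('n option)" where
  "sigma3 = blk 1 0 0 (- mat 1)"

definition Qmat :: "complex^'n \<Rightarrow> complex^'n \<Rightarrow> complex^('n option)^('n option)" where
  "Qmat q r = blk 0 r q 0"

definition Umat :: "complex^'n \<Rightarrow> complex^'n \<Rightarrow> complex \<Rightarrow> complex^('n option)^('n option)" where
  "Umat q r l = (\<i> * l powi (-2)) *\<^sub>M sigma3 + (l powi (-1)) *\<^sub>M Qmat q r"


section \<open>The formal solution \<open>W\<close> of the stationary equation\<close>

text \<open>\<open>cov_D s M\<close> is the operator \<open>Dx + s ad\<^sub>M\<close>.\<close>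

definition cov_D ::
  "complex \<Rightarrow> (real \<Rightarrow> complex^'n^'n) \<Rightarrow> (real \<Rightarrow> complex^'n^'n) \<Rightarrow> real \<Rightarrow> complex^'n^'n" where
  "cov_D s M F = (\<lambda>x. Dx F x + s *\<^sub>M comm (M x) (F x))"

function KN_a :: "complex \<Rightarrow> (real \<Rightarrow> complex^'n) \<Rightarrow> (real \<Rightarrow> complex^'n) \<Rightarrow> nat \<Rightarrow> real \<Rightarrow> complex"
  and KN_d :: "complex \<Rightarrow> (real \<Rightarrow> complex^'n) \<Rightarrow> (real \<Rightarrow> complex^'n) \<Rightarrow> nat \<Rightarrow> real \<Rightarrow> complex^'n^'n"
  and KN_b :: "complex \<Rightarrow> (real \<Rightarrow> complex^'n) \<Rightarrow> (real \<Rightarrow> complex^'n) \<Rightarrow> nat \<Rightarrow> real \<Rightarrow> complex^'n"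
  and KN_c :: "complex \<Rightarrow> (real \<Rightarrow> complex^'n) \<Rightarrow> (real \<Rightarrow> complex^'n) \<Rightarrow> nat \<Rightarrow> real \<Rightarrow> complex^'n"
where
  "KN_a \<alpha> q r 0 = (\<lambda>x. \<i> * \<alpha>)"
| "KN_d \<alpha> q r 0 = (\<lambda>x. mat (- \<i> * \<alpha>))"
| "KN_b \<alpha> q r 0 = (\<lambda>x. \<alpha> *s q x)"
| "KN_c \<alpha> q r 0 = (\<lambda>x. \<alpha> *s r x)"
| "KN_a \<alpha> q r (Suc n) = formal_inverse Dx
     (\<lambda>x. \<i>/2 * (scalar_product (r x) (Dx (KN_b \<alpha> q r n) x)
                 + scalar_product (Dx (KN_c \<alpha> q r n) x) (q x)))"
| "KN_d \<alpha> q r (Suc n) = formal_inverse (cov_D (-(\<i>/2)) (\<lambda>x. outer (q x) (r x)))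
     (\<lambda>x. (-(\<i>/2)) *\<^sub>M (outer (Dx (KN_b \<alpha> q r n) x) (r x)
                       + outer (q x) (Dx (KN_c \<alpha> q r n) x)))"
| "KN_b \<alpha> q r (Suc n) = (\<lambda>x. (1/\<i>) *s
     ((-(1/2)) *s Dx (KN_b \<alpha> q r n) x
      + (1/2) *s (KN_a \<alpha> q r (Suc n) x *s q x - KN_d \<alpha> q r (Suc n) x *v q x)))"
| "KN_c \<alpha> q r (Suc n) = (\<lambda>x. (1/\<i>) *s
     ((1/2) *s Dx (KN_c \<alpha> q r n) x
      - (1/2) *s (transpose (KN_d \<alpha> q r (Suc n) x) *v r x - KN_a \<alpha> q r (Suc n) x *s r x)))"
  by pat_completeness auto
termination
  by (relation "Wellfounded.measure (\<lambda>p. case p of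
        Inl (Inl (_, _, _, n)) \<Rightarrow> 2 * n
      | Inl (Inr (_, _, _, n)) \<Rightarrow> 2 * n
      | Inr (Inl (_, _, _, n)) \<Rightarrow> 2 * n + 1
      | Inr (Inr (_, _, _, n)) \<Rightarrow> 2 * n + 1)") auto

text \<open>\<open>KN_W \<alpha> q r k\<close> is the coefficient of \<open>\<lambda>\<^sup>k\<close> in the formal series \<open>W\<close>: \<open>a\<^sub>n, d\<^sub>n\<close> belong
  to \<open>\<lambda>\<^bsup>2n\<^esup>\<close>, and \<open>b\<^sub>n, c\<^sub>n\<close> to \<open>\<lambda>\<^bsup>2n+1\<^esup>\<close>.\<close>

definition KN_W ::
  "complex \<Rightarrow> (real \<Rightarrow> complex^'n) \<Rightarrow> (real \<Rightarrow> complex^'n) \<Rightarrow> int \<Rightarrow> real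
     \<Rightarrow> complex^('n option)^('n option)" where
  "KN_W \<alpha> q r k x =
     (let n = nat k div 2 in
      if k < 0 then 0
      else if even k then blk (KN_a \<alpha> q r n x) 0 0 (KN_d \<alpha> q r n x)
      else blk 0 (KN_c \<alpha> q r n x) (KN_b \<alpha> q r n x) 0)"

text \<open>\<open>W\<^sub>x = [U, W]\<close> as an identity of formal Laurent series, read off at each \<open>\<lambda>\<^sup>k\<close>.\<close>

definition stationary_zero_curvature ::
  "(real \<Rightarrow> complex^'n) \<Rightarrow> (real \<Rightarrow> complex^'n)
     \<Rightarrow> (int \<Rightarrow> real \<Rightarrow> complex^('n option)^('n option)) \<Rightarrow> bool" where
  "stationary_zero_curvature q r W \<longleftrightarrow>
     (\<forall>k x. (W k has_vector_derivative
        (comm (\<i> *\<^sub>M sigma3) (W (k + 2) x) + comm (Qmat (q x) (r x)) (W (k + 1) x))) (at x))"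

text \<open>\<open>V = (\<lambda>\<^bsup>-2(n+1)\<^esup> W)\<^sub>-\<close>, evaluated at a nonzero complex number \<open>l\<close>; the coefficients below
  \<open>\<lambda>\<^bsup>-2(n+1)\<^esup>\<close> vanish.\<close>

definition KN_V ::
  "complex \<Rightarrow> (real \<Rightarrow> complex^'n) \<Rightarrow> (real \<Rightarrow> complex^'n) \<Rightarrow> nat \<Rightarrow> complex \<Rightarrow> real
     \<Rightarrow> complex^('n option)^('n option)" where
  "KN_V \<alpha> q r n l x =
     (\<Sum>k \<in> {- 2 * (int n + 1) ..< 0}. (l powi k) *\<^sub>M KN_W \<alpha> q r (k + 2 * (int n + 1)) x)"


section \<open>Functionals and operators on \<open>\<omega> = (q, r)\<close>\<close>

type_synonym 'n field2 = "real \<Rightarrow> (complex^'n) \<times> (complex^'n)"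

definition pairing :: "'n::finite field2 \<Rightarrow> 'n field2 \<Rightarrow> complex" where
  "pairing f g = integral\<^sup>L lborel
     (\<lambda>x. scalar_product (fst (f x)) (fst (g x)) + scalar_product (snd (f x)) (snd (g x)))"

definition has_variational_derivative ::
  "('n::finite field2 \<Rightarrow> complex) \<Rightarrow> 'n field2 \<Rightarrow> 'n field2 \<Rightarrow> bool" where
  "has_variational_derivative H w g \<longleftrightarrow> admissible g \<and>
     (\<forall>\<eta>. admissible \<eta> \<longrightarrow>
        ((\<lambda>e::real. H (\<lambda>x. w x + e *\<^sub>R \<eta> x)) has_vector_derivative pairing \<eta> g) (at 0))"

definition variational_derivative ::
  "('n::finite field2 \<Rightarrow> complex) \<Rightarrow> 'n field2 \<Rightarrow> 'n field2" where
  "variational_derivative H w = (THE g. has_variational_derivative H w g)"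

definition skew_symmetric :: "('n::finite field2 \<Rightarrow> 'n field2) \<Rightarrow> bool" where
  "skew_symmetric T \<longleftrightarrow>
     (\<forall>f. admissible f \<longrightarrow> admissible (T f)) \<and>
     (\<forall>f g. admissible f \<longrightarrow> admissible g \<longrightarrow> pairing f (T g) = - pairing (T f) g)"

definition KN_H :: "complex \<Rightarrow> nat \<Rightarrow> 'n::finite field2 \<Rightarrow> complex" where
  "KN_H \<alpha> n w =
     (let q = (\<lambda>x. fst (w x)); r = (\<lambda>x. snd (w x)) in
      if n = 0 then \<alpha> * integral\<^sup>L lborel (\<lambda>x. scalar_product (q x) (r x))
      else - (1 / (2 * of_nat n)) * integral\<^sup>L lborel (\<lambda>x.
             2 * \<i> * (KN_a \<alpha> q r (n + 1) x - trace (KN_d \<alpha> q r (n + 1) x))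
             + scalar_product (KN_c \<alpha> q r n x) (q x) + scalar_product (r x) (KN_b \<alpha> q r n x)))"

text \<open>The operator \<open>f \<mapsto> u \<partial>\<^sub>x\<^sup>-\<^sup>1 (v\<^sup>T f)\<close>.\<close>

definition rank1_op ::
  "(real \<Rightarrow> complex^'n) \<Rightarrow> (real \<Rightarrow> complex^'n) \<Rightarrow> (real \<Rightarrow> complex^'n) \<Rightarrow> real \<Rightarrow> complex^'n" where
  "rank1_op u v f = (\<lambda>x. formal_inverse Dx (\<lambda>y. scalar_product (v y) (f y)) x *s u x)"

definition op_A ::
  "(real \<Rightarrow> complex^'n) \<Rightarrow> (real \<Rightarrow> complex^'n) \<Rightarrow> (real \<Rightarrow> complex^'n) \<Rightarrow> real \<Rightarrow> complex^'n" where
  "op_A q r f = (\<lambda>x. formal_inverse (cov_D (-(\<i>/2)) (\<lambda>y. outer (q y) (r y)))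
                        (\<lambda>y. outer (f y) (r y)) x *v q x)"

definition op_B ::
  "(real \<Rightarrow> complex^'n) \<Rightarrow> (real \<Rightarrow> complex^'n) \<Rightarrow> (real \<Rightarrow> complex^'n) \<Rightarrow> real \<Rightarrow> complex^'n" where
  "op_B q r f = (\<lambda>x. formal_inverse (cov_D (\<i>/2) (\<lambda>y. outer (r y) (q y)))
                        (\<lambda>y. outer (f y) (q y)) x *v r x)"

definition op_C ::
  "(real \<Rightarrow> complex^'n) \<Rightarrow> (real \<Rightarrow> complex^'n) \<Rightarrow> (real \<Rightarrow> complex^'n) \<Rightarrow> real \<Rightarrow> complex^'n" where
  "op_C q r f = (\<lambda>x. formal_inverse (cov_D (-(\<i>/2)) (\<lambda>y. outer (q y) (r y)))
                        (\<lambda>y. outer (q y) (f y)) x *v q x)"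

definition op_D ::
  "(real \<Rightarrow> complex^'n) \<Rightarrow> (real \<Rightarrow> complex^'n) \<Rightarrow> (real \<Rightarrow> complex^'n) \<Rightarrow> real \<Rightarrow> complex^'n" where
  "op_D q r f = (\<lambda>x. formal_inverse (cov_D (\<i>/2) (\<lambda>y. outer (r y) (q y)))
                        (\<lambda>y. outer (r y) (f y)) x *v r x)"

definition op_L1 ::
  "(real \<Rightarrow> complex^'n) \<Rightarrow> (real \<Rightarrow> complex^'n) \<Rightarrow> 'n field2 \<Rightarrow> 'n field2" where
  "op_L1 q r w =
     (let f = (\<lambda>x. fst (w x)); g = (\<lambda>x. snd (w x)) in
      (\<lambda>x. ((\<i>/2) *s f x
              + (1/4) *s ((rank1_op q r f x + op_A q r f x) + (rank1_op q q g x + op_C q r g x)),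
            (-(\<i>/2)) *s g x
              + (1/4) *s ((rank1_op r r f x + op_D q r f x) + (rank1_op r q g x + op_B q r g x)))))"

definition swap2 :: "'n::finite field2 \<Rightarrow> 'n field2" where
  "swap2 w = (\<lambda>x. (snd (w x), fst (w x)))"

definition op_J :: "'n::finite field2 \<Rightarrow> 'n field2" where
  "op_J w = (\<lambda>x. (Dx (\<lambda>y. snd (w y)) x, Dx (\<lambda>y. fst (w y)) x))"

definition op_L ::
  "(real \<Rightarrow> complex^'n) \<Rightarrow> (real \<Rightarrow> complex^'n) \<Rightarrow> 'n field2 \<Rightarrow> 'n field2" where
  "op_L q r w = swap2 (op_L1 q r (swap2 (Dx w)))"

end

theory Submission
  imports Defs
begin

text \<open>
  The recursion produces \<open>a\<^sub>n\<close> and \<open>d\<^sub>n\<close> by integration, so decay of the coefficients is not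
  evident.  Normalise \<open>\<alpha>\<^sub>0 = 1\<close> and construct \<open>W\<close> instead from \<open>W\<^sup>2 = -1\<close>, which fixes its diagonal
  blocks algebraically, and from the off-diagonal part of \<open>W\<^sub>x = [U, W]\<close>.  The defects
  \<open>S = W\<^sup>2 + 1\<close> and \<open>E = W\<^sub>x - [U, W]\<close> are then off-diagonal and diagonal respectively and satisfy
  \<open>S\<^sub>x - [U, S] = W E + E W\<close>; comparing lowest orders gives \<open>S = E = 0\<close>.  Hence all coefficients are
  differential polynomials in \<open>q, r\<close>, the primitives that occur vanish at both ends, and the
  recursion returns \<open>\<alpha>\<^sub>0 W\<close>.

  As \<open>W\<close> anticommutes with \<open>\<delta>W\<close> and \<open>\<partial>\<^sub>\<lambda>W\<close>, one finds
  \<open>\<partial>\<^sub>x tr (W [\<delta>W, \<partial>\<^sub>\<lambda>W]) = 4 tr (\<delta>U \<partial>\<^sub>\<lambda>W) - 4 tr (\<partial>\<^sub>\<lambda>U \<delta>W)\<close>; integrating and reading off one power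
  of \<open>\<lambda>\<close> gives the variational derivative of \<open>H\<^sub>n\<close>.  Along \<open>\<omega> + \<epsilon>\<eta>\<close> everything is polynomial in
  \<open>\<epsilon>\<close>, so differentiation under the integral is harmless.

  The formal inverse of \<open>\<partial>\<^sub>x + ad\<close> is antisymmetric because it is the mean of the two solutions
  decaying at one end.  This makes \<open>L\<^sub>1 S\<close> skew, \<open>S\<close> being the swap, and \<open>J L\<^sup>k\<close> inherits it.
\<close>

section \<open>Primitives of integrable functions\<close>

text \<open>\<open>W\<close> evolves by commutators with \<open>U\<close>, hence so does
  \<open>W * W\<close>, and a multiple of the unit solves that equation; the value -1 is
  \<open>(i sigma3)^2\<close>, the term of order zero. Commutation with \<open>sigma3\<close> is
  invertible on off-diagonal blocks and kills diagonal ones, anticommutation the reverse; so half of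
  each defect can be removed by choice of the next coefficient. As \<open>U\<close> has a pole at
  \<open>lambda = 0\<close>, every equation is multiplied by \<open>lambda^2\<close>, which leaves
  power series with matrix coefficients. The expression \<open>tr (W [D, T])\<close> is the
  Kirillov-Kostant form on the conjugation orbit of \<open>W\<close> at two tangent vectors.
  Commutator flow preserves it, so only the inhomogeneous terms in the equations of \<open>D\<close>
  and \<open>T\<close> contribute to its derivative. When \<open>L^k\<close> acts on an arbitrary
  field, the primitives need not decay. They are merely bounded with all derivatives, and
  admissibility returns because each is multiplied by \<open>q\<close> or \<open>r\<close>. This is
  why two classes of functions are used below, and why \<open>F' = f - B M F\<close> is solved on
  the whole line.\<close>

lemma vd_imp_diff: "(f has_vector_derivative f') (at x) \<Longrightarrow> f differentiable (at x)"
  unfolding has_vector_derivative_def differentiable_def by blast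

lemma vd_diff_iff: "f differentiable (at (x::real)) \<longleftrightarrow> (f has_vector_derivative Dx f x) (at x)"
  unfolding Dx_def by (auto simp: vector_derivative_works[symmetric] intro: vd_imp_diff)

lemma Dx_eqI: "(\<And>x. (f has_vector_derivative f' x) (at x)) \<Longrightarrow> Dx f = f'"
  unfolding Dx_def by (auto intro: vector_derivative_at)

lemma diff_continuous: "(\<And>x::real. f differentiable (at x)) \<Longrightarrow> continuous_on UNIV f"
  by (simp add: differentiable_imp_continuous_within continuous_at_imp_continuous_on)

lemma diff_borel:
  fixes f :: "real \<Rightarrow> 'a::real_normed_vector"
  assumes "\<And>x::real. f differentiable (at x)"
  shows "f \<in> borel_measurable lborel"
  using borel_measurable_continuous_onI[OF diff_continuous[OF assms]] by simp

definition primitive :: "(real \<Rightarrow> 'a::euclidean_space) \<Rightarrow> real \<Rightarrow> 'a" where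
  "primitive g x = (LINT y|lborel. indicator {..x} y *\<^sub>R g y)"

lemma integrable_indicator_atMost:
  fixes g :: "real \<Rightarrow> 'a::euclidean_space"
  assumes "integrable lborel g"
  shows "integrable lborel (\<lambda>y. indicator {..x} y *\<^sub>R g y)"
  using integrable_mult_indicator[OF _ assms, of "{..x}"] by simp

text \<open>The fundamental theorem of calculus for an integral from -infinity: near
  \<open>x\<close>, up to a constant, \<open>primitive g\<close> is an integral over a compact
  interval starting at \<open>x - 1\<close>.\<close>

lemma primitive_has_vector_derivative:
  fixes g :: "real \<Rightarrow> 'a::euclidean_space"
  assumes g: "integrable lborel g" and c: "continuous_on UNIV g"
  shows "(primitive g has_vector_derivative g x) (at x)"
proof -
  have *: "primitive g z = primitive g (x - 1) + integral {x - 1..z} g" if "x - 1 \<le> z" for z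
  proof -
    have ii: "integrable lborel (\<lambda>y. indicator {x - 1..z} y *\<^sub>R g y)"
      using integrable_mult_indicator[OF _ g, of "{x - 1..z}"] by simp
    \<comment> \<open>At \<open>y = x - 1\<close> both indicators on the right are 1, so the
      splitting holds only almost everywhere.\<close>
    have "indicator {..z} y *\<^sub>R g y = indicator {..x - 1} y *\<^sub>R g y + indicator {x - 1..z} y *\<^sub>R g y"
      if "y \<noteq> x - 1" for y
      using \<open>x - 1 \<le> z\<close> that by (auto simp: indicator_def)
    with AE_lborel_singleton[of "x - 1"] have "AE y in lborel. indicator {..z} y *\<^sub>R g y
        = indicator {..x - 1} y *\<^sub>R g y + indicator {x - 1..z} y *\<^sub>R g y"
      by (rule eventually_mono)
    then have "primitive g z
        = (LINT y|lborel. indicator {..x - 1} y *\<^sub>R g y + indicator {x - 1..z} y *\<^sub>R g y)"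
      unfolding primitive_def
      by (intro integral_cong_AE borel_measurable_integrable Bochner_Integration.integrable_add
          integrable_indicator_atMost[OF g] ii)
    also have "\<dots> = primitive g (x - 1) + (LINT y|lborel. indicator {x - 1..z} y *\<^sub>R g y)"
      unfolding primitive_def
      by (rule Bochner_Integration.integral_add[OF integrable_indicator_atMost[OF g] ii])
    also have "(LINT y|lborel. indicator {x - 1..z} y *\<^sub>R g y) = integral {x - 1..z} g"
      using set_borel_integral_eq_integral(2)[of "{x - 1..z}" g] ii
      by (simp add: set_integrable_def set_lebesgue_integral_def)
    finally show ?thesis .
  qed
  have "((\<lambda>z. primitive g (x - 1) + integral {x - 1..z} g) has_vector_derivative 0 + g x)
      (at x within {x - 1..x + 1})"
    by (intro has_vector_derivative_add has_vector_derivative_const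
        integral_has_vector_derivative continuous_on_subset[OF c]) auto
  then have "(primitive g has_vector_derivative g x) (at x within {x - 1..x + 1})"
    by (intro has_vector_derivative_transform[of x "{x - 1..x + 1}" "primitive g"
        "\<lambda>z. primitive g (x - 1) + integral {x - 1..z} g"] *) auto
  moreover have "at x within {x - 1..x + 1} = at x"
    by (rule at_within_interior) auto
  ultimately show ?thesis by simp
qed

lemma primitive_at_top:
  fixes g :: "real \<Rightarrow> 'a::euclidean_space"
  assumes g: "integrable lborel g"
  shows "(primitive g \<longlongrightarrow> integral\<^sup>L lborel g) at_top"
  using tendsto_integral_at_top[OF _ g] unfolding primitive_def[abs_def] by simp

lemma primitive_at_bot:
  fixes g :: "real \<Rightarrow> 'a::euclidean_space"
  assumes g: "integrable lborel g"
  shows "(primitive g \<longlongrightarrow> 0) at_bot"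
proof -
  have "((\<lambda>t. LINT y|lborel. indicator {..- t} y *\<^sub>R g y) \<longlongrightarrow> (LINT (y::real)|lborel. (0::'a))) at_top"
  proof (rule integral_dominated_convergence_at_top[where w = "\<lambda>y. norm (g y)"])
    show "\<forall>\<^sub>F i in at_top. AE x in lborel. norm (indicator {..- i} x *\<^sub>R g x) \<le> norm (g x)"
      by (intro always_eventually) (auto simp: indicator_def)
    have "((\<lambda>i. indicator {..- i} x *\<^sub>R g x) \<longlongrightarrow> 0) at_top" for x
      by (rule tendsto_eventually, rule eventually_mono[OF eventually_gt_at_top[of "- x"]])
        (auto simp: indicator_def)
    then show "AE x in lborel. ((\<lambda>i. indicator {..- i} x *\<^sub>R g x) \<longlongrightarrow> 0) at_top" by simp
    show "\<And>t. (\<lambda>y. indicator {..- t} y *\<^sub>R g y) \<in> borel_measurable lborel"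
      by (rule borel_measurable_integrable[OF integrable_indicator_atMost[OF g]])
  qed (use g in auto)
  then show ?thesis
    by (simp add: filterlim_at_bot_mirror primitive_def)
qed

lemma has_vector_derivative_zero_const:
  fixes F :: "real \<Rightarrow> 'a::euclidean_space"
  assumes "\<And>x. (F has_vector_derivative 0) (at x)"
  obtains c where "\<And>x. F x = c"
  using has_vector_derivative_zero_constant[of UNIV F] assms by auto

lemma limits_of_integrable_derivative:
  fixes F :: "real \<Rightarrow> 'a::euclidean_space"
  assumes F: "\<And>x. (F has_vector_derivative f x) (at x)"
    and f: "integrable lborel f" "continuous_on UNIV f"
  obtains c where "F = (\<lambda>x. c + primitive f x)"
    "(F \<longlongrightarrow> c) at_bot" "(F \<longlongrightarrow> c + integral\<^sup>L lborel f) at_top"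
proof -
  have "((\<lambda>x. F x - primitive f x) has_vector_derivative 0) (at x)" for x
    using has_vector_derivative_diff[OF F[of x] primitive_has_vector_derivative[OF f, of x]] by simp
  then obtain c where *: "\<And>x. F x - primitive f x = c"
    using has_vector_derivative_zero_const[of "\<lambda>x. F x - primitive f x"] by blast
  then have "F x = c + primitive f x" for x using *[of x] by (metis diff_add_cancel add.commute)
  then have c: "F = (\<lambda>x. c + primitive f x)" by blast
  show ?thesis
    using that[OF c] tendsto_add[OF tendsto_const primitive_at_bot[OF f(1)], of c]
      tendsto_add[OF tendsto_const primitive_at_top[OF f(1)], of c] c by simp
qed

lemma primitive_eqI:
  fixes F :: "real \<Rightarrow> 'a::euclidean_space"
  assumes F: "\<And>x. (F has_vector_derivative f x) (at x)"
    and f: "integrable lborel f" "continuous_on UNIV f" and a: "(F \<longlongrightarrow> a) at_bot"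
  shows "primitive f x = F x - a"
proof -
  obtain c where c: "F = (\<lambda>x. c + primitive f x)" and "(F \<longlongrightarrow> c) at_bot"
    using limits_of_integrable_derivative[OF F f] .
  then have "a = c" using a tendsto_unique[OF trivial_limit_at_bot_linorder] by metis
  then show ?thesis by (simp add: c)
qed

lemma integral_total_derivative:
  fixes F :: "real \<Rightarrow> 'a::euclidean_space"
  assumes F: "\<And>x. (F has_vector_derivative f x) (at x)"
    and f: "integrable lborel f" "continuous_on UNIV f"
    and a: "(F \<longlongrightarrow> a) at_bot" and b: "(F \<longlongrightarrow> b) at_top"
  shows "integral\<^sup>L lborel f = b - a"
proof -
  have "primitive f = (\<lambda>x. F x - a)" using primitive_eqI[OF F f a] by blast
  then have "(primitive f \<longlongrightarrow> b - a) at_top" using tendsto_diff[OF b tendsto_const] by simp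
  then show ?thesis using tendsto_unique[OF trivial_limit_at_top_linorder primitive_at_top[OF f(1)]] by metis
qed

lemma bounded_of_limits:
  fixes F :: "real \<Rightarrow> 'a::euclidean_space"
  assumes c: "continuous_on UNIV F" and "(F \<longlongrightarrow> a) at_bot" "(F \<longlongrightarrow> b) at_top"
  shows "bounded (range F)"
proof -
  have "\<forall>\<^sub>F x in at_bot. dist (F x) a < 1" "\<forall>\<^sub>F x in at_top. dist (F x) b < 1"
    using assms(2,3) by (auto simp: tendsto_iff)
  then obtain l u where lu: "\<And>x. x \<le> l \<Longrightarrow> dist (F x) a < 1" "\<And>x. u \<le> x \<Longrightarrow> dist (F x) b < 1"
    by (auto simp: eventually_at_bot_linorder eventually_at_top_linorder)
  have "range F \<subseteq> ball a 1 \<union> ball b 1 \<union> F ` {l..u}"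
  proof
    fix y assume "y \<in> range F"
    then obtain x where "y = F x" by blast
    then show "y \<in> ball a 1 \<union> ball b 1 \<union> F ` {l..u}"
      using lu(1)[of x] lu(2)[of x] by (cases "x \<le> l"; cases "u \<le> x") (simp_all add: dist_commute)
  qed
  moreover have "bounded (F ` {l..u})"
    by (intro compact_imp_bounded compact_continuous_image continuous_on_subset[OF c]) auto
  ultimately show ?thesis
    using bounded_subset[of "ball a 1 \<union> ball b 1 \<union> F ` {l..u}" "range F"] by simp
qed

text \<open>A nonzero limit would keep \<open>norm f\<close> above a positive constant on
  arbitrarily long intervals, which a finite integral excludes.\<close>

lemma integrable_limit_zero:
  fixes f :: "real \<Rightarrow> 'a::euclidean_space"
  assumes f: "integrable lborel f" and Z: "Z = at_bot \<or> Z = at_top" and lim: "(f \<longlongrightarrow> a) Z"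
  shows "a = 0"
proof (rule ccontr)
  assume "a \<noteq> 0"
  define c where "c = norm a / 2"
  have c: "c > 0" "norm a = 2 * c" using \<open>a \<noteq> 0\<close> by (auto simp: c_def)
  have "\<forall>\<^sub>F x in Z. norm (f x) > c"
    using order_tendstoD(1)[OF tendsto_norm[OF lim], of c] c by simp
  with Z have long: "\<exists>l. \<forall>x\<in>{l..l+N}. c \<le> norm (f x)" for N
  proof (elim disjE; hypsubst)
    assume "\<forall>\<^sub>F x in at_bot. norm (f x) > c"
    then obtain u where "\<And>x. x \<le> u \<Longrightarrow> norm (f x) > c" by (auto simp: eventually_at_bot_linorder)
    then show ?thesis by (intro exI[of _ "u - N"]) (simp add: less_imp_le)
  next
    assume "\<forall>\<^sub>F x in at_top. norm (f x) > c"
    then obtain u where "\<And>x. u \<le> x \<Longrightarrow> norm (f x) > c" by (auto simp: eventually_at_top_linorder)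
    then show ?thesis by (intro exI[of _ u]) (simp add: less_imp_le)
  qed
  define I where "I = (LINT x|lborel. norm (f x))"
  have I0: "I \<ge> 0" unfolding I_def by (rule Bochner_Integration.integral_nonneg) auto
  \<comment> \<open>Chosen so that \<open>c * N = I + c\<close> exceeds the integral.\<close>
  define N where "N = I / c + 1"
  have N: "N \<ge> 0" "c * N > I" using c I0 by (auto simp: N_def field_simps)
  obtain l where l: "\<forall>x\<in>{l..l+N}. c \<le> norm (f x)" using long by blast
  have "c * N = (LINT x|lborel. c * indicator {l..l+N} x)" using N by simp
  also have "\<dots> \<le> I" unfolding I_def
  proof (rule Bochner_Integration.integral_mono)
    show "integrable lborel (\<lambda>x. c * indicator {l..l + N} x)"
      using N by (intro integrable_mult_right integrable_real_indicator) auto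
    show "c * indicator {l..l + N} x \<le> norm (f x)" for x
      using l by (auto simp: indicator_def)
  qed (use f in auto)
  finally show False using N by simp
qed

text \<open>Integrability of the derivative gives limits at both ends, and integrability of
  \<open>F\<close> itself forces them to be 0. This is how boundary terms of admissible functions
  disappear.\<close>

lemma decay:
  fixes F :: "real \<Rightarrow> 'a::euclidean_space"
  assumes F: "\<And>x. (F has_vector_derivative f x) (at x)"
    and f: "integrable lborel f" "continuous_on UNIV f" and i: "integrable lborel F"
  shows "(F \<longlongrightarrow> 0) at_bot" "(F \<longlongrightarrow> 0) at_top" "bounded (range F)"
proof -
  obtain a b where ab: "(F \<longlongrightarrow> a) at_bot" "(F \<longlongrightarrow> b) at_top"
    using limits_of_integrable_derivative[OF F f] by metis
  show "(F \<longlongrightarrow> 0) at_bot" "(F \<longlongrightarrow> 0) at_top"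
    using integrable_limit_zero[OF i] ab by blast+
  have "continuous_on UNIV F" by (rule diff_continuous[OF vd_imp_diff[OF F]])
  then show "bounded (range F)" using bounded_of_limits ab by blast
qed

section \<open>Smooth functions with integrable or bounded derivatives\<close>

text \<open>The flag selects integrable (\<open>True\<close>) or bounded (\<open>False\<close>). A
  bounded factor preserves either property, so one proof of closure under products serves both
  classes.\<close>

definition tame :: "bool \<Rightarrow> (real \<Rightarrow> 'a::euclidean_space) \<Rightarrow> bool" where
  "tame i f \<longleftrightarrow> (\<forall>x. f differentiable (at x)) \<and> (if i then integrable lborel f else bounded (range f))"

text \<open>Differentiating first turns closure under the Leibniz rule into an induction on
  \<open>k\<close>; the iterates in \<open>admissible\<close> are recovered by
  \<open>Ck_funpow\<close>.\<close>

primrec Ck :: "bool \<Rightarrow> nat \<Rightarrow> (real \<Rightarrow> 'a::euclidean_space) \<Rightarrow> bool" where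
  "Ck i 0 f = tame i f"
| "Ck i (Suc k) f = (tame i f \<and> Ck i k (Dx f))"

definition bounded_smooth :: "(real \<Rightarrow> 'a::euclidean_space) \<Rightarrow> bool" where
  "bounded_smooth f \<longleftrightarrow> (\<forall>k. Ck False k f)"

lemma Ck_funpow: "Ck i k f \<longleftrightarrow> (\<forall>j\<le>k. tame i ((Dx ^^ j) f))"
proof (induction k arbitrary: f)
  case (Suc k)
  have "(\<forall>j\<le>Suc k. tame i ((Dx ^^ j) f)) \<longleftrightarrow> tame i f \<and> (\<forall>j\<le>k. tame i ((Dx ^^ Suc j) f))"
    by (metis Suc_le_mono bot_nat_0.extremum funpow_0 not0_implies_Suc)
  then show ?case using Suc by (simp add: funpow_Suc_right del: funpow.simps)
qed simp

lemma admissible_Ck: "admissible f \<longleftrightarrow> (\<forall>k. Ck True k f)"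
  unfolding admissible_def Ck_funpow by (auto simp: tame_def)

lemma Ck_tame: "Ck i k f \<Longrightarrow> tame i f"
  by (cases k) auto

lemma Ck_SucD: "Ck i (Suc k) f \<Longrightarrow> Ck i k f"
  by (auto simp: Ck_funpow)

lemma tame_vd: "tame i f \<Longrightarrow> (f has_vector_derivative Dx f x) (at x)"
  by (simp add: tame_def vd_diff_iff)

lemma tame_add: "tame i f \<Longrightarrow> tame i g \<Longrightarrow> tame i (\<lambda>x. f x + g x)"
  by (cases i) (auto simp: tame_def intro!: bounded_plus_comp)

lemma tame_linear:
  assumes "bounded_linear T" "tame i f"
  shows "tame i (\<lambda>x. T (f x))"
proof -
  have "(\<lambda>x. T (f x)) differentiable (at x)" for x
    using bounded_linear.has_vector_derivative[OF assms(1) tame_vd[OF assms(2)]] vd_imp_diff by blast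
  moreover have "bounded (range (\<lambda>x. T (f x)))" if "bounded (range f)"
    using bounded_linear_image[OF that assms(1)] by (simp add: image_image)
  ultimately show ?thesis
    using assms integrable_bounded_linear[OF assms(1), of lborel f] by (auto simp: tame_def)
qed

lemma tame_bilinear:
  assumes B: "bounded_bilinear B" and f: "tame False f" and g: "tame i g"
  shows "tame i (\<lambda>x. B (f x) (g x))"
proof -
  have d: "(\<lambda>x. B (f x) (g x)) differentiable (at x)" for x
    using bounded_bilinear.has_vector_derivative[OF B tame_vd[OF f] tame_vd[OF g]] vd_imp_diff by blast
  obtain K where K: "K \<ge> 0" "\<And>a b. norm (B a b) \<le> norm a * norm b * K"
    using bounded_bilinear.nonneg_bounded[OF B] by blast
  obtain C where C: "\<And>x. norm (f x) \<le> C" using f by (auto simp: tame_def bounded_iff)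
  have C0: "C \<ge> 0" using C[of 0] norm_ge_zero order_trans by blast
  have le: "norm (B (f x) (g x)) \<le> C * K * norm (g x)" for x
  proof -
    have "norm (f x) * norm (g x) * K \<le> C * norm (g x) * K"
      by (intro mult_right_mono K C) auto
    then show ?thesis using K(2)[of "f x" "g x"] by (simp add: mult_ac)
  qed
  show ?thesis
  proof (cases i)
    case True
    have "integrable lborel (\<lambda>x. B (f x) (g x))"
    proof (rule Bochner_Integration.integrable_bound)
      show "integrable lborel (\<lambda>x. C * K * norm (g x))"
        using g True by (auto simp: tame_def)
      show "(\<lambda>x. B (f x) (g x)) \<in> borel_measurable lborel" using diff_borel d by blast
      show "AE x in lborel. norm (B (f x) (g x)) \<le> norm (C * K * norm (g x))"
        using le K(1) C0 by (auto simp: abs_mult)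
    qed
    then show ?thesis using d True by (auto simp: tame_def)
  next
    case False
    obtain E where E: "\<And>x. norm (g x) \<le> E" using g False by (auto simp: tame_def bounded_iff)
    have "norm (B (f x) (g x)) \<le> C * K * E" for x
      using le[of x] mult_left_mono[OF E[of x], of "C * K"] C0 K(1) by (smt (verit) mult_nonneg_nonneg)
    then show ?thesis using d False by (auto simp: tame_def bounded_iff)
  qed
qed

lemma Dx_add: "tame i f \<Longrightarrow> tame i g \<Longrightarrow> Dx (\<lambda>x. f x + g x) = (\<lambda>x. Dx f x + Dx g x)"
  by (rule Dx_eqI[OF has_vector_derivative_add[OF tame_vd tame_vd]])

lemma Dx_linear: "bounded_linear T \<Longrightarrow> tame i f \<Longrightarrow> Dx (\<lambda>x. T (f x)) = (\<lambda>x. T (Dx f x))"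
  by (rule Dx_eqI[OF bounded_linear.has_vector_derivative[OF _ tame_vd]])

lemma Dx_bilinear: "bounded_bilinear B \<Longrightarrow> tame i f \<Longrightarrow> tame j g \<Longrightarrow>
    Dx (\<lambda>x. B (f x) (g x)) = (\<lambda>x. B (f x) (Dx g x) + B (Dx f x) (g x))"
  by (rule Dx_eqI[OF bounded_bilinear.has_vector_derivative[OF _ tame_vd tame_vd]])

lemma Ck_add: "Ck i k f \<Longrightarrow> Ck i k g \<Longrightarrow> Ck i k (\<lambda>x. f x + g x)"
  by (induction k arbitrary: f g) (simp_all add: tame_add Dx_add[of i])

lemma Ck_linear: "bounded_linear T \<Longrightarrow> Ck i k f \<Longrightarrow> Ck i k (\<lambda>x. T (f x))"
  by (induction k arbitrary: f) (simp_all add: tame_linear Dx_linear[of T i])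

text \<open>The first factor is bounded and the second of either kind, since a product of two merely
  integrable functions need not be integrable.\<close>

lemma Ck_bilinear: "bounded_bilinear B \<Longrightarrow> Ck False k f \<Longrightarrow> Ck i k g \<Longrightarrow> Ck i k (\<lambda>x. B (f x) (g x))"
proof (induction k arbitrary: f g)
  case (Suc k)
  then have "tame False f" "tame i g" by auto
  moreover have "Ck i k (\<lambda>x. B (f x) (Dx g x) + B (Dx f x) (g x))"
    using Suc.prems Ck_SucD[OF Suc.prems(2)] Ck_SucD[OF Suc.prems(3)]
    by (intro Ck_add Suc.IH) simp_all
  ultimately show ?case
    using Suc.prems(1) by (simp add: tame_bilinear Dx_bilinear[of B False f i g])
qed (auto simp: tame_bilinear)

lemma admissible_tame: "admissible f \<Longrightarrow> tame True f"
  by (auto simp: admissible_Ck intro: Ck_tame)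

lemma bounded_smooth_tame: "bounded_smooth f \<Longrightarrow> tame False f"
  by (auto simp: bounded_smooth_def intro: Ck_tame)

lemma admissible_Dx: "admissible f \<Longrightarrow> admissible (Dx f)"
  unfolding admissible_Ck by (meson Ck.simps(2))

lemma admissible_vd: "admissible f \<Longrightarrow> (f has_vector_derivative Dx f x) (at x)"
  using admissible_tame tame_vd by blast

lemma bounded_smooth_vd: "bounded_smooth f \<Longrightarrow> (f has_vector_derivative Dx f x) (at x)"
  using bounded_smooth_tame tame_vd by blast

lemma admissible_integrable: "admissible f \<Longrightarrow> integrable lborel f"
  using admissible_tame by (auto simp: tame_def)

lemma admissible_continuous: "admissible f \<Longrightarrow> continuous_on UNIV f"
  by (rule diff_continuous[OF vd_imp_diff[OF admissible_vd]])

lemma bounded_smooth_bounded: "bounded_smooth f \<Longrightarrow> bounded (range f)"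
  using bounded_smooth_tame by (auto simp: tame_def)

lemma admissible_decay:
  assumes "admissible f"
  shows "(f \<longlongrightarrow> 0) at_bot" "(f \<longlongrightarrow> 0) at_top" "bounded (range f)"
  using decay[OF admissible_vd[OF assms] admissible_integrable[OF admissible_Dx[OF assms]]
      admissible_continuous[OF admissible_Dx[OF assms]] admissible_integrable[OF assms]] by auto

text \<open>Every derivative of an admissible function is again admissible and therefore bounded; so
  admissible functions may serve as multipliers.\<close>

lemma admissible_bounded_smooth:
  assumes "admissible f" shows "bounded_smooth f"
proof -
  have *: "tame False f" if "admissible f" for f :: "real \<Rightarrow> 'a"
    using admissible_decay(3)[OF that] admissible_tame[OF that] by (simp add: tame_def)
  have "Ck False k f" for k
    using assms
  proof (induction k arbitrary: f)
    case (Suc k)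
    then show ?case using *[of f] admissible_Dx[of f] by simp
  qed (simp add: *)
  then show ?thesis by (simp add: bounded_smooth_def)
qed

lemma admissible_add: "admissible f \<Longrightarrow> admissible g \<Longrightarrow> admissible (\<lambda>x. f x + g x)"
  by (simp add: admissible_Ck Ck_add)

lemma bounded_smooth_add: "bounded_smooth f \<Longrightarrow> bounded_smooth g \<Longrightarrow> bounded_smooth (\<lambda>x. f x + g x)"
  by (simp add: bounded_smooth_def Ck_add)

lemma admissible_linear: "bounded_linear T \<Longrightarrow> admissible f \<Longrightarrow> admissible (\<lambda>x. T (f x))"
  by (simp add: admissible_Ck Ck_linear)

lemma bounded_smooth_linear: "bounded_linear T \<Longrightarrow> bounded_smooth f \<Longrightarrow> bounded_smooth (\<lambda>x. T (f x))"
  by (simp add: bounded_smooth_def Ck_linear)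

lemma admissible_bilinear_left:
  "bounded_bilinear B \<Longrightarrow> bounded_smooth f \<Longrightarrow> admissible g \<Longrightarrow> admissible (\<lambda>x. B (f x) (g x))"
  by (simp add: admissible_Ck bounded_smooth_def Ck_bilinear)

lemma admissible_bilinear_right:
  "bounded_bilinear B \<Longrightarrow> admissible f \<Longrightarrow> bounded_smooth g \<Longrightarrow> admissible (\<lambda>x. B (f x) (g x))"
  using admissible_bilinear_left[OF bounded_bilinear.flip[of B]] by blast

lemma admissible_bilinear:
  "bounded_bilinear B \<Longrightarrow> admissible f \<Longrightarrow> admissible g \<Longrightarrow> admissible (\<lambda>x. B (f x) (g x))"
  by (simp add: admissible_bilinear_left admissible_bounded_smooth)

lemma admissible_zero: "admissible (\<lambda>x. 0)"
proof -
  have "(Dx ^^ k) (\<lambda>x. 0::'a) = (\<lambda>x. 0)" for k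
    by (induction k) (simp_all add: Dx_def)
  then show ?thesis by (simp add: admissible_def)
qed

text \<open>Nonzero constants are not admissible; the larger class has to contain them because the
  leading coefficient of \<open>W\<close> is constant.\<close>

lemma bounded_smooth_const: "bounded_smooth (\<lambda>x. c :: 'a::euclidean_space)"
proof -
  have "admissible (\<lambda>x. 0::'a)" by (rule admissible_zero)
  then have "Ck False k (\<lambda>x. 0::'a)" for k
    using admissible_bounded_smooth[of "\<lambda>x. 0::'a"] by (simp add: bounded_smooth_def)
  moreover have "Dx (\<lambda>x. c) = (\<lambda>x. 0::'a)" by (simp add: Dx_def)
  ultimately show ?thesis
    unfolding bounded_smooth_def
    by (intro allI, case_tac k) (simp_all add: tame_def image_constant_conv)
qed

lemma admissible_sum:
  "(\<And>i. i \<in> I \<Longrightarrow> admissible (f i)) \<Longrightarrow> admissible (\<lambda>x. \<Sum>i\<in>I. f i x)"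
proof (induction I rule: infinite_finite_induct)
  case (insert i I)
  then show ?case using admissible_add[of "f i" "\<lambda>x. \<Sum>i\<in>I. f i x"] by simp
qed (simp_all add: admissible_zero)

lemma admissible_uminus: "admissible f \<Longrightarrow> admissible (\<lambda>x. - f x)"
  by (rule admissible_linear[OF bounded_linear_minus[OF bounded_linear_ident]])

lemma admissible_diff: "admissible f \<Longrightarrow> admissible g \<Longrightarrow> admissible (\<lambda>x. f x - g x)"
  using admissible_add[of f "\<lambda>x. - g x"] admissible_uminus[of g] by simp

section \<open>Linear equations with decaying solutions\<close>

lemma norm_primitive_le:
  fixes g :: "real \<Rightarrow> 'a::euclidean_space"
  assumes g: "integrable lborel g" and h: "integrable lborel h" and le: "\<And>y. norm (g y) \<le> h y"
  shows "norm (primitive g x) \<le> primitive h x"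
proof -
  have "norm (primitive g x) \<le> (LINT y|lborel. norm (indicator {..x} y *\<^sub>R g y))"
    unfolding primitive_def by (rule integral_norm_bound)
  also have "\<dots> \<le> primitive h x"
    unfolding primitive_def
  proof (rule Bochner_Integration.integral_mono)
    show "integrable lborel (\<lambda>y. norm (indicator {..x} y *\<^sub>R g y))"
      by (intro integrable_norm integrable_indicator_atMost g)
    show "integrable lborel (\<lambda>y. indicator {..x} y *\<^sub>R h y)"
      by (rule integrable_indicator_atMost[OF h])
    show "norm (indicator {..x} y *\<^sub>R g y) \<le> indicator {..x} y *\<^sub>R h y" for y
      using le[of y] by (simp add: indicator_def)
  qed
  finally show ?thesis .
qed

lemma primitive_nonneg_le:
  assumes "integrable lborel h" "\<And>y. 0 \<le> h y"
  shows "0 \<le> primitive h x" "primitive h x \<le> integral\<^sup>L lborel (h :: real \<Rightarrow> real)"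
proof -
  show "0 \<le> primitive h x" unfolding primitive_def
    by (rule Bochner_Integration.integral_nonneg) (simp add: assms)
  show "primitive h x \<le> integral\<^sup>L lborel h" unfolding primitive_def
  proof (rule Bochner_Integration.integral_mono)
    show "integrable lborel (\<lambda>y. indicator {..x} y *\<^sub>R h y)"
      by (rule integrable_indicator_atMost[OF assms(1)])
  qed (use assms in \<open>auto simp: indicator_def\<close>)
qed

text \<open>Picard iteration contracts on the whole half line in the sup norm with the weight
  \<open>exp (- w)\<close>, where \<open>w' = 2 K \<bar>M\<bar>\<close>.\<close>

lemma ode_solution_at_bot:
  fixes B :: "'m::euclidean_space \<Rightarrow> 'a::euclidean_space \<Rightarrow> 'a"
  assumes B: "bounded_bilinear B"
    and M: "integrable lborel M" "continuous_on UNIV M"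
    and f: "integrable lborel f" "continuous_on UNIV f"
  obtains F where "\<And>x. (F has_vector_derivative f x - B (M x) (F x)) (at x)"
    "(F \<longlongrightarrow> 0) at_bot" "bounded (range F)"
proof -
  interpret B: bounded_bilinear B by (rule B)
  obtain K where K: "K \<ge> 0" "\<And>a b. norm (B a b) \<le> norm a * norm b * K"
    using B.nonneg_bounded by blast
  define m where "m x = 2 * K * norm (M x)" for x
  define w where "w = primitive m"
  define W where "W = integral\<^sup>L lborel m"
  have m: "integrable lborel m" "continuous_on UNIV m" "\<And>x. 0 \<le> m x"
    unfolding m_def using K(1)
    by (auto intro!: integrable_mult_right integrable_norm M continuous_intros)
  have w_vd: "(w has_vector_derivative m x) (at x)" for x
    unfolding w_def by (rule primitive_has_vector_derivative[OF m(1,2)])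
  have w_cont: "continuous_on UNIV w" by (rule diff_continuous[OF vd_imp_diff[OF w_vd]])
  have w0: "0 \<le> w x" and wW: "w x \<le> W" for x
    unfolding w_def W_def using primitive_nonneg_le[OF m(1,3)] by auto
  \<comment> \<open>The unknown is written as \<open>F = exp w * G\<close> with \<open>G\<close>
    bounded, so that the sup norm of \<open>G\<close> is the weighted norm of \<open>F\<close>;
    \<open>g G\<close> is \<open>f - B M F\<close> in these terms.\<close>
  define g where "g G y = f y - exp (w y) *\<^sub>R B (M y) (G y)" for G :: "real \<Rightarrow>\<^sub>C 'a" and y
  have g_cont: "continuous_on UNIV (g G)" for G
    unfolding g_def by (intro continuous_intros B.continuous_on w_cont M f) auto
  have g_int: "integrable lborel (g G)" for G
  proof -
    obtain C where C: "\<And>x. norm (G x) \<le> C"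
      using bounded_apply_bcontfun[of G] unfolding bounded_iff by blast
    have "integrable lborel (\<lambda>y. exp (w y) *\<^sub>R B (M y) (G y))"
    proof (rule Bochner_Integration.integrable_bound)
      show "integrable lborel (\<lambda>y. exp W * (norm (M y) * (C * K)))"
        by (intro integrable_mult_right integrable_mult_left integrable_norm M)
      have "continuous_on UNIV (\<lambda>y. exp (w y) *\<^sub>R B (M y) (G y))"
        by (intro continuous_intros B.continuous_on w_cont M) auto
      then show "(\<lambda>y. exp (w y) *\<^sub>R B (M y) (G y)) \<in> borel_measurable lborel"
        using borel_measurable_continuous_onI by simp
      have "norm (exp (w y) *\<^sub>R B (M y) (G y)) \<le> exp W * (norm (M y) * (C * K))" for y
      proof -
        have "norm (B (M y) (G y)) \<le> norm (M y) * norm (G y) * K"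
          by (rule K(2))
        also have "\<dots> \<le> norm (M y) * C * K"
          by (intro mult_right_mono mult_left_mono C K) auto
        finally have "norm (B (M y) (G y)) \<le> norm (M y) * (C * K)"
          by (simp add: mult_ac)
        then show ?thesis
          unfolding norm_scaleR using wW[of y] by (intro mult_mono) auto
      qed
      then show "AE y in lborel. norm (exp (w y) *\<^sub>R B (M y) (G y))
          \<le> norm (exp W * (norm (M y) * (C * K)))"
        by (intro AE_I2) (metis abs_ge_self order_trans real_norm_def)
    qed
    then show ?thesis unfolding g_def by (intro Bochner_Integration.integrable_diff f)
  qed
  define T where "T G x = exp (- w x) *\<^sub>R primitive (g G) x" for G x
  have T_mem: "T G \<in> bcontfun" for G
  proof -
    have "continuous_on UNIV (primitive (g G))"
      by (rule diff_continuous[OF vd_imp_diff[OF primitive_has_vector_derivative[OF g_int g_cont]]])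
    then have "continuous_on UNIV (T G)"
      unfolding T_def by (intro continuous_intros w_cont)
    moreover have "norm (T G x) \<le> (LINT y|lborel. norm (g G y))" for x
    proof -
      have "norm (T G x) \<le> 1 * norm (primitive (g G) x)"
        unfolding T_def norm_scaleR using w0[of x] by (intro mult_right_mono) auto
      also have "\<dots> \<le> primitive (\<lambda>y. norm (g G y)) x"
        using norm_primitive_le[OF g_int integrable_norm[OF g_int]] by simp
      also have "\<dots> \<le> (LINT y|lborel. norm (g G y))"
        by (rule primitive_nonneg_le) (auto intro: g_int)
      finally show ?thesis .
    qed
    ultimately show ?thesis unfolding bcontfun_def bounded_iff by blast
  qed
  define TT where "TT G = Bcontfun (T G)" for G
  have TT: "apply_bcontfun (TT G) = T G" for G
    unfolding TT_def by (rule Bcontfun_inverse[OF T_mem])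
  have "dist (TT G) (TT H) \<le> 1/2 * dist G H" for G H :: "real \<Rightarrow>\<^sub>C 'a"
  proof (rule dist_bound)
    fix x
    define d where "d = dist G H"
    have d: "norm (G y - H y) \<le> d" for y
      using dist_bounded[of G y H] by (simp add: d_def dist_norm)
    \<comment> \<open>The bound \<open>exp w * norm M * d * K\<close> for the difference of two
      integrands equals \<open>h\<close> because \<open>m\<close> carries the factor 2. It is the
      exact derivative of \<open>d / 2 * exp w\<close>, whence the contraction constant 1/2.\<close>
    define h where "h y = d / 2 * (exp (w y) * m y)" for y
    have h_vd: "((\<lambda>y. d / 2 * exp (w y)) has_vector_derivative h y) (at y)" for y
      using w_vd[of y] unfolding h_def has_real_derivative_iff_has_vector_derivative[symmetric]
      by (auto intro!: derivative_eq_intros)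
    have h_cont: "continuous_on UNIV h"
      unfolding h_def by (intro continuous_intros w_cont m)
    have h_int: "integrable lborel h"
    proof (rule Bochner_Integration.integrable_bound)
      show "integrable lborel (\<lambda>y. d / 2 * (exp W * m y))"
        by (intro integrable_mult_right m)
      show "h \<in> borel_measurable lborel"
        using borel_measurable_continuous_onI[OF h_cont] by simp
      show "AE y in lborel. norm (h y) \<le> norm (d / 2 * (exp W * m y))"
        unfolding h_def using wW m(3) by (intro AE_I2) (auto simp: abs_mult intro!: mult_mono)
    qed
    have h_bot: "((\<lambda>y. d / 2 * exp (w y)) \<longlongrightarrow> d / 2 * exp 0) at_bot"
      unfolding w_def by (intro tendsto_intros primitive_at_bot m)
    have "norm (primitive (g G) x - primitive (g H) x) = norm (primitive (\<lambda>y. g G y - g H y) x)"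
      unfolding primitive_def
      by (subst Bochner_Integration.integral_diff[symmetric])
        (auto intro!: integrable_indicator_atMost g_int simp: scaleR_diff_right)
    moreover have "norm (primitive (\<lambda>y. g G y - g H y) x) \<le> primitive h x"
    proof (rule norm_primitive_le[OF _ h_int])
      show "integrable lborel (\<lambda>y. g G y - g H y)"
        by (intro Bochner_Integration.integrable_diff g_int)
      show "norm (g G y - g H y) \<le> h y" for y
      proof -
        have "g G y - g H y = - (exp (w y) *\<^sub>R B (M y) (G y - H y))"
          unfolding g_def by (simp add: B.diff_right algebra_simps)
        then have "norm (g G y - g H y)
            = exp (w y) * norm (B (M y) (G y - H y))" by simp
        also have "\<dots> \<le> exp (w y) * (norm (M y) * d * K)"
          by (intro mult_left_mono order_trans[OF K(2)] mult_right_mono d K) auto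
        also have "\<dots> = h y" by (simp add: h_def m_def)
        finally show ?thesis .
      qed
    qed
    moreover have "primitive h x = d / 2 * exp (w x) - d / 2"
      using primitive_eqI[OF h_vd h_int h_cont h_bot] by simp
    ultimately have le: "norm (primitive (g G) x - primitive (g H) x) \<le> d / 2 * exp (w x)"
      using zero_le_dist[of G H] unfolding d_def by linarith
    have "dist (apply_bcontfun (TT G) x) (apply_bcontfun (TT H) x)
        = exp (- w x) * norm (primitive (g G) x - primitive (g H) x)"
      unfolding TT T_def dist_norm by (simp flip: scaleR_diff_right)
    also have "\<dots> \<le> exp (- w x) * (d / 2 * exp (w x))"
      by (intro mult_left_mono le) auto
    also have "\<dots> = d / 2" by (simp add: exp_minus field_simps)
    finally show "dist (apply_bcontfun (TT G) x) (apply_bcontfun (TT H) x) \<le> 1/2 * dist G H"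
      by (simp add: d_def)
  qed
  then have "\<exists>!G. TT G = G" by (intro banach_fix_type[of "1/2"]) auto
  then obtain G where "TT G = G" by blast
  then have G: "G x = exp (- w x) *\<^sub>R primitive (g G) x" for x
    using TT[of G] by (simp add: T_def fun_eq_iff)
  define F where "F = primitive (g G)"
  have F: "F x = exp (w x) *\<^sub>R G x" for x
    unfolding G F_def by (simp flip: exp_add)
  have "(F has_vector_derivative f x - B (M x) (F x)) (at x)" for x
  proof -
    have "g G x = f x - B (M x) (F x)" by (simp add: g_def F B.scaleR_right)
    then show ?thesis
      unfolding F_def using primitive_has_vector_derivative[OF g_int[of G] g_cont] by metis
  qed
  moreover have "(F \<longlongrightarrow> 0) at_bot" unfolding F_def by (rule primitive_at_bot[OF g_int])
  moreover have "norm (F x) \<le> (LINT y|lborel. norm (g G y))" for x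
    unfolding F_def
    by (rule order_trans[OF norm_primitive_le[OF g_int integrable_norm[OF g_int]] primitive_nonneg_le(2)])
      (auto intro: g_int)
  then have "bounded (range F)" by (auto simp: bounded_iff)
  ultimately show ?thesis by (rule that)
qed

text \<open>The end +infinity reduces to -infinity by \<open>x -> -x\<close>: reflection changes the
  sign of the derivative, hence of both \<open>f\<close> and \<open>M\<close>.\<close>

lemma ode_solution:
  fixes B :: "'m::euclidean_space \<Rightarrow> 'a::euclidean_space \<Rightarrow> 'a"
  assumes B: "bounded_bilinear B"
    and M: "integrable lborel M" "continuous_on UNIV M"
    and f: "integrable lborel f" "continuous_on UNIV f"
    and Z: "Z = at_bot \<or> Z = at_top"
  obtains F where "\<And>x. (F has_vector_derivative f x - B (M x) (F x)) (at x)"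
    "(F \<longlongrightarrow> 0) Z" "bounded (range F)"
  using Z
proof
  assume "Z = at_bot"
  then show ?thesis using ode_solution_at_bot[OF B M f] that by blast
next
  assume Z: "Z = at_top"
  interpret B: bounded_bilinear B by (rule B)
  have r: "integrable lborel (\<lambda>x. - u (- x))" if "integrable lborel u" for u :: "real \<Rightarrow> 'b::euclidean_space"
    using lborel_integrable_real_affine[OF that, of "-1" 0] by simp
  have c: "continuous_on UNIV (\<lambda>x. - u (- x))" if "continuous_on UNIV u" for u :: "real \<Rightarrow> 'b::euclidean_space"
    by (intro continuous_intros continuous_on_compose2[OF that]) auto
  obtain G where G: "\<And>x. (G has_vector_derivative - f (- x) - B (- M (- x)) (G x)) (at x)"
      "(G \<longlongrightarrow> 0) at_bot" "bounded (range G)"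
    using ode_solution_at_bot[OF B r[OF M(1)] c[OF M(2)] r[OF f(1)] c[OF f(2)]] by blast
  define F where "F x = G (- x)" for x
  have "(F has_vector_derivative f x - B (M x) (F x)) (at x)" for x
  proof -
    have "(G has_vector_derivative (- f x + B (M x) (G (- x)))) (at (- x))"
      using G(1)[of "- x"] by (simp add: B.minus_left)
    then have "((G \<circ> uminus) has_vector_derivative (- 1) *\<^sub>R (- f x + B (M x) (G (- x)))) (at x)"
      by (intro vector_diff_chain_at) (auto intro!: derivative_eq_intros)
    then show ?thesis by (simp add: F_def[abs_def] comp_def)
  qed
  moreover have "(F \<longlongrightarrow> 0) at_top"
    using G(2) by (simp add: F_def[abs_def] filterlim_at_bot_mirror)
  moreover have "bounded (range F)"
    by (rule bounded_subset[OF G(3)]) (auto simp: F_def)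
  ultimately show ?thesis using that Z by blast
qed

text \<open>A Gronwall argument for the squared norm \<open>N\<close> of \<open>H\<close>:
  \<open>abs N' <= m * N\<close>, so \<open>exp w * N\<close> increases and
  \<open>exp (- w) * N\<close> decreases, and as \<open>w\<close> is bounded both tend to 0 where
  \<open>H\<close> does. For the end -infinity the decreasing one is at most its limit 0, for
  +infinity the increasing one.\<close>

lemma ode_unique:
  fixes B :: "'m::euclidean_space \<Rightarrow> 'a::euclidean_space \<Rightarrow> 'a"
  assumes B: "bounded_bilinear B"
    and M: "integrable lborel M" "continuous_on UNIV M"
    and Z: "Z = at_bot \<or> Z = at_top"
    and H: "\<And>x. (H has_vector_derivative - B (M x) (H x)) (at x)" "(H \<longlongrightarrow> 0) Z"
  shows "H x = 0"
proof -
  obtain K where K: "K \<ge> 0" "\<And>a b. norm (B a b) \<le> norm a * norm b * K"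
    using bounded_bilinear.nonneg_bounded[OF B] by blast
  define m where "m x = 2 * K * norm (M x)" for x
  define w where "w = primitive m"
  define W where "W = integral\<^sup>L lborel m"
  have m: "integrable lborel m" "continuous_on UNIV m" "\<And>x. 0 \<le> m x"
    unfolding m_def using K(1)
    by (auto intro!: integrable_mult_right integrable_norm M continuous_intros)
  have w_vd: "(w has_real_derivative m x) (at x)" for x
    unfolding w_def has_real_derivative_iff_has_vector_derivative
    by (rule primitive_has_vector_derivative[OF m(1,2)])
  have w0: "0 \<le> w x" and wW: "w x \<le> W" for x
    unfolding w_def W_def using primitive_nonneg_le[OF m(1,3)] by auto
  define N where "N x = H x \<bullet> H x" for x
  define N' where "N' x = 2 * (H x \<bullet> (- B (M x) (H x)))" for x
  have N_vd: "(N has_real_derivative N' x) (at x)" for x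
    unfolding has_real_derivative_iff_has_vector_derivative N_def N'_def
    using bounded_bilinear.has_vector_derivative[OF bounded_bilinear_inner H(1) H(1)]
    by (simp add: inner_commute)
  have N0: "0 \<le> N x" for x by (simp add: N_def)
  have N'_le: "\<bar>N' x\<bar> \<le> m x * N x" for x
  proof -
    have "\<bar>N' x\<bar> \<le> 2 * (norm (H x) * norm (B (M x) (H x)))"
      unfolding N'_def using Cauchy_Schwarz_ineq2[of "H x" "- B (M x) (H x)"] by (simp add: abs_mult)
    also have "\<dots> \<le> 2 * (norm (H x) * (norm (M x) * norm (H x) * K))"
      by (intro mult_left_mono K) auto
    also have "\<dots> = m x * N x"
      by (simp add: m_def N_def dot_square_norm power2_eq_square)
    finally show ?thesis .
  qed
  have N_lim: "(N \<longlongrightarrow> 0) Z"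
    unfolding N_def using tendsto_inner[OF H(2) H(2)] by simp
  have "N x \<le> 0" using Z
  proof
    assume Z: "Z = at_bot"
    define \<phi> where "\<phi> x = exp (- w x) * N x" for x
    have "\<phi> x \<le> \<phi> y" if "y \<le> x" for y
    proof (rule DERIV_nonpos_imp_nonincreasing[OF that])
      fix t
      have "(\<phi> has_real_derivative exp (- w t) * (N' t - m t * N t)) (at t)"
        unfolding \<phi>_def by (auto intro!: derivative_eq_intros w_vd N_vd simp: algebra_simps)
      moreover have "exp (- w t) * (N' t - m t * N t) \<le> 0"
        using N'_le[of t] by (intro mult_nonneg_nonpos) auto
      ultimately show "\<exists>y. (\<phi> has_real_derivative y) (at t) \<and> y \<le> 0" by blast
    qed
    moreover have "(\<phi> \<longlongrightarrow> 0) at_bot"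
    proof (rule Lim_null_comparison)
      show "\<forall>\<^sub>F x in at_bot. norm (\<phi> x) \<le> N x"
        unfolding \<phi>_def using w0 N0
        by (intro always_eventually) (auto simp: abs_mult intro!: mult_left_le_one_le)
      show "(N \<longlongrightarrow> 0) at_bot" using N_lim Z by simp
    qed
    ultimately have "\<phi> x \<le> 0"
      by (intro tendsto_lowerbound[of \<phi> 0 at_bot "\<phi> x"])
        (auto intro: eventually_mono[OF eventually_le_at_bot[of x]])
    then show ?thesis by (simp add: \<phi>_def mult_le_0_iff)
  next
    assume Z: "Z = at_top"
    define \<phi> where "\<phi> x = exp (w x) * N x" for x
    have "\<phi> x \<le> \<phi> y" if "x \<le> y" for y
    proof (rule DERIV_nonneg_imp_nondecreasing[OF that])
      fix t
      have "(\<phi> has_real_derivative exp (w t) * (N' t + m t * N t)) (at t)"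
        unfolding \<phi>_def by (auto intro!: derivative_eq_intros w_vd N_vd simp: algebra_simps)
      moreover have "exp (w t) * (N' t + m t * N t) \<ge> 0"
        using N'_le[of t] by (intro mult_nonneg_nonneg) auto
      ultimately show "\<exists>y. (\<phi> has_real_derivative y) (at t) \<and> 0 \<le> y" by blast
    qed
    moreover have "(\<phi> \<longlongrightarrow> 0) at_top"
    proof (rule Lim_null_comparison)
      show "\<forall>\<^sub>F x in at_top. norm (\<phi> x) \<le> exp W * N x"
        unfolding \<phi>_def using wW N0
        by (intro always_eventually) (auto simp: abs_mult intro!: mult_right_mono)
      show "((\<lambda>x. exp W * N x) \<longlongrightarrow> 0) at_top" using tendsto_mult_right_zero[OF N_lim] Z by simp
    qed
    ultimately have "\<phi> x \<le> 0"
      by (intro tendsto_lowerbound[of \<phi> 0 at_top "\<phi> x"])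
        (auto intro: eventually_mono[OF eventually_ge_at_top[of x]])
    then show ?thesis by (simp add: \<phi>_def mult_le_0_iff)
  qed
  then show ?thesis using N0[of x] inner_eq_zero_iff[of "H x"] unfolding N_def by linarith
qed

section \<open>First-order linear operators on the line and their formal inverses\<close>

definition connection_op ::
  "('m \<Rightarrow> 'a::euclidean_space \<Rightarrow> 'a) \<Rightarrow> (real \<Rightarrow> 'm) \<Rightarrow> (real \<Rightarrow> 'a) \<Rightarrow> real \<Rightarrow> 'a" where
  "connection_op B M F = (\<lambda>x. Dx F x + B (M x) (F x))"

text \<open>\<open>Dx\<close> is the case \<open>B = 0\<close>, \<open>cov_D s M\<close> the case of
  a scaled commutator; both formal inverses are treated at once.\<close>

locale connection =
  fixes B :: "'m::euclidean_space \<Rightarrow> 'a::euclidean_space \<Rightarrow> 'a" and M :: "real \<Rightarrow> 'm"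
  assumes B: "bounded_bilinear B" and M: "admissible M"
begin

sublocale B: bounded_bilinear B by (rule B)

abbreviation P where "P \<equiv> connection_op B M"

text \<open>Differentiability is stated separately because \<open>Dx\<close> has an arbitrary value
  where the derivative does not exist.\<close>

lemma connection_op_eq_iff:
  "(\<forall>x. F differentiable at x) \<and> P F = f
    \<longleftrightarrow> (\<forall>x. (F has_vector_derivative f x - B (M x) (F x)) (at x))" (is "?l \<longleftrightarrow> ?r")
proof
  assume ?l
  then show ?r by (auto simp: connection_op_def vd_diff_iff)
next
  assume r: ?r
  then have "Dx F = (\<lambda>x. f x - B (M x) (F x))" by (intro Dx_eqI) blast
  then show ?l using r vd_imp_diff by (fastforce simp: connection_op_def)
qed

lemma decaying_solution_unique:
  assumes Z: "Z = at_bot \<or> Z = at_top"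
    and F: "\<And>x. (F has_vector_derivative f x - B (M x) (F x)) (at x)" "(F \<longlongrightarrow> 0) Z"
    and G: "\<And>x. (G has_vector_derivative f x - B (M x) (G x)) (at x)" "(G \<longlongrightarrow> 0) Z"
  shows "F = G"
proof
  fix x
  have "((\<lambda>x. F x - G x) has_vector_derivative - B (M x) (F x - G x)) (at x)" for x
    using has_vector_derivative_diff[OF F(1)[of x] G(1)[of x]] by (simp add: B.diff_right algebra_simps)
  moreover have "((\<lambda>x. F x - G x) \<longlongrightarrow> 0) Z" using tendsto_diff[OF F(2) G(2)] by simp
  ultimately show "F x = G x"
    using ode_unique[OF B admissible_integrable[OF M] admissible_continuous[OF M] Z, of "\<lambda>x. F x - G x" x]
    by simp
qed

lemma inverse_from_eqI:
  assumes Z: "Z = at_bot \<or> Z = at_top"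
    and F: "\<And>x. (F has_vector_derivative f x - B (M x) (F x)) (at x)" "(F \<longlongrightarrow> 0) Z"
  shows "inverse_from Z P f = F"
  unfolding inverse_from_def
proof (rule the_equality)
  show "(\<forall>x. F differentiable at x) \<and> P F = f \<and> (F \<longlongrightarrow> 0) Z"
    using connection_op_eq_iff[of F f] F by blast
next
  fix G assume "(\<forall>x. G differentiable at x) \<and> P G = f \<and> (G \<longlongrightarrow> 0) Z"
  then have "(G has_vector_derivative f x - B (M x) (G x)) (at x)" "(G \<longlongrightarrow> 0) Z" for x
    using connection_op_eq_iff[of G f] by blast+
  then show "G = F" using decaying_solution_unique[OF Z _ _ F] by blast
qed

text \<open>Bootstrapping: the equation expresses the derivative of \<open>F\<close> by
  \<open>f\<close>, \<open>M\<close> and \<open>F\<close>, so boundedness passes from one order to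
  the next.\<close>

lemma solution_bounded_smooth:
  assumes f: "admissible f" and F: "\<And>x. (F has_vector_derivative f x - B (M x) (F x)) (at x)"
    and b: "bounded (range F)"
  shows "bounded_smooth F"
  unfolding bounded_smooth_def
proof
  have t: "tame False F" using b F vd_imp_diff by (simp add: tame_def) blast
  have DF: "Dx F = (\<lambda>x. f x + - B (M x) (F x))" using F by (intro Dx_eqI) simp
  fix k show "Ck False k F"
  proof (induction k)
    case (Suc k)
    have "Ck False k f" "Ck False k M"
      using admissible_bounded_smooth f M by (auto simp: bounded_smooth_def)
    then have "Ck False k (\<lambda>x. f x + - B (M x) (F x))"
      by (intro Ck_add Ck_linear[OF bounded_linear_minus[OF bounded_linear_ident]] Ck_bilinear[OF B] Suc)
    then show ?case using t by (simp add: DF)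
  qed (simp add: t)
qed

lemma inverse_from_solution:
  assumes f: "admissible f" and Z: "Z = at_bot \<or> Z = at_top"
  shows "(inverse_from Z P f has_vector_derivative
      f x - B (M x) (inverse_from Z P f x)) (at x)"
    and "(inverse_from Z P f \<longlongrightarrow> 0) Z"
    and "bounded_smooth (inverse_from Z P f)"
proof -
  obtain F where F: "\<And>x. (F has_vector_derivative f x - B (M x) (F x)) (at x)"
    "(F \<longlongrightarrow> 0) Z" "bounded (range F)"
    using ode_solution[OF B admissible_integrable[OF M] admissible_continuous[OF M]
        admissible_integrable[OF f] admissible_continuous[OF f] Z] by blast
  have "inverse_from Z P f = F" by (rule inverse_from_eqI[OF Z F(1,2)])
  then show "(inverse_from Z P f has_vector_derivative
      f x - B (M x) (inverse_from Z P f x)) (at x)"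
    "(inverse_from Z P f \<longlongrightarrow> 0) Z"
    "bounded_smooth (inverse_from Z P f)"
    using F solution_bounded_smooth[OF f F(1,3)] by simp_all
qed

text \<open>A solution vanishing at both ends is both one-sided solutions at once, hence their mean.
  Through this the integrations in the recursion for \<open>KN_a\<close> and \<open>KN_d\<close>
  return differential polynomials.\<close>

lemma formal_inverse_eqI:
  assumes F: "\<And>x. (F has_vector_derivative f x - B (M x) (F x)) (at x)"
    "(F \<longlongrightarrow> 0) at_bot" "(F \<longlongrightarrow> 0) at_top"
  shows "formal_inverse P f = F"
proof -
  have "inverse_from at_bot P f = F" "inverse_from at_top P f = F"
    by (rule inverse_from_eqI, simp, rule F, rule F)+
  then show ?thesis by (simp add: formal_inverse_def fun_eq_iff flip: scaleR_2)
qed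

lemma formal_inverse_bounded_smooth:
  assumes "admissible f"
  shows "bounded_smooth (formal_inverse P f)"
  unfolding formal_inverse_def
  by (intro bounded_smooth_linear[OF bounded_linear_scaleR_right] bounded_smooth_add
      inverse_from_solution(3) assms) auto

lemma formal_inverse_vd:
  assumes "admissible f"
  shows "(formal_inverse P f has_vector_derivative
    f x - B (M x) (formal_inverse P f x)) (at x)"
proof -
  have "((\<lambda>x. (1/2) *\<^sub>R (inverse_from at_bot P f x + inverse_from at_top P f x))
    has_vector_derivative (1/2) *\<^sub>R ((f x - B (M x) (inverse_from at_bot P f x))
      + (f x - B (M x) (inverse_from at_top P f x)))) (at x)"
    by (rule bounded_linear.has_vector_derivative[OF bounded_linear_scaleR_right
          has_vector_derivative_add[OF inverse_from_solution(1)[OF assms] inverse_from_solution(1)[OF assms]]])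
       simp_all
  moreover have "(1/2) *\<^sub>R ((f x - B (M x) a) + (f x - B (M x) b)) = f x - B (M x) ((1/2) *\<^sub>R (a + b))" for a b
  proof -
    have "(1/2) *\<^sub>R ((f x - B (M x) a) + (f x - B (M x) b))
        = ((1/2) *\<^sub>R f x + (1/2) *\<^sub>R f x) - (1/2) *\<^sub>R (B (M x) a + B (M x) b)"
      by (simp add: scaleR_add_right scaleR_diff_right)
    also have "(1/2) *\<^sub>R f x + (1/2) *\<^sub>R f x = f x" by (simp flip: scaleR_add_left)
    finally show ?thesis by (simp add: B.scaleR_right B.add_right)
  qed
  ultimately show ?thesis unfolding formal_inverse_def by simp
qed

end

text \<open>\<open>T\<close> carries decaying solutions of one equation to decaying solutions of the
  other, and these are unique. It serves for constant multiples and for transposition.\<close>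

lemma inverse_from_intertwine:
  assumes c: "connection B M" "connection B' M'" and T: "bounded_linear T"
    and TB: "\<And>x a. B' (M' x) (T a) = T (B (M x) a)"
    and f: "admissible f" and Z: "Z = at_bot \<or> Z = at_top"
  shows "inverse_from Z (connection_op B' M') (\<lambda>x. T (f x))
    = (\<lambda>x. T (inverse_from Z (connection_op B M) f x))"
proof (rule connection.inverse_from_eqI[OF c(2) Z])
  note s = connection.inverse_from_solution[OF c(1) f Z]
  show "((\<lambda>x. T (inverse_from Z (connection_op B M) f x)) has_vector_derivative
      T (f x) - B' (M' x) (T (inverse_from Z (connection_op B M) f x))) (at x)" for x
    using bounded_linear.has_vector_derivative[OF T s(1)[of x]]
    by (simp add: TB bounded_linear.linear[OF T] linear_diff)
  show "((\<lambda>x. T (inverse_from Z (connection_op B M) f x)) \<longlongrightarrow> 0) Z"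
    using bounded_linear.tendsto[OF T s(2)] by (simp add: linear_0 bounded_linear.linear[OF T])
qed

lemma formal_inverse_intertwine:
  assumes "connection B M" "connection B' M'" and T: "bounded_linear T"
    and "\<And>x a. B' (M' x) (T a) = T (B (M x) a)" and "admissible f"
  shows "formal_inverse (connection_op B' M') (\<lambda>x. T (f x))
    = (\<lambda>x. T (formal_inverse (connection_op B M) f x))"
  using inverse_from_intertwine[OF assms, of at_bot] inverse_from_intertwine[OF assms, of at_top]
  by (simp add: formal_inverse_def linear_add linear_scale bounded_linear.linear[OF T])

context connection
begin

lemma inverse_from_add:
  assumes f: "admissible f" and g: "admissible g" and Z: "Z = at_bot \<or> Z = at_top"
  shows "inverse_from Z P (\<lambda>x. f x + g x)
    = (\<lambda>x. inverse_from Z P f x + inverse_from Z P g x)"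
proof (rule inverse_from_eqI[OF Z])
  note F = inverse_from_solution[OF f Z] and G = inverse_from_solution[OF g Z]
  show "((\<lambda>x. inverse_from Z P f x + inverse_from Z P g x)
      has_vector_derivative f x + g x - B (M x)
        (inverse_from Z P f x + inverse_from Z P g x)) (at x)" for x
    using has_vector_derivative_add[OF F(1)[of x] G(1)[of x]]
    by (simp add: B.add_right algebra_simps)
  show "((\<lambda>x. inverse_from Z P f x + inverse_from Z P g x) \<longlongrightarrow> 0) Z"
    using tendsto_add[OF F(2) G(2)] by simp
qed

lemma formal_inverse_add:
  assumes "admissible f" "admissible g"
  shows "formal_inverse P (\<lambda>x. f x + g x)
    = (\<lambda>x. formal_inverse P f x + formal_inverse P g x)"
  using inverse_from_add[OF assms, of at_bot] inverse_from_add[OF assms, of at_top]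
  by (simp add: formal_inverse_def algebra_simps)

end

lemma scaleR_half_add: "u = (1/2) *\<^sub>R u + (1/2) *\<^sub>R (u :: 'a::real_vector)"
  by (simp flip: scaleR_add_left)

lemma bounded_range_Bfun: "bounded (range V) \<Longrightarrow> Bfun (V :: _ \<Rightarrow> 'a::real_normed_vector) Z"
  unfolding Bfun_def bounded_pos by (auto intro!: always_eventually)

text \<open>With \<open>X\<^sub>-\<close>, \<open>X\<^sub>+\<close> the solutions decaying at \<open>-\<infinity>\<close>, \<open>+\<infinity>\<close> and \<open>H = X\<^sub>- - X\<^sub>+\<close>, the mean is
  \<open>X\<^sub>+ + H/2 = X\<^sub>- - H/2\<close>, and \<open>\<beta> H H'\<close> is constant; so \<open>\<beta> X X'\<close> has the same limit
  \<open>\<beta> H H' / 4\<close> at both ends.\<close>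

lemma formal_inverse_antisymmetric:
  fixes \<beta> :: "'a::euclidean_space \<Rightarrow> 'b::euclidean_space \<Rightarrow> 'c::euclidean_space"
  assumes c: "connection B M" "connection B' M'" and \<beta>: "bounded_bilinear \<beta>"
    and inv: "\<And>x a b. \<beta> (B (M x) a) b + \<beta> a (B' (M' x) b) = 0"
    and f: "admissible f" and g: "admissible g"
  shows "integral\<^sup>L lborel (\<lambda>x. \<beta> (f x) (formal_inverse (connection_op B' M') g x))
    = - integral\<^sup>L lborel (\<lambda>x. \<beta> (formal_inverse (connection_op B M) f x) (g x))"
proof -
  interpret \<beta>: bounded_bilinear \<beta> by (rule \<beta>)
  define X where "X = formal_inverse (connection_op B M) f"
  define Y where "Y = formal_inverse (connection_op B' M') g"
  define Xm where "Xm = inverse_from at_bot (connection_op B M) f"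
  define Xp where "Xp = inverse_from at_top (connection_op B M) f"
  define Ym where "Ym = inverse_from at_bot (connection_op B' M') g"
  define Yp where "Yp = inverse_from at_top (connection_op B' M') g"
  note Xmp = connection.inverse_from_solution[OF c(1) f, of at_bot, folded Xm_def]
    connection.inverse_from_solution[OF c(1) f, of at_top, folded Xp_def]
  note Ymp = connection.inverse_from_solution[OF c(2) g, of at_bot, folded Ym_def]
    connection.inverse_from_solution[OF c(2) g, of at_top, folded Yp_def]
  define H where "H x = Xm x - Xp x" for x
  define G where "G x = Ym x - Yp x" for x
  \<comment> \<open>Invariance of \<open>\<beta>\<close> cancels the connection terms in the product
    rule, leaving only the right-hand sides.\<close>
  have vd: "((\<lambda>x. \<beta> (U x) (V x)) has_vector_derivative \<beta> (u x) (V x) + \<beta> (U x) (v x)) (at x)"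
    if U: "(U has_vector_derivative u x - B (M x) (U x)) (at x)"
      and V: "(V has_vector_derivative v x - B' (M' x) (V x)) (at x)" for U V u v x
  proof -
    have "\<beta> (U x) (v x - B' (M' x) (V x)) + \<beta> (u x - B (M x) (U x)) (V x)
        = \<beta> (u x) (V x) + \<beta> (U x) (v x) - (\<beta> (B (M x) (U x)) (V x) + \<beta> (U x) (B' (M' x) (V x)))"
      by (simp add: \<beta>.diff_left \<beta>.diff_right)
    then show ?thesis using \<beta>.has_vector_derivative[OF U V] inv by simp
  qed
  \<comment> \<open>\<open>H\<close> and \<open>G\<close> are differences of two solutions, so they
    solve the homogeneous equations and their pairing is constant.\<close>
  have "((\<lambda>x. \<beta> (H x) (G x)) has_vector_derivative 0) (at x)" for x
  proof -
    have "(H has_vector_derivative 0 - B (M x) (H x)) (at x)"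
      unfolding H_def using has_vector_derivative_diff[OF Xmp(1)[of x] Xmp(4)[of x]]
      by (simp add: bounded_bilinear.diff_right[OF connection.B[OF c(1)]])
    moreover have "(G has_vector_derivative 0 - B' (M' x) (G x)) (at x)"
      unfolding G_def using has_vector_derivative_diff[OF Ymp(1)[of x] Ymp(4)[of x]]
      by (simp add: bounded_bilinear.diff_right[OF connection.B[OF c(2)]])
    ultimately show ?thesis
      using vd[of H "\<lambda>_. 0" x G "\<lambda>_. 0"] by (simp add: \<beta>.zero_left \<beta>.zero_right)
  qed
  then obtain k where k: "\<And>x. \<beta> (H x) (G x) = k"
    using has_vector_derivative_zero_const[of "\<lambda>x. \<beta> (H x) (G x)"] by blast
  have Xeq: "X x = Xp x + (1/2) *\<^sub>R H x" "X x = Xm x - (1/2) *\<^sub>R H x" for x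
    using scaleR_half_add[of "Xp x"] scaleR_half_add[of "Xm x"]
    by (simp_all add: X_def formal_inverse_def H_def Xm_def Xp_def algebra_simps)
  have Yeq: "Y x = Yp x + (1/2) *\<^sub>R G x" "Y x = Ym x - (1/2) *\<^sub>R G x" for x
    using scaleR_half_add[of "Yp x"] scaleR_half_add[of "Ym x"]
    by (simp_all add: Y_def formal_inverse_def G_def Ym_def Yp_def algebra_simps)
  have bX: "bounded_smooth X" unfolding X_def by (rule connection.formal_inverse_bounded_smooth[OF c(1) f])
  have bY: "bounded_smooth Y" unfolding Y_def by (rule connection.formal_inverse_bounded_smooth[OF c(2) g])
  have bH: "bounded_smooth H"
  proof -
    have "H = (\<lambda>x. Xm x + - Xp x)" by (simp add: H_def fun_eq_iff)
    then show ?thesis using bounded_smooth_add[OF Xmp(3)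
        bounded_smooth_linear[OF bounded_linear_minus[OF bounded_linear_ident] Xmp(6)]] by simp
  qed
  have null: "((\<lambda>x. \<beta> (U x) (V x)) \<longlongrightarrow> 0) Z"
    if "(U \<longlongrightarrow> 0) Z" "bounded (range V)" for U V Z
    using \<beta>.Zfun_prod_Bfun[of U Z V] that bounded_range_Bfun[of V Z] by (simp add: tendsto_Zfun_iff)
  have null': "((\<lambda>x. \<beta> (U x) (V x)) \<longlongrightarrow> 0) Z"
    if "bounded (range U)" "(V \<longlongrightarrow> 0) Z" for U V Z
    using \<beta>.Bfun_prod_Zfun[of U Z V] that bounded_range_Bfun[of U Z] by (simp add: tendsto_Zfun_iff)
  have "((\<lambda>x. \<beta> (X x) (Y x)) \<longlongrightarrow> (1/4) *\<^sub>R k) at_top"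
  proof -
    have "\<beta> (X x) (Y x) = \<beta> (Xp x) (Y x) + (1/2) *\<^sub>R \<beta> (H x) (Yp x) + (1/4) *\<^sub>R k" for x
      using k[of x] by (simp add: Xeq(1) Yeq(1) \<beta>.add_left \<beta>.add_right \<beta>.scaleR_left \<beta>.scaleR_right
          scaleR_add_right)
    moreover have "((\<lambda>x. \<beta> (Xp x) (Y x) + (1/2) *\<^sub>R \<beta> (H x) (Yp x) + (1/4) *\<^sub>R k) \<longlongrightarrow> 0 + (1/2) *\<^sub>R 0 + (1/4) *\<^sub>R k) at_top"
      by (intro tendsto_add tendsto_scaleR tendsto_const null null' Xmp Ymp bounded_smooth_bounded bY bH) auto
    ultimately show ?thesis by simp
  qed
  moreover have "((\<lambda>x. \<beta> (X x) (Y x)) \<longlongrightarrow> (1/4) *\<^sub>R k) at_bot"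
  proof -
    have "\<beta> (X x) (Y x) = \<beta> (Xm x) (Y x) - (1/2) *\<^sub>R \<beta> (H x) (Ym x) + (1/4) *\<^sub>R k" for x
      using k[of x] by (simp add: Xeq(2) Yeq(2) \<beta>.diff_left \<beta>.diff_right \<beta>.scaleR_left \<beta>.scaleR_right
          algebra_simps)
    moreover have "((\<lambda>x. \<beta> (Xm x) (Y x) - (1/2) *\<^sub>R \<beta> (H x) (Ym x) + (1/4) *\<^sub>R k) \<longlongrightarrow> 0 - (1/2) *\<^sub>R 0 + (1/4) *\<^sub>R k) at_bot"
      by (intro tendsto_add tendsto_diff tendsto_scaleR tendsto_const null null' Xmp Ymp bounded_smooth_bounded bY bH) auto
    ultimately show ?thesis by simp
  qed
  moreover have "((\<lambda>x. \<beta> (X x) (Y x)) has_vector_derivative \<beta> (f x) (Y x) + \<beta> (X x) (g x)) (at x)" for x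
    using vd[of X f x Y g] connection.formal_inverse_vd[OF c(1) f, of x] connection.formal_inverse_vd[OF c(2) g, of x]
    by (simp add: X_def Y_def)
  moreover have a: "admissible (\<lambda>x. \<beta> (f x) (Y x))" "admissible (\<lambda>x. \<beta> (X x) (g x))"
    by (rule admissible_bilinear_right[OF \<beta> f bY], rule admissible_bilinear_left[OF \<beta> bX g])
  ultimately have "integral\<^sup>L lborel (\<lambda>x. \<beta> (f x) (Y x) + \<beta> (X x) (g x)) = (1/4) *\<^sub>R k - (1/4) *\<^sub>R k"
    using admissible_add[OF a]
    by (intro integral_total_derivative[where F = "\<lambda>x. \<beta> (X x) (Y x)"]
        admissible_integrable admissible_continuous)
  moreover have "integral\<^sup>L lborel (\<lambda>x. \<beta> (f x) (Y x) + \<beta> (X x) (g x))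
      = integral\<^sup>L lborel (\<lambda>x. \<beta> (f x) (Y x)) + integral\<^sup>L lborel (\<lambda>x. \<beta> (X x) (g x))"
    by (intro Bochner_Integration.integral_add admissible_integrable a)
  ultimately show ?thesis
    unfolding X_def[symmetric] Y_def[symmetric] by (simp add: eq_neg_iff_add_eq_0)
qed

section \<open>The ring of square matrices and matrix-valued formal power series\<close>

lemma matrix_add_rdistrib: "(A + B) ** C = A ** C + B ** (C :: 'a::semiring_1^'k^'m)"
  by (simp add: matrix_matrix_mult_def vec_eq_iff sum.distrib distrib_right)

text \<open>A copy of the matrix type whose \<open>*\<close> is the matrix product; formal power
  series over it form a noncommutative ring in which \<open>lambda\<close> is central.\<close>

typedef ('n::finite) sqm = "UNIV :: (complex^'n^'n) set"
  by simp

instantiation sqm :: (finite) ring_1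
begin

definition "0 = Abs_sqm 0"
definition "1 = Abs_sqm (mat 1)"
definition "A + B = Abs_sqm (Rep_sqm A + Rep_sqm B)"
definition "A - B = Abs_sqm (Rep_sqm A - Rep_sqm B)"
definition "- A = Abs_sqm (- Rep_sqm A)"
definition "A * B = Abs_sqm (Rep_sqm A ** Rep_sqm B)"

lemma Rep_sqm_ops [simp]:
  "Rep_sqm 0 = 0" "Rep_sqm 1 = mat 1" "Rep_sqm (A + B) = Rep_sqm A + Rep_sqm B"
  "Rep_sqm (A - B) = Rep_sqm A - Rep_sqm B" "Rep_sqm (- A) = - Rep_sqm A"
  "Rep_sqm (A * B) = Rep_sqm A ** Rep_sqm B"
  by (simp_all add: zero_sqm_def one_sqm_def plus_sqm_def minus_sqm_def uminus_sqm_def times_sqm_def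
      Abs_sqm_inverse)

instance
proof
  fix a b c :: "'a sqm"
  show "a * b * c = a * (b * c)" by (simp add: Rep_sqm_inject[symmetric] matrix_mul_assoc)
  show "(a + b) * c = a * c + b * c" by (simp add: Rep_sqm_inject[symmetric] matrix_add_rdistrib)
  show "a * (b + c) = a * b + a * c" by (simp add: Rep_sqm_inject[symmetric] matrix_add_ldistrib)
  have "(mat 1 :: complex^'a^'a) $ i $ i \<noteq> 0 $ i $ i" for i by (simp add: mat_def)
  then have "(mat 1 :: complex^'a^'a) \<noteq> 0" by metis
  then show "(0 :: 'a sqm) \<noteq> 1" by (simp add: Rep_sqm_inject[symmetric])
qed (simp_all add: Rep_sqm_inject[symmetric])

end

lemma Rep_sqm_sum: "Rep_sqm (sum f A) = (\<Sum>i\<in>A. Rep_sqm (f i))"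
  by (induction A rule: infinite_finite_induct) simp_all

definition mfps :: "(nat \<Rightarrow> complex^'n^'n) \<Rightarrow> ('n::finite) sqm fps" where
  "mfps f = Abs_fps (\<lambda>k. Abs_sqm (f k))"

definition mcoeff :: "('n::finite) sqm fps \<Rightarrow> nat \<Rightarrow> complex^'n^'n" where
  "mcoeff A k = Rep_sqm (fps_nth A k)"

definition mconst :: "complex^'n^'n \<Rightarrow> ('n::finite) sqm fps" where
  "mconst M = fps_const (Abs_sqm M)"

lemma mcoeff_simps [simp]:
  "mcoeff (mfps f) k = f k" "mcoeff 0 k = 0" "mcoeff (A + B) k = mcoeff A k + mcoeff B k"
  "mcoeff (A - B) k = mcoeff A k - mcoeff B k" "mcoeff (- A) k = - mcoeff A k"
  "mcoeff (mconst M * A) k = M ** mcoeff A k" "mcoeff (A * mconst M) k = mcoeff A k ** M"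
  "mcoeff (fps_X * A) k = (if k = 0 then 0 else mcoeff A (k - 1))"
  "mcoeff (mconst M) k = (if k = 0 then M else 0)"
  "mcoeff 1 k = (if k = 0 then mat 1 else 0)"
  by (simp_all add: mfps_def mcoeff_def mconst_def Abs_sqm_inverse)

lemma mcoeff_mult: "mcoeff (A * B) k = (\<Sum>i=0..k. mcoeff A i ** mcoeff B (k - i))"
  by (simp add: mcoeff_def fps_mult_nth Rep_sqm_sum)

lemma mfps_eqI: "(\<And>k. mcoeff A k = mcoeff B k) \<Longrightarrow> A = B"
  by (simp add: mcoeff_def fps_eq_iff Rep_sqm_inject)

lemma fps_X_left: "A * (fps_X * B) = fps_X * (A * (B :: 'a::ring_1 fps))"
  by (metis fps_mult_fps_X_commute mult.assoc)

section \<open>Block matrices\<close>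

type_synonym 'n bmat = "complex^('n option)^('n option)"

definition blk_a :: "'n::finite bmat \<Rightarrow> complex" where
  "blk_a M = M $ None $ None"
definition blk_b :: "'n::finite bmat \<Rightarrow> complex^'n" where
  "blk_b M = (\<chi> i. M $ Some i $ None)"
definition blk_c :: "'n::finite bmat \<Rightarrow> complex^'n" where
  "blk_c M = (\<chi> j. M $ None $ Some j)"
definition blk_d :: "'n::finite bmat \<Rightarrow> complex^'n^'n" where
  "blk_d M = (\<chi> i j. M $ Some i $ Some j)"

lemmas blk_parts_def = blk_a_def blk_b_def blk_c_def blk_d_def

lemma blk_parts_blk [simp]:
  "blk_a (blk a c b d) = a" "blk_b (blk a c b d) = b" "blk_c (blk a c b d) = c" "blk_d (blk a c b d) = d"
  by (simp_all add: blk_parts_def blk_def vec_eq_iff)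

lemma blk_eqI:
  "blk_a A = blk_a B \<Longrightarrow> blk_b A = blk_b B \<Longrightarrow> blk_c A = blk_c B \<Longrightarrow> blk_d A = blk_d B \<Longrightarrow> A = B"
  by (simp add: blk_parts_def vec_eq_iff split_option_all)

lemma blk_eq_iff:
  "A = B \<longleftrightarrow> blk_a A = blk_a B \<and> blk_b A = blk_b B \<and> blk_c A = blk_c B \<and> blk_d A = blk_d B"
  using blk_eqI by blast

lemma blk_parts_arith [simp]:
  "blk_a 0 = 0" "blk_b 0 = 0" "blk_c 0 = 0" "blk_d 0 = 0"
  "blk_a (A + B) = blk_a A + blk_a B" "blk_b (A + B) = blk_b A + blk_b B"
  "blk_c (A + B) = blk_c A + blk_c B" "blk_d (A + B) = blk_d A + blk_d B"
  "blk_a (A - B) = blk_a A - blk_a B" "blk_b (A - B) = blk_b A - blk_b B"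
  "blk_c (A - B) = blk_c A - blk_c B" "blk_d (A - B) = blk_d A - blk_d B"
  "blk_a (- A) = - blk_a A" "blk_b (- A) = - blk_b A"
  "blk_c (- A) = - blk_c A" "blk_d (- A) = - blk_d A"
  "blk_a (t *\<^sub>R A) = t *\<^sub>R blk_a A" "blk_b (t *\<^sub>R A) = t *\<^sub>R blk_b A"
  "blk_c (t *\<^sub>R A) = t *\<^sub>R blk_c A" "blk_d (t *\<^sub>R A) = t *\<^sub>R blk_d A"
  "blk_a (s *\<^sub>M A) = s * blk_a A" "blk_b (s *\<^sub>M A) = s *s blk_b A"
  "blk_c (s *\<^sub>M A) = s *s blk_c A" "blk_d (s *\<^sub>M A) = s *\<^sub>M blk_d A"
  by (simp_all add: blk_parts_def vec_eq_iff mscale_def)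

lemma mat_parts [simp]: "blk_a (mat s) = s" "blk_b (mat s) = 0" "blk_c (mat s) = 0" "blk_d (mat s) = mat s"
  by (simp_all add: blk_parts_def mat_def vec_eq_iff)

lemma sum_option: "(\<Sum>i\<in>UNIV. f i) = f None + (\<Sum>i\<in>UNIV. f (Some (i::'n::finite)))"
  by (simp add: UNIV_option_conv sum.reindex)

lemma blk_parts_mult [simp]:
  "blk_a (A ** B) = blk_a A * blk_a B + scalar_product (blk_c A) (blk_b B)"
  "blk_b (A ** B) = blk_a B *s blk_b A + blk_d A *v blk_b B"
  "blk_c (A ** B) = blk_a A *s blk_c B + transpose (blk_d B) *v blk_c A"
  "blk_d (A ** B) = outer (blk_b A) (blk_c B) + blk_d A ** blk_d B"
  by (simp_all add: blk_parts_def vec_eq_iff matrix_matrix_mult_def matrix_vector_mult_def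
      scalar_product_def outer_def transpose_def sum_option mult.commute)

lemma mscale_simps [simp]: "1 *\<^sub>M A = A" "0 *\<^sub>M A = 0" "s *\<^sub>M (0 :: complex^'n^'m) = 0"
  "s *\<^sub>M t *\<^sub>M A = (s * t) *\<^sub>M A" "s *\<^sub>M (- A) = - (s *\<^sub>M A)" "(- s) *\<^sub>M A = - (s *\<^sub>M A)"
  by (simp_all add: mscale_def vec_eq_iff)

lemma mscale_distrib: "s *\<^sub>M (A + B) = s *\<^sub>M A + s *\<^sub>M B" "s *\<^sub>M (A - B) = s *\<^sub>M A - s *\<^sub>M B"
  "(s + t) *\<^sub>M A = s *\<^sub>M A + t *\<^sub>M A"
  by (simp_all add: mscale_def vec_eq_iff algebra_simps)

lemma mscale_mult [simp]:
  fixes A :: "complex^'m^'n" and B :: "complex^'k^'m"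
  shows "(s *\<^sub>M A) ** B = s *\<^sub>M (A ** B)" "A ** (s *\<^sub>M B) = s *\<^sub>M (A ** B)"
  by (simp_all add: mscale_def vec_eq_iff matrix_matrix_mult_def sum_distrib_left algebra_simps)

lemma mscale_eq_0 [simp]: "s *\<^sub>M A = 0 \<longleftrightarrow> s = 0 \<or> A = 0"
  by (auto simp: mscale_def vec_eq_iff)

lemma outer_zero [simp]: "outer 0 v = 0" "outer u 0 = 0"
  by (simp_all add: outer_def vec_eq_iff)

lemma scalar_product_zero [simp]: "scalar_product 0 v = (0::complex)" "scalar_product u 0 = (0::complex)"
  by (simp_all add: scalar_product_def)

lemma vsmult_zero [simp]: "(0::complex) *s v = 0" "s *s (0 :: complex^'n) = 0"
  by (simp_all add: vec_eq_iff)

lemma sigma3_parts [simp]: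
  "blk_a sigma3 = 1" "blk_b sigma3 = 0" "blk_c sigma3 = 0" "blk_d sigma3 = - mat 1"
  by (simp_all add: sigma3_def)

lemma Qmat_parts [simp]:
  "blk_a (Qmat q r) = 0" "blk_b (Qmat q r) = q" "blk_c (Qmat q r) = r" "blk_d (Qmat q r) = 0"
  by (simp_all add: Qmat_def)

lemma matrix_vector_simps [simp]:
  "(- A) *v v = - (A *v (v :: complex^'n))" "(A :: complex^'n^'m) *v (- v) = - (A *v v)" "transpose (mat s :: complex^'n^'n) = mat s"
  "transpose (- B) = - transpose (B :: complex^'n^'m)" "(- C) ** D = - (C ** (D :: complex^'k^'l))"
  "C ** (- D) = - (C ** D)" "transpose (0 :: complex^'n^'m) = 0"
  by (simp_all add: vec_eq_iff matrix_vector_mult_def transpose_def mat_def matrix_matrix_mult_def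
      sum_negf if_distrib)

text \<open>The adjoint action of \<open>sigma3\<close> kills the diagonal blocks and is invertible
  on the off-diagonal ones; its eigenvalues -2i and 2i are what the constants in
  \<open>solve_off\<close> invert.\<close>

lemma comm_sigma3_parts:
  "blk_a (comm (\<i> *\<^sub>M sigma3) M) = 0" "blk_b (comm (\<i> *\<^sub>M sigma3) M) = (- 2 * \<i>) *s blk_b M"
  "blk_c (comm (\<i> *\<^sub>M sigma3) M) = (2 * \<i>) *s blk_c M" "blk_d (comm (\<i> *\<^sub>M sigma3) M) = 0"
  by (simp_all add: comm_def vec_eq_iff algebra_simps)

lemma comm_Qmat_parts:
  "blk_a (comm (Qmat q r) M) = scalar_product r (blk_b M) - scalar_product (blk_c M) q"
  "blk_b (comm (Qmat q r) M) = blk_a M *s q - blk_d M *v q"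
  "blk_c (comm (Qmat q r) M) = transpose (blk_d M) *v r - blk_a M *s r"
  "blk_d (comm (Qmat q r) M) = outer q (blk_c M) - outer (blk_b M) r"
  by (simp_all add: comm_def)

section \<open>Bounded bilinear operations\<close>

lemma bounded_bilinearI_euclidean:
  fixes h :: "'a::euclidean_space \<Rightarrow> 'b::euclidean_space \<Rightarrow> 'c::real_normed_vector"
  assumes "\<And>x x' y. h (x + x') y = h x y + h x' y" "\<And>x y y'. h x (y + y') = h x y + h x y'"
    "\<And>t x y. h (t *\<^sub>R x) y = t *\<^sub>R h x y" "\<And>t x y. h x (t *\<^sub>R y) = t *\<^sub>R h x y"
  shows "bounded_bilinear h"
  unfolding bilinear_conv_bounded_bilinear[symmetric] bilinear_def
  using assms by (auto intro!: linearI)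

lemma bounded_linearI_euclidean:
  fixes h :: "'a::euclidean_space \<Rightarrow> 'b::real_normed_vector"
  assumes "\<And>x y. h (x + y) = h x + h y" "\<And>t x. h (t *\<^sub>R x) = t *\<^sub>R h x"
  shows "bounded_linear h"
  using assms by (auto intro!: linearI simp: linear_conv_bounded_linear[symmetric])

lemma bounded_bilinear_matrix_matrix:
  "bounded_bilinear ((**) :: complex^'m^'n \<Rightarrow> complex^'k^'m \<Rightarrow> complex^'k^'n)"
  by (rule bounded_bilinearI_euclidean)
    (simp_all add: matrix_matrix_mult_def vec_eq_iff scaleR_sum_right sum.distrib algebra_simps)

lemma bounded_bilinear_matrix_vector:
  "bounded_bilinear ((*v) :: complex^'m^'n \<Rightarrow> complex^'m \<Rightarrow> complex^'n)"
  by (rule bounded_bilinearI_euclidean)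
    (simp_all add: matrix_vector_mult_def vec_eq_iff scaleR_sum_right sum.distrib algebra_simps)

lemma bounded_bilinear_outer: "bounded_bilinear (outer :: complex^'n \<Rightarrow> complex^'m \<Rightarrow> _)"
  by (rule bounded_bilinearI_euclidean) (simp_all add: outer_def vec_eq_iff algebra_simps)

lemma bounded_bilinear_scalar_product:
  "bounded_bilinear (scalar_product :: complex^'n \<Rightarrow> complex^'n \<Rightarrow> _)"
  by (rule bounded_bilinearI_euclidean)
    (simp_all add: scalar_product_def scaleR_sum_right sum.distrib algebra_simps)

lemma bounded_bilinear_vsmult: "bounded_bilinear ((*s) :: complex \<Rightarrow> complex^'n \<Rightarrow> _)"
  by (rule bounded_bilinearI_euclidean) (simp_all add: vec_eq_iff algebra_simps)

lemma bounded_bilinear_mscale: "bounded_bilinear ((*\<^sub>M) :: complex \<Rightarrow> complex^'m^'n \<Rightarrow> _)"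
  by (rule bounded_bilinearI_euclidean) (simp_all add: vec_eq_iff mscale_def algebra_simps)

lemmas bounded_linear_mscale = bounded_bilinear.bounded_linear_right[OF bounded_bilinear_mscale]

lemma bounded_bilinear_comm: "bounded_bilinear (comm :: complex^'n^'n \<Rightarrow> _)"
proof -
  interpret bounded_bilinear "(**) :: complex^'n^'n \<Rightarrow> complex^'n^'n \<Rightarrow> complex^'n^'n"
    by (rule bounded_bilinear_matrix_matrix)
  show ?thesis
    by (rule bounded_bilinearI_euclidean)
      (simp_all add: comm_def add_left add_right scaleR_left scaleR_right algebra_simps)
qed

lemma bounded_linear_blk_parts:
  "bounded_linear blk_a" "bounded_linear blk_b" "bounded_linear blk_c" "bounded_linear blk_d"
  by (rule bounded_linearI_euclidean; simp)+

lemma bounded_linear_trace: "bounded_linear (trace :: complex^'n^'n \<Rightarrow> complex)"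
  by (rule bounded_linearI_euclidean) (simp_all add: trace_def sum.distrib scaleR_sum_right)

lemmas matrix_scaleR =
  bounded_bilinear.scaleR_left[OF bounded_bilinear_matrix_matrix]
  bounded_bilinear.scaleR_right[OF bounded_bilinear_matrix_matrix]

lemmas trace_scaleR = linear_scale[OF bounded_linear.linear[OF bounded_linear_trace]]

lemma bounded_bilinear_trace_mult: "bounded_bilinear (\<lambda>A B :: complex^'n^'n. trace (A ** B))"
  by (rule bounded_bilinearI_euclidean)
    (simp_all add: matrix_add_ldistrib matrix_add_rdistrib trace_add matrix_scaleR trace_scaleR)

lemma bounded_linear_transpose: "bounded_linear (transpose :: complex^'m^'n \<Rightarrow> _)"
  by (rule bounded_linearI_euclidean) (simp_all add: transpose_def vec_eq_iff)

section \<open>The local solution\<close>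

text \<open>\<open>solve_diag T\<close> is the block-diagonal \<open>X\<close> with \<open>\<i>\<sigma>\<^sub>3 X + X \<i>\<sigma>\<^sub>3 = - T\<close> on the diagonal blocks,
  \<open>solve_off Y\<close> the block-off-diagonal \<open>X\<close> with \<open>[\<i>\<sigma>\<^sub>3, X] = Y\<close> on the off-diagonal blocks.\<close>

definition solve_diag :: "'n::finite bmat \<Rightarrow> 'n bmat" where
  "solve_diag T = blk (\<i>/2 * blk_a T) 0 0 (- (\<i>/2) *\<^sub>M blk_d T)"

definition solve_off :: "'n::finite bmat \<Rightarrow> 'n bmat" where
  "solve_off Y = blk 0 (- (\<i>/2) *s blk_c Y) ((\<i>/2) *s blk_b Y) 0"

lemma bounded_linear_solve: "bounded_linear solve_diag" "bounded_linear solve_off"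
  by (rule bounded_linearI_euclidean;
      rule blk_eqI; simp add: solve_diag_def solve_off_def vec_eq_iff mscale_def algebra_simps)+

text \<open>Coefficients of the formal solution with \<open>\<alpha>\<^sub>0 = 1\<close>.  The diagonal blocks come from
  \<open>W\<^sup>2 = -1\<close> instead of an integration, so that they are differential polynomials in \<open>Q\<close>.\<close>

function lax_coeff :: "(real \<Rightarrow> 'n::finite bmat) \<Rightarrow> nat \<Rightarrow> real \<Rightarrow> 'n bmat" where
  "lax_coeff Q 0 = (\<lambda>x. \<i> *\<^sub>M sigma3)"
| "lax_coeff Q (Suc 0) = Q"
| "lax_coeff Q (Suc (Suc k)) = (\<lambda>x.
     solve_diag (\<Sum>i=1..Suc k. lax_coeff Q i x ** lax_coeff Q (Suc (Suc k) - i) x)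
     + solve_off (Dx (lax_coeff Q k) x - comm (Q x) (lax_coeff Q (Suc k) x)))"
  by pat_completeness auto
termination by (relation "Wellfounded.measure snd") auto

declare lax_coeff.simps(3) [simp del]

text \<open>Every coefficient but the constant one is a differential polynomial in \<open>Q\<close>
  without constant term.\<close>

lemma lax_coeff_admissible:
  assumes Q: "admissible Q" and "k \<ge> 1"
  shows "admissible (lax_coeff Q k)"
  using \<open>k \<ge> 1\<close>
proof (induction k rule: less_induct)
  case (less k)
  consider "k = 1" | j where "k = Suc (Suc j)"
    using less.prems by (metis One_nat_def Suc_le_D not0_implies_Suc)
  then show ?case
  proof cases
    case 2
    have "admissible (\<lambda>x. \<Sum>i=1..Suc j. lax_coeff Q i x ** lax_coeff Q (Suc (Suc j) - i) x)"
      by (rule admissible_sum, rule admissible_bilinear[OF bounded_bilinear_matrix_matrix])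
        (use 2 in \<open>auto intro!: less.IH\<close>)
    \<comment> \<open>For \<open>j = 0\<close> the coefficient is the constant
      \<open>i sigma3\<close>, which is not admissible, but its derivative vanishes.\<close>
    moreover have "admissible (Dx (lax_coeff Q j))"
    proof (cases "j = 0")
      case True
      then have "Dx (lax_coeff Q j) = (\<lambda>x. 0)" by (simp add: Dx_def)
      then show ?thesis by (simp add: admissible_zero)
    next
      case False
      then show ?thesis using less.IH[of j] 2 by (simp add: admissible_Dx)
    qed
    moreover have "admissible (\<lambda>x. comm (Q x) (lax_coeff Q (Suc j) x))"
      using 2 by (intro admissible_bilinear[OF bounded_bilinear_comm] Q less.IH) auto
    ultimately show ?thesis
      unfolding 2 lax_coeff.simps
      by (intro admissible_add admissible_linear[OF bounded_linear_solve(1)]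
          admissible_linear[OF bounded_linear_solve(2)] admissible_diff)
  qed (use Q in simp)
qed

lemma lax_coeff_bounded_smooth: "admissible Q \<Longrightarrow> bounded_smooth (lax_coeff Q k)"
  by (cases "k = 0") (simp_all add: bounded_smooth_const admissible_bounded_smooth lax_coeff_admissible)

lemma lax_coeff_vd: "admissible Q \<Longrightarrow> (lax_coeff Q k has_vector_derivative Dx (lax_coeff Q k) x) (at x)"
  using bounded_smooth_vd lax_coeff_bounded_smooth by blast

definition lax_series :: "(real \<Rightarrow> 'n::finite bmat) \<Rightarrow> real \<Rightarrow> ('n option) sqm fps" where
  "lax_series Q x = mfps (\<lambda>k. lax_coeff Q k x)"

definition lax_series_x :: "(real \<Rightarrow> 'n::finite bmat) \<Rightarrow> real \<Rightarrow> ('n option) sqm fps" where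
  "lax_series_x Q x = mfps (\<lambda>k. Dx (lax_coeff Q k) x)"

text \<open>\<open>\<lambda>\<^sup>2 U\<close>\<close>

definition U_series :: "'n::finite bmat \<Rightarrow> ('n option) sqm fps" where
  "U_series Q = mconst (\<i> *\<^sub>M sigma3) + fps_X * mconst Q"

text \<open>The Leibniz rule for \<open>X d/dx - [U, .]\<close> applied to \<open>W * W\<close>; the
  unit is central and drops out of the commutator.\<close>

lemma square_defect_identity:
  fixes X W W' U :: "'a::ring_1"
  assumes X: "\<And>A. A * X = X * A"
  shows "X * (W' * W + W * W') - (U * (W * W + 1) - (W * W + 1) * U)
    = W * (X * W' - (U * W - W * U)) + (X * W' - (U * W - W * U)) * W"
proof -
  have "W * (X * W') = X * (W * W')" by (metis X mult.assoc)
  then show ?thesis by (simp add: algebra_simps)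
qed

text \<open>\<open>solve_diag\<close> cancels the diagonal blocks of the \<open>k\<close>-th
  coefficient of \<open>S\<close>, \<open>solve_off\<close> the off-diagonal blocks of that of
  \<open>E\<close>. In order \<open>k\<close> the identity then equates a commutator with
  \<open>i sigma3\<close>, which is off-diagonal, to an anticommutator, which is diagonal. Both
  vanish, and each operation is injective on the blocks that remain.\<close>

lemma lax_defects_vanish:
  fixes Q :: "real \<Rightarrow> 'n::finite bmat"
  assumes Q: "admissible Q" and off: "\<And>x. blk_a (Q x) = 0" "\<And>x. blk_d (Q x) = 0"
  shows "\<forall>x. mcoeff (lax_series Q x * lax_series Q x + 1) k = 0 \<and>
     mcoeff (fps_X * fps_X * lax_series_x Q x
       - (U_series (Q x) * lax_series Q x - lax_series Q x * U_series (Q x))) k = 0"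
proof (induction k rule: less_induct)
  case (less k)
  define w where "w = lax_series Q"
  define w' where "w' = lax_series_x Q"
  define u where "u x = U_series (Q x)" for x
  define S where "S x = w x * w x + 1" for x
  define S' where "S' x = w' x * w x + w x * w' x" for x
  define E where "E x = fps_X * fps_X * w' x - (u x * w x - w x * u x)" for x
  note defs = w_def w'_def u_def S_def S'_def E_def
  have S0: "mcoeff (S x) j = 0" and E0: "mcoeff (E x) j = 0" if "j < k" for j x
    using less.IH[OF that] by (auto simp: defs)
  have Sk: "mcoeff (S x) j = (\<Sum>i=0..j. lax_coeff Q i x ** lax_coeff Q (j - i) x) + (if j = 0 then mat 1 else 0)" for x j
    by (simp add: S_def w_def lax_series_def mcoeff_mult)
  \<comment> \<open>Lower coefficients of \<open>S\<close> vanish for every \<open>x\<close>, so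
    their derivatives do too; because of the factor \<open>lambda^2\<close> only these enter in
    order \<open>k\<close>.\<close>
  have S'0: "mcoeff (S' x) j = 0" if "j < k" for j x
  proof -
    have "((\<lambda>x. mcoeff (S x) j) has_vector_derivative
      (\<Sum>i=0..j. lax_coeff Q i x ** Dx (lax_coeff Q (j - i)) x + Dx (lax_coeff Q i) x ** lax_coeff Q (j - i) x) + 0) (at x)"
      unfolding Sk
      by (intro has_vector_derivative_add has_vector_derivative_const has_vector_derivative_sum
          bounded_bilinear.has_vector_derivative[OF bounded_bilinear_matrix_matrix] lax_coeff_vd Q)
    moreover have "((\<lambda>x. mcoeff (S x) j) has_vector_derivative 0) (at x)"
      using S0[OF that] by (simp add: has_vector_derivative_const)
    ultimately have "(\<Sum>i=0..j. lax_coeff Q i x ** Dx (lax_coeff Q (j - i)) x + Dx (lax_coeff Q i) x ** lax_coeff Q (j - i) x) + 0 = 0"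
      by (rule vector_derivative_unique_at)
    then show ?thesis
      by (simp add: S'_def w_def w'_def lax_series_def lax_series_x_def mcoeff_mult sum.distrib add.commute)
  qed
  have Ek: "mcoeff (E x) j = (if j \<ge> 2 then Dx (lax_coeff Q (j - 2)) x else 0)
     - comm (\<i> *\<^sub>M sigma3) (lax_coeff Q j x) - (if j \<ge> 1 then comm (Q x) (lax_coeff Q (j - 1) x) else 0)" for x j
    by (simp add: E_def u_def w_def w'_def U_series_def lax_series_def lax_series_x_def comm_def
        distrib_left distrib_right mult.assoc fps_X_left[of "mfps _"] numeral_2_eq_2)
  have diag: "blk_a (mcoeff (S x) k) = 0" "blk_d (mcoeff (S x) k) = 0" for x
  proof -
    consider "k = 0" | "k = 1" | j where "k = Suc (Suc j)" by (metis One_nat_def not0_implies_Suc)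
    then have "blk_a (mcoeff (S x) k) = 0 \<and> blk_d (mcoeff (S x) k) = 0"
    proof cases
      case 1
      then show ?thesis by (simp add: Sk)
    next
      case 2
      then show ?thesis by (simp add: Sk off)
    next
      case 3
      \<comment> \<open>The summands of index 0 and \<open>k\<close> contain the new coefficient;
        \<open>T\<close> collects the others, which are already determined.\<close>
      define T where "T = (\<Sum>i=1..Suc j. lax_coeff Q i x ** lax_coeff Q (Suc (Suc j) - i) x)"
      have S: "mcoeff (S x) k = (\<i> *\<^sub>M sigma3) ** lax_coeff Q k x + T + lax_coeff Q k x ** (\<i> *\<^sub>M sigma3)"
        unfolding Sk 3 T_def by (simp add: sum.atLeast0_atMost_Suc_shift sum.atLeast_Suc_atMost)
      have W: "blk_a (lax_coeff Q k x) = \<i>/2 * blk_a T" "blk_d (lax_coeff Q k x) = - (\<i>/2) *\<^sub>M blk_d T"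
        unfolding 3 lax_coeff.simps T_def[symmetric] by (simp_all add: solve_diag_def solve_off_def)
      show ?thesis unfolding S by (simp add: W) (simp add: vec_eq_iff mscale_def)
    qed
    then show "blk_a (mcoeff (S x) k) = 0" "blk_d (mcoeff (S x) k) = 0" by blast+
  qed
  have offE: "blk_b (mcoeff (E x) k) = 0" "blk_c (mcoeff (E x) k) = 0" for x
  proof -
    consider "k = 0" | "k = 1" | j where "k = Suc (Suc j)" by (metis One_nat_def not0_implies_Suc)
    then have "blk_b (mcoeff (E x) k) = 0 \<and> blk_c (mcoeff (E x) k) = 0"
    proof cases
      case 1
      then show ?thesis by (simp add: Ek comm_def)
    next
      case 2
      then show ?thesis by (simp add: Ek comm_def)
    next
      case 3
      define Y where "Y = Dx (lax_coeff Q j) x - comm (Q x) (lax_coeff Q (Suc j) x)"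
      have E: "mcoeff (E x) k = Y - comm (\<i> *\<^sub>M sigma3) (lax_coeff Q k x)"
        unfolding Ek 3 Y_def by simp
      have W: "blk_b (lax_coeff Q k x) = (\<i>/2) *s blk_b Y" "blk_c (lax_coeff Q k x) = - (\<i>/2) *s blk_c Y"
        unfolding 3 lax_coeff.simps Y_def[symmetric] by (simp_all add: solve_diag_def solve_off_def)
      show ?thesis unfolding E by (simp add: comm_sigma3_parts W)
    qed
    then show "blk_b (mcoeff (E x) k) = 0" "blk_c (mcoeff (E x) k) = 0" by blast+
  qed
  have "mcoeff (S x) k = 0 \<and> mcoeff (E x) k = 0" for x
  proof -
    have id: "fps_X * fps_X * S' x - (u x * S x - S x * u x) = w x * E x + E x * w x"
      unfolding S_def S'_def E_def
      by (rule square_defect_identity) (metis fps_mult_fps_X_commute mult.assoc)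
    have "mcoeff (fps_X * fps_X * S' x) k = 0"
      using S'0 by (simp add: mult.assoc)
    moreover have "mcoeff (u x * S x - S x * u x) k = comm (\<i> *\<^sub>M sigma3) (mcoeff (S x) k)"
      using S0 by (simp add: u_def U_series_def comm_def distrib_left distrib_right mult.assoc fps_X_left[of "S x"])
    moreover have "mcoeff (w x * E x) k = (\<i> *\<^sub>M sigma3) ** mcoeff (E x) k"
    proof -
      have "mcoeff (w x * E x) k = (\<Sum>i\<in>{0}. mcoeff (w x) i ** mcoeff (E x) (k - i))"
        unfolding mcoeff_mult by (rule sum.mono_neutral_right) (auto simp: E0)
      then show ?thesis by (simp add: w_def lax_series_def)
    qed
    moreover have "mcoeff (E x * w x) k = mcoeff (E x) k ** (\<i> *\<^sub>M sigma3)"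
    proof -
      have "mcoeff (E x * w x) k = (\<Sum>i\<in>{k}. mcoeff (E x) i ** mcoeff (w x) (k - i))"
        unfolding mcoeff_mult by (rule sum.mono_neutral_right) (auto simp: E0)
      then show ?thesis by (simp add: w_def lax_series_def)
    qed
    ultimately have eq: "- comm (\<i> *\<^sub>M sigma3) (mcoeff (S x) k)
        = (\<i> *\<^sub>M sigma3) ** mcoeff (E x) k + mcoeff (E x) k ** (\<i> *\<^sub>M sigma3)"
      using arg_cong[OF id, of "\<lambda>A. mcoeff A k"] by simp
    have "blk_a (mcoeff (E x) k) = 0" using arg_cong[OF eq, of blk_a] by (simp add: comm_sigma3_parts)
    moreover have "blk_d (mcoeff (E x) k) = 0"
      using arg_cong[OF eq, of blk_d] by (simp add: comm_sigma3_parts, simp add: vec_eq_iff mscale_def)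
    moreover have "blk_b (mcoeff (S x) k) = 0"
      using arg_cong[OF eq, of blk_b] by (simp add: comm_sigma3_parts offE vec_eq_iff)
    moreover have "blk_c (mcoeff (S x) k) = 0"
      using arg_cong[OF eq, of blk_c] by (simp add: comm_sigma3_parts offE vec_eq_iff)
    ultimately show ?thesis using diag offE by (simp add: blk_eq_iff)
  qed
  then show ?case by (simp add: defs)
qed

lemma lax_series_square:
  assumes "admissible Q" "\<And>x. blk_a (Q x) = 0" "\<And>x. blk_d (Q x) = 0"
  shows "lax_series Q x * lax_series Q x = - 1"
proof -
  have "lax_series Q x * lax_series Q x + 1 = 0"
    by (rule mfps_eqI) (use lax_defects_vanish[OF assms] in simp)
  then show ?thesis by (simp add: eq_neg_iff_add_eq_0)
qed

lemma lax_series_stationary: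
  assumes "admissible Q" "\<And>x. blk_a (Q x) = 0" "\<And>x. blk_d (Q x) = 0"
  shows "fps_X * fps_X * lax_series_x Q x
    = U_series (Q x) * lax_series Q x - lax_series Q x * U_series (Q x)"
proof -
  have "fps_X * fps_X * lax_series_x Q x
    - (U_series (Q x) * lax_series Q x - lax_series Q x * U_series (Q x)) = 0"
    by (rule mfps_eqI) (use lax_defects_vanish[OF assms] in simp)
  then show ?thesis by simp
qed

lemma lax_coeff_stationary:
  assumes "admissible Q" "\<And>x. blk_a (Q x) = 0" "\<And>x. blk_d (Q x) = 0"
  shows "(if k \<ge> 2 then Dx (lax_coeff Q (k - 2)) x else 0)
    = comm (\<i> *\<^sub>M sigma3) (lax_coeff Q k x) + (if k \<ge> 1 then comm (Q x) (lax_coeff Q (k - 1) x) else 0)"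
proof -
  have *: "mcoeff (fps_X * fps_X * lax_series_x Q x) k
      = mcoeff (U_series (Q x) * lax_series Q x - lax_series Q x * U_series (Q x)) k"
    by (simp only: lax_series_stationary[OF assms])
  consider "k = 0" | "k = 1" | j where "k = Suc (Suc j)" by (metis One_nat_def not0_implies_Suc)
  then show ?thesis
    using * by cases (simp_all add: U_series_def lax_series_def lax_series_x_def comm_def
      distrib_left distrib_right mult.assoc fps_X_left[of "mfps _"] numeral_2_eq_2)
qed

text \<open>The grading by conjugation with \<open>sigma3\<close>: even means block-diagonal, odd
  block-off-diagonal.\<close>

definition block_parity :: "bool \<Rightarrow> 'n::finite bmat \<Rightarrow> bool" where
  "block_parity e M \<longleftrightarrow> (if e then blk_b M = 0 \<and> blk_c M = 0 else blk_a M = 0 \<and> blk_d M = 0)"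

lemma block_parity_add: "block_parity e A \<Longrightarrow> block_parity e B \<Longrightarrow> block_parity e (A + B)"
  by (simp add: block_parity_def split: if_splits)

lemma block_parity_diff: "block_parity e A \<Longrightarrow> block_parity e B \<Longrightarrow> block_parity e (A - B)"
  by (simp add: block_parity_def split: if_splits)

lemma block_parity_zero: "block_parity e 0"
  by (simp add: block_parity_def)

lemma block_parity_sum: "(\<And>i. i \<in> I \<Longrightarrow> block_parity e (f i)) \<Longrightarrow> block_parity e (sum f I)"
  by (induction I rule: infinite_finite_induct) (auto simp: block_parity_zero block_parity_add)

lemma block_parity_mult: "block_parity e A \<Longrightarrow> block_parity e' B \<Longrightarrow> block_parity (e = e') (A ** B)"
  by (cases e; cases e') (simp_all add: block_parity_def)

lemma block_parity_Dx:
  assumes p: "\<And>x. block_parity e (F x)" and F: "bounded_smooth F"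
  shows "block_parity e (Dx F x)"
proof -
  have "(\<lambda>x. L (Dx F x)) = (\<lambda>x. 0)" if "bounded_linear L" "\<And>x. L (F x) = 0"
    for L :: "_ \<Rightarrow> 'c::euclidean_space"
    using Dx_linear[OF that(1) bounded_smooth_tame[OF F]] that(2) by (simp add: Dx_def)
  note l = fun_cong[OF this]
  show ?thesis
    using p l[OF bounded_linear_blk_parts(1)] l[OF bounded_linear_blk_parts(2)]
      l[OF bounded_linear_blk_parts(3)] l[OF bounded_linear_blk_parts(4)]
    by (simp add: block_parity_def split: if_splits)
qed

text \<open>All ingredients respect the grading when \<open>Q\<close> is odd. Equivalently
  \<open>W (- lambda) = sigma3 W sigma3\<close>, which is why \<open>a, d\<close> sit at even and
  \<open>b, c\<close> at odd powers.\<close>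

lemma lax_coeff_parity:
  assumes Q: "admissible Q" "\<And>x. blk_a (Q x) = 0" "\<And>x. blk_d (Q x) = 0"
  shows "block_parity (even k) (lax_coeff Q k x)"
proof (induction k arbitrary: x rule: less_induct)
  case (less k)
  consider "k = 0" | "k = 1" | j where "k = Suc (Suc j)" by (metis One_nat_def not0_implies_Suc)
  then show ?case
  proof cases
    case 3
    have "block_parity (even k) (\<Sum>i=1..Suc j. lax_coeff Q i x ** lax_coeff Q (Suc (Suc j) - i) x)"
    proof (rule block_parity_sum)
      fix i assume i: "i \<in> {1..Suc j}"
      then have "block_parity (even i = even (Suc (Suc j) - i)) (lax_coeff Q i x ** lax_coeff Q (Suc (Suc j) - i) x)"
        using 3 by (intro block_parity_mult less.IH) auto
      moreover have "(even i = even (Suc (Suc j) - i)) = even k" using i 3 by auto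
      ultimately show "block_parity (even k) (lax_coeff Q i x ** lax_coeff Q (Suc (Suc j) - i) x)" by simp
    qed
    then have "block_parity (even k) (solve_diag (\<Sum>i=1..Suc j. lax_coeff Q i x ** lax_coeff Q (Suc (Suc j) - i) x))"
      by (simp add: block_parity_def solve_diag_def split: if_splits)
    moreover have "block_parity (even k) (Dx (lax_coeff Q j) x)"
      using less.IH[of j] 3 by (intro block_parity_Dx lax_coeff_bounded_smooth Q) auto
    moreover have "block_parity (even k) (comm (Q x) (lax_coeff Q (Suc j) x))"
    proof -
      have a: "block_parity False (Q x)" using Q by (simp add: block_parity_def)
      have b: "block_parity (even (Suc j)) (lax_coeff Q (Suc j) x)" using 3 by (intro less.IH) auto
      show ?thesis using block_parity_mult[OF a b] block_parity_mult[OF b a] 3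
        by (cases "even j") (simp_all add: comm_def block_parity_diff)
    qed
    ultimately have "block_parity (even k) (Dx (lax_coeff Q j) x - comm (Q x) (lax_coeff Q (Suc j) x))"
      by (intro block_parity_diff)
    then have "block_parity (even k) (solve_off (Dx (lax_coeff Q j) x - comm (Q x) (lax_coeff Q (Suc j) x)))"
      by (simp add: block_parity_def solve_off_def split: if_splits)
    with \<open>block_parity (even k) (solve_diag _)\<close> show ?thesis
      unfolding 3 lax_coeff.simps by (intro block_parity_add)
  qed (use Q in \<open>simp_all add: block_parity_def\<close>)
qed

section \<open>The coefficients of the hierarchy are local\<close>

lemma scalar_product_simps:
  "scalar_product (u + u') v = scalar_product u v + scalar_product u' (v :: complex^'n)"
  "scalar_product u (v + v') = scalar_product u v + scalar_product u (v' :: complex^'n)"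
  "scalar_product (u - u') v = scalar_product u v - scalar_product u' (v :: complex^'n)"
  "scalar_product u (v - v') = scalar_product u v - scalar_product u (v' :: complex^'n)"
  "scalar_product (- u) v = - scalar_product u (v :: complex^'n)"
  "scalar_product u (- v) = - scalar_product u (v :: complex^'n)"
  "scalar_product (s *s u) v = s * scalar_product u (v :: complex^'n)"
  "scalar_product u (s *s v) = s * scalar_product u (v :: complex^'n)"
  by (simp_all add: scalar_product_def sum.distrib sum_subtractf sum_negf sum_distrib_left algebra_simps)

lemma scalar_product_commute: "scalar_product u v = scalar_product v (u :: complex^'n)"
  by (simp add: scalar_product_def mult.commute)

lemma outer_simps:
  "outer (u + u') v = outer u v + outer u' v" "outer u (v + v') = outer u v + outer u v'"
  "outer (u - u') v = outer u v - outer u' v" "outer u (v - v') = outer u v - outer u v'"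
  "outer (- u) v = - outer u v" "outer u (- v) = - outer u v"
  "outer (s *s u) v = s *\<^sub>M outer u v" "outer u (s *s v) = s *\<^sub>M outer u v"
  by (simp_all add: outer_def mscale_def vec_eq_iff algebra_simps)

lemma scalar_product_vector_matrix:
  "scalar_product (u v* D) v = scalar_product u (D *v (v :: complex^'n))"
proof -
  have "scalar_product (u v* D) v = (\<Sum>i\<in>UNIV. \<Sum>j\<in>UNIV. D $ j $ i * u $ j * v $ i)"
    by (simp add: scalar_product_def vector_matrix_mult_def sum_distrib_left mult_ac)
  also have "\<dots> = (\<Sum>j\<in>UNIV. \<Sum>i\<in>UNIV. D $ j $ i * u $ j * v $ i)" by (rule sum.swap)
  also have "\<dots> = scalar_product u (D *v v)"
    by (simp add: scalar_product_def matrix_vector_mult_def sum_distrib_left mult_ac)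
  finally show ?thesis .
qed

lemma matrix_outer: "A ** outer u v = outer (A *v u) (v :: complex^'n)"
  by (simp add: matrix_matrix_mult_def outer_def vec_eq_iff matrix_vector_mult_def sum_distrib_left mult_ac)

lemma outer_matrix: "outer u v ** A = outer u ((v :: complex^'n) v* A)"
  by (simp add: matrix_matrix_mult_def outer_def vec_eq_iff vector_matrix_mult_def
      sum_distrib_left mult_ac)

lemma transpose_outer: "transpose (outer u v) = outer v u"
  by (simp add: transpose_def outer_def vec_eq_iff mult.commute)

lemma matrix_vsmult: "A *v (s *s v) = s *s (A *v (v :: complex^'n))" "(s *\<^sub>M A) *v v = s *s (A *v v)"
  "w v* (s *\<^sub>M A) = s *s (w v* A)" "s *s (t *s v) = (s * t) *s v"
  by (simp_all add: vec_eq_iff matrix_vector_mult_def vector_matrix_mult_def sum_distrib_left mult_ac mscale_def)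

lemma vsmult_distrib: "s *s (u + v) = s *s u + s *s (v :: complex^'n)" "s *s (u - v) = s *s u - s *s (v :: complex^'n)"
  "(s + t) *s u = s *s u + t *s u" "(s - t) *s u = s *s u - t *s u"
  by (simp_all add: vec_eq_iff algebra_simps)

text \<open>The zero form, with the one-dimensional space \<open>real\<close> as a dummy argument,
  makes \<open>Dx\<close> an instance of the abstract operator.\<close>

lemma Dx_connection_op: "(Dx :: (real \<Rightarrow> 'a::euclidean_space) \<Rightarrow> _) = connection_op (\<lambda>(m::real) a. 0) (\<lambda>x. 0)"
  by (simp add: connection_op_def fun_eq_iff)

lemma connection_Dx: "connection (\<lambda>(m::real) (a::'a::euclidean_space). 0) (\<lambda>x. 0)"
  by (rule connection.intro) (simp_all add: bounded_bilinearI_euclidean admissible_zero)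

lemma cov_D_connection_op: "cov_D s M = connection_op (\<lambda>m F. s *\<^sub>M comm m F) M"
  by (simp add: cov_D_def connection_op_def fun_eq_iff)

lemma connection_cov_D:
  assumes "admissible M"
  shows "connection (\<lambda>m F. s *\<^sub>M comm m F) (M :: real \<Rightarrow> complex^'n^'n)"
proof (rule connection.intro)
  interpret c: bounded_bilinear "comm :: complex^'n^'n \<Rightarrow> _" by (rule bounded_bilinear_comm)
  show "bounded_bilinear (\<lambda>m F :: complex^'n^'n. s *\<^sub>M comm m F)"
    by (rule bounded_bilinearI_euclidean)
      (simp_all add: c.add_left c.add_right c.scaleR_left c.scaleR_right mscale_distrib,
       simp_all add: mscale_def vec_eq_iff)
qed (rule assms)

lemma admissible_Qmat:
  fixes q r :: "real \<Rightarrow> complex^'n"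
  assumes "admissible q" "admissible r"
  shows "admissible (\<lambda>x. Qmat (q x) (r x))"
proof -
  have "bounded_linear (\<lambda>u::complex^'n. Qmat u 0)" "bounded_linear (\<lambda>u::complex^'n. Qmat 0 u)"
    by (rule bounded_linearI_euclidean; rule blk_eqI; simp)+
  from admissible_add[OF admissible_linear[OF this(1) assms(1)] admissible_linear[OF this(2) assms(2)]]
  have "admissible (\<lambda>x. Qmat (q x) 0 + Qmat 0 (r x))" .
  moreover have "Qmat u 0 + Qmat 0 v = Qmat u (v :: complex^'n)" for u v by (rule blk_eqI) simp_all
  ultimately show ?thesis by simp
qed

text \<open>The diagonal blocks of the stationary equation: commutation with \<open>sigma3\<close>
  contributes nothing there, so only \<open>Q\<close> and the next odd coefficient enter.\<close>

lemma lax_coeff_Dx_even: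
  fixes q r :: "real \<Rightarrow> complex^'n"
  assumes Q: "admissible (\<lambda>x. Qmat (q x) (r x))"
  defines "W \<equiv> lax_coeff (\<lambda>x. Qmat (q x) (r x))"
  shows "blk_a (Dx (W (2 * m)) x) = scalar_product (r x) (blk_b (W (2 * m + 1) x)) - scalar_product (blk_c (W (2 * m + 1) x)) (q x)"
    and "blk_d (Dx (W (2 * m)) x) = outer (q x) (blk_c (W (2 * m + 1) x)) - outer (blk_b (W (2 * m + 1) x)) (r x)"
  using lax_coeff_stationary[OF Q, of "2 * m + 2" x]
  by (simp_all add: W_def comm_sigma3_parts comm_Qmat_parts)

lemma lax_coeff_Dx_odd:
  fixes q r :: "real \<Rightarrow> complex^'n"
  assumes Q: "admissible (\<lambda>x. Qmat (q x) (r x))"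
  defines "W \<equiv> lax_coeff (\<lambda>x. Qmat (q x) (r x))"
  shows "blk_b (Dx (W (2 * m + 1)) x) = (- 2 * \<i>) *s blk_b (W (2 * m + 3) x)
      + (blk_a (W (2 * m + 2) x) *s q x - blk_d (W (2 * m + 2) x) *v q x)"
    and "blk_c (Dx (W (2 * m + 1)) x) = (2 * \<i>) *s blk_c (W (2 * m + 3) x)
      + (r x v* blk_d (W (2 * m + 2) x) - blk_a (W (2 * m + 2) x) *s r x)"
  using lax_coeff_stationary[OF Q, of "2 * m + 3" x]
  by (simp_all add: W_def comm_sigma3_parts comm_Qmat_parts numeral_3_eq_3 numeral_2_eq_2)

lemma bounded_linear_scaled_blk_parts:
  fixes s :: complex
  shows "bounded_linear (\<lambda>M. s * blk_a M)" "bounded_linear (\<lambda>M. s *\<^sub>M blk_d M)"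
    "bounded_linear (\<lambda>M. s *s blk_b M)" "bounded_linear (\<lambda>M. s *s blk_c M)"
  by (rule bounded_linearI_euclidean; simp add: vec_eq_iff mscale_def algebra_simps)+

text \<open>The recursion eliminates the new off-diagonal coefficient: substituting the odd
  equations into the even ones expresses the derivatives of \<open>a\<close> and \<open>d\<close> by
  those of the previous \<open>b\<close> and \<open>c\<close>. As the local coefficients decay at
  both ends, they are what \<open>formal_inverse\<close> selects; a general \<open>\<alpha>\<close>
  enters by linearity.\<close>

lemma KN_eq_lax_coeff:
  fixes q r :: "real \<Rightarrow> complex^'n"
  assumes q: "admissible q" and r: "admissible r"
  defines "W \<equiv> lax_coeff (\<lambda>x. Qmat (q x) (r x))"
  shows "KN_a \<alpha> q r m = (\<lambda>x. \<alpha> * blk_a (W (2 * m) x)) \<and> KN_d \<alpha> q r m = (\<lambda>x. \<alpha> *\<^sub>M blk_d (W (2 * m) x))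
    \<and> KN_b \<alpha> q r m = (\<lambda>x. \<alpha> *s blk_b (W (2 * m + 1) x)) \<and> KN_c \<alpha> q r m = (\<lambda>x. \<alpha> *s blk_c (W (2 * m + 1) x))"
proof (induction m)
  case 0
  show ?case by (simp add: W_def fun_eq_iff) (simp add: vec_eq_iff mscale_def mat_def)
next
  case (Suc m)
  have Q: "admissible (\<lambda>x. Qmat (q x) (r x))" by (rule admissible_Qmat[OF q r])
  have Wadm: "admissible (W k)" if "k \<ge> 1" for k
    unfolding W_def by (rule lax_coeff_admissible[OF Q that])
  have Wvd: "(W k has_vector_derivative Dx (W k) x) (at x)" for k x
    unfolding W_def by (rule lax_coeff_vd[OF Q])
  have IH: "KN_b \<alpha> q r m = (\<lambda>x. \<alpha> *s blk_b (W (2 * m + 1) x))" "KN_c \<alpha> q r m = (\<lambda>x. \<alpha> *s blk_c (W (2 * m + 1) x))"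
    using Suc by auto
  note lin = bounded_linear_scaled_blk_parts[of \<alpha>]
  have t: "tame True (W (2 * m + 1))" by (rule admissible_tame[OF Wadm]) simp
  have Dbc: "Dx (KN_b \<alpha> q r m) = (\<lambda>x. \<alpha> *s blk_b (Dx (W (2 * m + 1)) x))"
    "Dx (KN_c \<alpha> q r m) = (\<lambda>x. \<alpha> *s blk_c (Dx (W (2 * m + 1)) x))"
    unfolding IH by (rule Dx_linear[OF lin(3) t], rule Dx_linear[OF lin(4) t])
  note odd = lax_coeff_Dx_odd[OF Q, of m, folded W_def]
  have idx: "2 * Suc m = 2 * m + 2" "2 * Suc m + 1 = 2 * m + 3" by auto
  note even = lax_coeff_Dx_even[OF Q, of "Suc m", folded W_def, unfolded idx(2), unfolded idx(1)]
  define A where "A x = \<alpha> * blk_a (W (2 * m + 2) x)" for x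
  define D where "D x = \<alpha> *\<^sub>M blk_d (W (2 * m + 2) x)" for x
  have Aadm: "admissible A" unfolding A_def[abs_def] by (rule admissible_linear[OF lin(1) Wadm]) simp
  have Dadm: "admissible D" unfolding D_def[abs_def] by (rule admissible_linear[OF lin(2) Wadm]) simp
  have a: "KN_a \<alpha> q r (Suc m) = A"
    unfolding KN_a.simps Dx_connection_op Dbc[unfolded Dx_connection_op]
  proof (rule connection.formal_inverse_eqI[OF connection_Dx])
    fix x
    \<comment> \<open>After substitution the terms in \<open>a\<close> and \<open>d\<close> cancel,
      and the factors \<open>i/2\<close> and \<open>-2 i\<close> multiply to 1.\<close>
    show "(A has_vector_derivative \<i>/2 * (scalar_product (r x) (\<alpha> *s blk_b (connection_op (\<lambda>(m::real) a. 0) (\<lambda>x. 0) (W (2 * m + 1)) x))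
        + scalar_product (\<alpha> *s blk_c (connection_op (\<lambda>(m::real) a. 0) (\<lambda>x. 0) (W (2 * m + 1)) x)) (q x)) - 0) (at x)"
      unfolding Dx_connection_op[symmetric]
      using bounded_linear.has_vector_derivative[OF lin(1) Wvd[of "2 * m + 2" x]]
      unfolding A_def[abs_def] odd even
      by (simp add: scalar_product_simps scalar_product_vector_matrix algebra_simps)
  qed (rule admissible_decay[OF Aadm])+
  have d: "KN_d \<alpha> q r (Suc m) = D"
    unfolding KN_d.simps cov_D_connection_op Dbc
  proof (rule connection.formal_inverse_eqI[OF connection_cov_D])
    show "admissible (\<lambda>x. outer (q x) (r x))" by (rule admissible_bilinear[OF bounded_bilinear_outer q r])
    fix x
    \<comment> \<open>Here the terms in \<open>a\<close> cancel, while those in \<open>d\<close>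
      assemble to the commutator with \<open>outer q r\<close>.\<close>
    show "(D has_vector_derivative - (\<i>/2) *\<^sub>M (outer (\<alpha> *s blk_b (Dx (W (2 * m + 1)) x)) (r x)
        + outer (q x) (\<alpha> *s blk_c (Dx (W (2 * m + 1)) x))) - - (\<i>/2) *\<^sub>M comm (outer (q x) (r x)) (D x)) (at x)"
      using bounded_linear.has_vector_derivative[OF lin(2) Wvd[of "2 * m + 2" x]]
      unfolding D_def[abs_def] odd even comm_def
      by (simp add: outer_simps matrix_outer outer_matrix mscale_distrib matrix_vsmult algebra_simps)
  qed (rule admissible_decay[OF Dadm])+
  have b: "KN_b \<alpha> q r (Suc m) = (\<lambda>x. \<alpha> *s blk_b (W (2 * m + 3) x))"
    unfolding KN_b.simps a d Dbc
    by (rule ext, simp only: A_def D_def odd matrix_vsmult, simp add: vec_eq_iff field_simps)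
  have c: "KN_c \<alpha> q r (Suc m) = (\<lambda>x. \<alpha> *s blk_c (W (2 * m + 3) x))"
    unfolding KN_c.simps a d Dbc
    by (rule ext, simp only: A_def D_def odd transpose_matrix_vector matrix_vsmult, simp add: vec_eq_iff field_simps)
  show ?case unfolding a b c d idx(2) unfolding idx(1) A_def[abs_def] D_def[abs_def] by simp
qed

lemmas KN_eq = KN_eq_lax_coeff[THEN conjunct1] KN_eq_lax_coeff[THEN conjunct2, THEN conjunct1]
  KN_eq_lax_coeff[THEN conjunct2, THEN conjunct2, THEN conjunct1]
  KN_eq_lax_coeff[THEN conjunct2, THEN conjunct2, THEN conjunct2]

text \<open>Parity supplies the two zero blocks, \<open>KN_eq_lax_coeff\<close> the other
  two.\<close>

lemma KN_W_eq_lax_coeff: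
  fixes q r :: "real \<Rightarrow> complex^'n"
  assumes q: "admissible q" and r: "admissible r"
  shows "KN_W \<alpha> q r (int k) x = \<alpha> *\<^sub>M lax_coeff (\<lambda>x. Qmat (q x) (r x)) k x"
proof -
  have p: "block_parity (even k) (lax_coeff (\<lambda>x. Qmat (q x) (r x)) k x)"
    by (rule lax_coeff_parity[OF admissible_Qmat[OF q r]]) simp_all
  show ?thesis
  proof (cases "even k")
    case True
    then have "2 * (k div 2) = k" by simp
    then show ?thesis
      using p True by (simp add: KN_W_def Let_def KN_eq[OF q r] block_parity_def blk_eq_iff)
  next
    case False
    then have "Suc (2 * (k div 2)) = k" by presburger
    then show ?thesis
      using p False by (simp add: KN_W_def Let_def KN_eq[OF q r] block_parity_def blk_eq_iff)
  qed
qed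

lemma KN_W_negative: "k < 0 \<Longrightarrow> KN_W \<alpha> q r k x = 0"
  by (simp add: KN_W_def)

lemma comm_mscale [simp]: "comm A (s *\<^sub>M B) = s *\<^sub>M comm A B" "comm A (0 :: complex^'n^'n) = 0"
  by (simp_all add: comm_def mscale_distrib)

text \<open>Below order 0 only the orders -2 and -1 carry a condition: in the former
  \<open>i sigma3\<close> commutes with itself, in the latter the two mixed commutators of
  \<open>i sigma3\<close> and \<open>Q\<close> cancel.\<close>

lemma KN_W_stationary:
  fixes q r :: "real \<Rightarrow> complex^'n"
  assumes q: "admissible q" and r: "admissible r"
  shows "stationary_zero_curvature q r (KN_W \<alpha> q r)"
  unfolding stationary_zero_curvature_def
proof (intro allI)
  fix k :: int and x :: real
  have Q: "admissible (\<lambda>x. Qmat (q x) (r x))" by (rule admissible_Qmat[OF q r])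
  note W = KN_W_eq_lax_coeff[OF q r, of \<alpha>]
  consider "k \<ge> 0" | "k = -1" | "k = -2" | "k < -2" by linarith
  then show "(KN_W \<alpha> q r k has_vector_derivative
      comm (\<i> *\<^sub>M sigma3) (KN_W \<alpha> q r (k + 2) x) + comm (Qmat (q x) (r x)) (KN_W \<alpha> q r (k + 1) x)) (at x)"
  proof cases
    case 1
    then obtain j where j: "k = int j" using nonneg_int_cases by blast
    have "((\<lambda>x. \<alpha> *\<^sub>M lax_coeff (\<lambda>x. Qmat (q x) (r x)) j x) has_vector_derivative
        \<alpha> *\<^sub>M Dx (lax_coeff (\<lambda>x. Qmat (q x) (r x)) j) x) (at x)"
      by (rule bounded_linear.has_vector_derivative[OF bounded_linear_mscale lax_coeff_vd[OF Q]])
    moreover have "Dx (lax_coeff (\<lambda>x. Qmat (q x) (r x)) j) x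
        = comm (\<i> *\<^sub>M sigma3) (lax_coeff (\<lambda>x. Qmat (q x) (r x)) (j + 2) x)
          + comm (Qmat (q x) (r x)) (lax_coeff (\<lambda>x. Qmat (q x) (r x)) (j + 1) x)"
      using lax_coeff_stationary[OF Q, of "j + 2" x] by simp
    moreover have "KN_W \<alpha> q r (k + 2) x = \<alpha> *\<^sub>M lax_coeff (\<lambda>x. Qmat (q x) (r x)) (j + 2) x"
      "KN_W \<alpha> q r (k + 1) x = \<alpha> *\<^sub>M lax_coeff (\<lambda>x. Qmat (q x) (r x)) (j + 1) x"
      using W[of "j + 2" x] W[of "j + 1" x] by (simp_all add: j add.commute)
    moreover have "KN_W \<alpha> q r k = (\<lambda>x. \<alpha> *\<^sub>M lax_coeff (\<lambda>x. Qmat (q x) (r x)) j x)"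
      using W[of j] by (simp add: j fun_eq_iff)
    ultimately show ?thesis by (simp only: comm_mscale mscale_distrib)
  next
    case 2
    have z: "KN_W \<alpha> q r k = (\<lambda>x. 0)" using 2 by (simp add: KN_W_negative fun_eq_iff)
    have "KN_W \<alpha> q r 1 x = \<alpha> *\<^sub>M Qmat (q x) (r x)" "KN_W \<alpha> q r 0 x = \<alpha> *\<^sub>M \<i> *\<^sub>M sigma3"
      using W[of 1 x] W[of 0 x] by simp_all
    then have "comm (\<i> *\<^sub>M sigma3) (KN_W \<alpha> q r (k + 2) x) + comm (Qmat (q x) (r x)) (KN_W \<alpha> q r (k + 1) x) = 0"
      using 2 by (simp add: comm_def mscale_distrib algebra_simps)
    then show ?thesis unfolding z by simp
  next
    case 3
    have z: "KN_W \<alpha> q r k = (\<lambda>x. 0)" using 3 by (simp add: KN_W_negative fun_eq_iff)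
    have "KN_W \<alpha> q r 0 x = \<alpha> *\<^sub>M \<i> *\<^sub>M sigma3" "KN_W \<alpha> q r (-1) x = 0"
      using W[of 0 x] by (simp_all add: KN_W_negative)
    then have "comm (\<i> *\<^sub>M sigma3) (KN_W \<alpha> q r (k + 2) x) + comm (Qmat (q x) (r x)) (KN_W \<alpha> q r (k + 1) x) = 0"
      using 3 by (simp add: comm_def mult_ac)
    then show ?thesis unfolding z by simp
  next
    case 4
    then have "KN_W \<alpha> q r k = (\<lambda>x. 0)" "KN_W \<alpha> q r (k + 2) x = 0" "KN_W \<alpha> q r (k + 1) x = 0"
      by (simp_all add: KN_W_negative fun_eq_iff)
    then show ?thesis by simp
  qed
qed

lemma KN_admissible:
  fixes q r :: "real \<Rightarrow> complex^'n"
  assumes q: "admissible q" and r: "admissible r"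
  shows "admissible (KN_a \<alpha> q r (Suc m))" "admissible (KN_d \<alpha> q r (Suc m))"
    "admissible (KN_b \<alpha> q r m)" "admissible (KN_c \<alpha> q r m)"
proof -
  have W: "admissible (lax_coeff (\<lambda>x. Qmat (q x) (r x)) k)" if "k \<ge> 1" for k
    by (rule lax_coeff_admissible[OF admissible_Qmat[OF q r] that])
  note lin = bounded_linear_scaled_blk_parts[of \<alpha>]
  show "admissible (KN_a \<alpha> q r (Suc m))" "admissible (KN_d \<alpha> q r (Suc m))"
    "admissible (KN_b \<alpha> q r m)" "admissible (KN_c \<alpha> q r m)"
    unfolding KN_eq[OF q r]
    by (rule admissible_linear[OF lin(1) W] admissible_linear[OF lin(2) W]
        admissible_linear[OF lin(3) W] admissible_linear[OF lin(4) W]; simp)+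
qed

section \<open>Polynomial curves of admissible functions\<close>

text \<open>Families that are polynomial in the deformation parameter, in Horner form; along them one
  may differentiate in the parameter under the integral sign.\<close>

inductive poly_curve :: "(real \<Rightarrow> real \<Rightarrow> 'a::euclidean_space) \<Rightarrow> bool" where
  const: "admissible f \<Longrightarrow> poly_curve (\<lambda>e. f)"
| step: "admissible f \<Longrightarrow> poly_curve G \<Longrightarrow> poly_curve (\<lambda>e x. f x + e *\<^sub>R G e x)"

lemma poly_curve_admissible: "poly_curve G \<Longrightarrow> admissible (G e)"
proof (induction rule: poly_curve.induct)
  case (step f G)
  show ?case
    by (rule admissible_add[OF step(1) admissible_linear[OF bounded_linear_scaleR_right step(3)]])
qed simp

lemma poly_curve_add:
  assumes "poly_curve G" "poly_curve H"
  shows "poly_curve (\<lambda>e x. G e x + H e x)"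
  using assms
proof (induction G arbitrary: H rule: poly_curve.induct)
  case (const f)
  from const(2) show ?case
  proof cases
    case (const g)
    then show ?thesis using poly_curve.const[OF admissible_add[OF \<open>admissible f\<close>, of g]] by simp
  next
    case (step g H')
    then show ?thesis using poly_curve.step[OF admissible_add[OF \<open>admissible f\<close>, of g], of H']
      by (simp add: add.assoc)
  qed
next
  case (step f G)
  from step(4) show ?case
  proof cases
    case (const g)
    then show ?thesis using poly_curve.step[OF admissible_add[OF step(1), of g] step(2)]
      by (simp add: add_ac)
  next
    case s: (step g H')
    have "(\<lambda>e x. f x + e *\<^sub>R G e x + H e x) = (\<lambda>e x. (f x + g x) + e *\<^sub>R (G e x + H' e x))"
      using s(1) by (simp add: algebra_simps)
    then show ?thesis using poly_curve.step[OF admissible_add[OF step(1) s(2)] step(3)[OF s(3)]] by simp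
  qed
qed

lemma poly_curve_scale: "poly_curve G \<Longrightarrow> poly_curve (\<lambda>e x. e *\<^sub>R G e x)"
  using poly_curve.step[OF admissible_zero, of G] by simp

lemma poly_curve_linear: "poly_curve G \<Longrightarrow> bounded_linear T \<Longrightarrow> poly_curve (\<lambda>e x. T (G e x))"
proof (induction rule: poly_curve.induct)
  case (const f)
  then show ?case using admissible_linear poly_curve.const by blast
next
  case (step f G)
  then show ?case
    using poly_curve.step[OF admissible_linear[OF step(4,1)] step(3)[OF step(4)]]
    by (simp add: linear_add linear_scale bounded_linear.linear)
qed

lemma poly_curve_bilinear:
  assumes B: "bounded_bilinear B" and "poly_curve G" and H: "poly_curve H"
  shows "poly_curve (\<lambda>e x. B (G e x) (H e x))"
proof -
  have *: "poly_curve (\<lambda>e x. B (f x) (H e x))" if f: "admissible f" for f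
    using H
  proof (induction rule: poly_curve.induct)
    case (const g)
    then show ?case using poly_curve.const[OF admissible_bilinear[OF B f const]] by simp
  next
    case (step g H')
    then show ?case using poly_curve.step[OF admissible_bilinear[OF B f step(1)] step(3)]
      by (simp add: bounded_bilinear.add_right[OF B] bounded_bilinear.scaleR_right[OF B])
  qed
  show ?thesis using assms(2)
  proof (induction rule: poly_curve.induct)
    case (const f)
    then show ?case by (rule *)
  next
    case (step f G)
    from poly_curve_add[OF *[OF step(1)] poly_curve_scale[OF step(3)]] show ?case
      by (simp add: bounded_bilinear.add_left[OF B] bounded_bilinear.scaleR_left[OF B])
  qed
qed

lemma poly_curve_sum:
  "(\<And>i. i \<in> I \<Longrightarrow> poly_curve (G i)) \<Longrightarrow> poly_curve (\<lambda>e x. \<Sum>i\<in>I. G i e x)"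
proof (induction I rule: infinite_finite_induct)
  case (insert i I)
  then show ?case using poly_curve_add[of "G i" "\<lambda>e x. \<Sum>i\<in>I. G i e x"] by simp
qed (simp_all add: poly_curve.const[OF admissible_zero])

lemma Dx_horner:
  assumes "admissible f" "admissible g"
  shows "Dx (\<lambda>x. f x + e *\<^sub>R g x) = (\<lambda>x. Dx f x + e *\<^sub>R Dx g x)"
  by (rule Dx_eqI, rule has_vector_derivative_add[OF admissible_vd[OF assms(1)]
        bounded_linear.has_vector_derivative[OF bounded_linear_scaleR_right admissible_vd[OF assms(2)]]])

lemma poly_curve_Dx: "poly_curve G \<Longrightarrow> poly_curve (\<lambda>e. Dx (G e))"
proof (induction rule: poly_curve.induct)
  case (const f)
  then show ?case using poly_curve.const admissible_Dx by blast
next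
  case (step f G)
  then show ?case using poly_curve.step[OF admissible_Dx[OF step(1)] step(3)]
    by (simp add: Dx_horner poly_curve_admissible)
qed

lemma horner_vd:
  assumes "(\<phi> has_vector_derivative \<phi>') (at 0)"
  shows "((\<lambda>e. c + e *\<^sub>R \<phi> e) has_vector_derivative \<phi> 0) (at 0)"
  using has_vector_derivative_add[OF has_vector_derivative_const[of c]
      has_vector_derivative_scaleR[OF DERIV_ident assms]] by simp

text \<open>In Horner form the derivative of \<open>f + e G e\<close> at \<open>e = 0\<close> is the
  value \<open>G 0\<close>; the induction hypothesis supplies differentiability of \<open>G\<close>
  for the product rule. The integral enters by linearity alone.\<close>

lemma poly_curve_variation:
  assumes "poly_curve G"
  obtains d where "admissible d" "\<And>x. ((\<lambda>e. G e x) has_vector_derivative d x) (at 0)"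
    "\<And>x. ((\<lambda>e. Dx (G e) x) has_vector_derivative Dx d x) (at 0)"
    "((\<lambda>e. integral\<^sup>L lborel (G e)) has_vector_derivative integral\<^sup>L lborel d) (at 0)"
proof -
  have "\<exists>d. admissible d \<and> (\<forall>x. ((\<lambda>e. G e x) has_vector_derivative d x) (at 0)) \<and>
    (\<forall>x. ((\<lambda>e. Dx (G e) x) has_vector_derivative Dx d x) (at 0)) \<and>
    ((\<lambda>e. integral\<^sup>L lborel (G e)) has_vector_derivative integral\<^sup>L lborel d) (at 0)"
    using assms
  proof (induction rule: poly_curve.induct)
    case (const f)
    have "Dx (\<lambda>x. 0::'a) = (\<lambda>x. 0)" by (simp add: Dx_def)
    then show ?case by (intro exI[of _ "\<lambda>x. 0"]) (simp add: admissible_zero)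
  next
    case (step f G)
    then obtain d where d: "\<And>x. ((\<lambda>e. G e x) has_vector_derivative d x) (at 0)"
      "\<And>x. ((\<lambda>e. Dx (G e) x) has_vector_derivative Dx d x) (at 0)"
      "((\<lambda>e. integral\<^sup>L lborel (G e)) has_vector_derivative integral\<^sup>L lborel d) (at 0)" by blast
    have adm: "admissible (G e)" for e by (rule poly_curve_admissible[OF step(2)])
    have "integral\<^sup>L lborel (\<lambda>x. f x + e *\<^sub>R G e x) = integral\<^sup>L lborel f + e *\<^sub>R integral\<^sup>L lborel (G e)" for e
      using admissible_integrable[OF step(1)] admissible_integrable[OF adm] by simp
    then show ?case
      using horner_vd[OF d(1)] horner_vd[OF d(2)] horner_vd[OF d(3)]
      by (intro exI[of _ "G 0"]) (simp add: adm Dx_horner[OF step(1) adm])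
  qed
  then show ?thesis using that by blast
qed

lemma integral_Dx_zero: "admissible F \<Longrightarrow> integral\<^sup>L lborel (Dx F) = 0"
  using integral_total_derivative[OF admissible_vd admissible_integrable[OF admissible_Dx]
      admissible_continuous[OF admissible_Dx] admissible_decay(1,2)] by simp

section \<open>The trace identity\<close>

lemma poly_curve_lax_coeff:
  assumes Q: "poly_curve Q" and "k \<ge> 1"
  shows "poly_curve (\<lambda>e. lax_coeff (Q e) k)"
  using \<open>k \<ge> 1\<close>
proof (induction k rule: less_induct)
  case (less k)
  consider "k = 1" | j where "k = Suc (Suc j)"
    using less.prems by (metis One_nat_def Suc_le_D not0_implies_Suc)
  then show ?case
  proof cases
    case 2
    have "poly_curve (\<lambda>e x. \<Sum>i=1..Suc j. lax_coeff (Q e) i x ** lax_coeff (Q e) (Suc (Suc j) - i) x)"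
      by (rule poly_curve_sum, rule poly_curve_bilinear[OF bounded_bilinear_matrix_matrix])
        (use 2 in \<open>auto intro!: less.IH\<close>)
    moreover have "poly_curve (\<lambda>e. Dx (lax_coeff (Q e) j))"
    proof (cases "j = 0")
      case True
      then have "(\<lambda>e. Dx (lax_coeff (Q e) j)) = (\<lambda>e x. 0)" by (simp add: Dx_def)
      then show ?thesis using poly_curve.const[OF admissible_zero] by simp
    next
      case False
      then show ?thesis using less.IH[of j] 2 by (simp add: poly_curve_Dx)
    qed
    moreover have "poly_curve (\<lambda>e x. - comm (Q e x) (lax_coeff (Q e) (Suc j) x))"
      using 2 by (intro poly_curve_linear[OF _ bounded_linear_minus[OF bounded_linear_ident]]
          poly_curve_bilinear[OF bounded_bilinear_comm] Q less.IH) auto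
    ultimately have "poly_curve (\<lambda>e x.
      solve_diag (\<Sum>i=1..Suc j. lax_coeff (Q e) i x ** lax_coeff (Q e) (Suc (Suc j) - i) x)
      + solve_off (Dx (lax_coeff (Q e) j) x + - comm (Q e x) (lax_coeff (Q e) (Suc j) x)))"
      by (intro poly_curve_add poly_curve_linear[OF _ bounded_linear_solve(1)]
          poly_curve_linear[OF _ bounded_linear_solve(2)])
    then show ?thesis unfolding 2 lax_coeff.simps by simp
  qed (use Q in simp)
qed

text \<open>With \<open>D = \<delta>W\<close>, \<open>T = \<lambda> \<partial>\<^sub>\<lambda> W\<close>, \<open>X = \<lambda>\<^sup>2\<close>, \<open>V = \<lambda>\<^sup>3 \<partial>\<^sub>\<lambda> U\<close>,
  and \<open>U\<close>, \<open>dU\<close> standing for \<open>\<lambda>\<^sup>2 U\<close>, \<open>\<lambda>\<^sup>2 \<delta>U\<close>: up to an \<open>x\<close>-derivative,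
  \<open>tr (\<delta>U \<partial>\<^sub>\<lambda> W) = tr (\<partial>\<^sub>\<lambda> U \<delta>W)\<close>.\<close>

lemma trace_identity_algebra:
  fixes W W' D D' T T' U dU V X :: "'a::ring_1" and t :: "'a \<Rightarrow> complex"
  assumes X: "\<And>A. A * X = X * A"
    and t: "\<And>A B. t (A + B) = t A + t B" "\<And>A B. t (A * B) = t (B * A)"
    and W: "X * W' = U * W - W * U"
    and D: "X * D' = (dU * W - W * dU) + (U * D - D * U)"
    and T: "X * T' = (V * W - W * V) + (U * T - T * U)"
    and WW: "W * W = - 1" and WD: "W * D = - (D * W)" and WT: "W * T = - (T * W)"
  shows "t (X * (W' * (D * T - T * D) + W * (D' * T + D * T' - T' * D - T * D'))) = 4 * t (dU * T) - 4 * t (V * D)"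
proof -
  have t0: "t 0 = 0" using t(1)[of 0 0] by simp
  have tm: "t (- A) = - t A" for A using t(1)[of A "- A"] t0 by (simp add: eq_neg_iff_add_eq_0 add.commute)
  have td: "t (A - B) = t A - t B" for A B using t(1)[of A "- B"] tm by simp
  have Xl: "A * (X * B) = X * (A * B)" for A B by (simp only: mult.assoc[symmetric] X)
  have "X * (W' * (D * T - T * D) + W * (D' * T + D * T' - T' * D - T * D'))
      = (X * W') * (D * T - T * D) + W * ((X * D') * T + D * (X * T') - (X * T') * D - T * (X * D'))"
    by (simp add: algebra_simps Xl[of W] Xl[of D] Xl[of T])
  also have "\<dots> = (U * (W * (D * T - T * D)) - (W * (D * T - T * D)) * U)
      + (W * dU * W * T - W * W * dU * T - W * T * dU * W + W * T * W * dU)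
      + (W * D * V * W - W * D * W * V - W * V * W * D + W * W * V * D)"
    unfolding W D T by (simp add: algebra_simps)
  finally have eq: "X * (W' * (D * T - T * D) + W * (D' * T + D * T' - T' * D - T * D')) = \<dots>" .
  \<comment> \<open>By these relations and cyclicity each of the four terms with \<open>dU\<close>
    contributes \<open>+ t (dU * T)\<close> and each of the four with \<open>V\<close> contributes
    \<open>- t (V * D)\<close>; the commutator with \<open>U\<close> has trace 0.\<close>
  have WTW: "W * T * W = T" by (simp add: WT mult.assoc WW)
  have WDW: "W * D * W = D" by (simp add: WD mult.assoc WW)
  have "t (W * dU * W * T) = t (dU * T)"
    using t(2)[of W "dU * W * T"] by (simp add: mult.assoc WTW[unfolded mult.assoc])
  moreover have "t (W * W * dU * T) = - t (dU * T)" by (simp add: WW tm)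
  moreover have "t (W * T * dU * W) = - t (dU * T)"
  proof -
    have "t (W * T * dU * W) = t (W * (W * T * dU))" by (rule t(2))
    also have "W * (W * T * dU) = W * W * (T * dU)" by (simp only: mult.assoc)
    also have "\<dots> = - (T * dU)" by (simp add: WW)
    finally show ?thesis by (simp add: tm t(2)[of T])
  qed
  moreover have "t (W * T * W * dU) = t (dU * T)" unfolding WTW by (rule t(2))
  moreover have "t (W * D * V * W) = - t (V * D)"
  proof -
    have "t (W * D * V * W) = t (W * (W * D * V))" by (rule t(2))
    also have "W * (W * D * V) = W * W * (D * V)" by (simp only: mult.assoc)
    also have "\<dots> = - (D * V)" by (simp add: WW)
    finally show ?thesis by (simp add: tm t(2)[of D])
  qed
  moreover have "t (W * D * W * V) = t (V * D)" unfolding WDW by (rule t(2))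
  moreover have "t (W * V * W * D) = t (V * D)"
    using t(2)[of W "V * W * D"] by (simp add: mult.assoc WDW[unfolded mult.assoc])
  moreover have "t (W * W * V * D) = - t (V * D)" by (simp add: WW tm)
  ultimately show ?thesis unfolding eq t(1) td t(2)[of U] by simp
qed

text \<open>For each \<open>k\<close> a functional that is additive and cyclic, as
  \<open>trace_identity_algebra\<close> requires of \<open>t\<close>.\<close>

definition mtrace :: "nat \<Rightarrow> ('n::finite) sqm fps \<Rightarrow> complex" where
  "mtrace k A = trace (mcoeff A k)"

lemma trace_mscale: "trace (s *\<^sub>M M) = s * trace (M :: complex^'n^'n)"
  by (simp add: trace_def mscale_def sum_distrib_left)

lemma trace_uminus: "trace (- M) = - trace (M :: complex^'n^'n)"
  by (simp add: trace_def sum_negf)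

lemma trace_sum: "trace (sum f I) = (\<Sum>i\<in>I. trace (f i :: complex^'n^'n))"
  by (induction I rule: infinite_finite_induct) (simp_all add: trace_add, simp_all add: trace_def)

lemma mtrace_add: "mtrace k (A + B) = mtrace k A + mtrace k B"
  by (simp add: mtrace_def trace_add)

lemma mtrace_commute: "mtrace k (A * B) = mtrace k (B * A)"
proof -
  have "mtrace k (A * B) = (\<Sum>i=0..k. trace (mcoeff A i ** mcoeff B (k - i)))"
    by (simp add: mtrace_def mcoeff_mult trace_sum)
  also have "\<dots> = (\<Sum>i=0..k. trace (mcoeff B (k - i) ** mcoeff A (k - (k - i))))"
    by (intro sum.cong refl, subst trace_mul_sym) simp
  also have "\<dots> = (\<Sum>i=0..k. trace (mcoeff B i ** mcoeff A (k - i)))"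
    by (subst sum.atLeastAtMost_rev[of _ 0 k]) simp
  finally show ?thesis by (simp add: mtrace_def mcoeff_mult trace_sum)
qed

definition series_vd :: "(real \<Rightarrow> ('n::finite) sqm fps) \<Rightarrow> 'n sqm fps \<Rightarrow> real \<Rightarrow> bool" where
  "series_vd A A' x \<longleftrightarrow> (\<forall>k. ((\<lambda>y. mcoeff (A y) k) has_vector_derivative mcoeff A' k) (at x))"

lemma series_vd_mult:
  assumes "series_vd A A' x" "series_vd B B' x"
  shows "series_vd (\<lambda>y. A y * B y) (A' * B x + A x * B') x"
  unfolding series_vd_def
proof
  fix k
  have "((\<lambda>y. \<Sum>i=0..k. mcoeff (A y) i ** mcoeff (B y) (k - i)) has_vector_derivative
     (\<Sum>i=0..k. mcoeff (A x) i ** mcoeff B' (k - i) + mcoeff A' i ** mcoeff (B x) (k - i))) (at x)"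
    using assms unfolding series_vd_def
    by (intro has_vector_derivative_sum bounded_bilinear.has_vector_derivative[OF bounded_bilinear_matrix_matrix]) auto
  then show "((\<lambda>y. mcoeff (A y * B y) k) has_vector_derivative mcoeff (A' * B x + A x * B') k) (at x)"
    by (simp add: mcoeff_mult sum.distrib add.commute)
qed

lemma series_vd_diff:
  assumes "series_vd A A' x" "series_vd B B' x"
  shows "series_vd (\<lambda>y. A y - B y) (A' - B') x"
  using assms by (simp add: series_vd_def has_vector_derivative_diff)

lemma series_vd_unique: "series_vd A A' x \<Longrightarrow> series_vd A B' x \<Longrightarrow> A' = B'"
  unfolding series_vd_def by (rule mfps_eqI) (metis vector_derivative_unique_at)

lemma series_vd_const: "series_vd (\<lambda>y. A) 0 x"
  by (simp add: series_vd_def)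

lemma mcoeff_mult_admissible:
  assumes "\<And>k. bounded_smooth (\<lambda>x. mcoeff (A x) k)" "\<And>k. admissible (\<lambda>x. mcoeff (B x) k)"
  shows "admissible (\<lambda>x. mcoeff (A x * B x) k)" "admissible (\<lambda>x. mcoeff (B x * A x) k)"
  unfolding mcoeff_mult
  by (intro admissible_sum admissible_bilinear_left[OF bounded_bilinear_matrix_matrix]
      admissible_bilinear_right[OF bounded_bilinear_matrix_matrix] assms)+

text \<open>The coefficient of \<open>\<lambda>\<^sup>2\<^sup>n\<^sup>-\<^sup>1\<close> in \<open>- tr (W \<partial>\<^sub>\<lambda> U)\<close>.\<close>

definition lax_density :: "(real \<Rightarrow> 'n::finite bmat) \<Rightarrow> nat \<Rightarrow> real \<Rightarrow> complex" where
  "lax_density Q n x = 2 * \<i> * trace (sigma3 ** lax_coeff Q (2 * n + 2) x) + trace (Q x ** lax_coeff Q (2 * n + 1) x)"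

text \<open>The \<open>x\<close>-derivative of one coefficient of \<open>tr (W [D, T])\<close>
  integrates to 0. That derivative is a combination of the variation of the density and of the
  gradient density, with a ratio fixed by the power of \<open>lambda\<close>.\<close>

lemma trace_identity:
  fixes Q \<eta> :: "real \<Rightarrow> 'n::finite bmat"
  assumes Q: "admissible Q" "\<And>x. blk_a (Q x) = 0" "\<And>x. blk_d (Q x) = 0"
    and \<eta>: "admissible \<eta>" "\<And>x. blk_a (\<eta> x) = 0" "\<And>x. blk_d (\<eta> x) = 0"
  shows "((\<lambda>e. integral\<^sup>L lborel (lax_density (\<lambda>x. Q x + e *\<^sub>R \<eta> x) n)) has_vector_derivative
    - (2 * of_nat n) * integral\<^sup>L lborel (\<lambda>x. trace (\<eta> x ** lax_coeff Q (2 * n + 1) x))) (at 0)"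
proof -
  define Qe where "Qe e x = Q x + e *\<^sub>R \<eta> x" for e :: real and x
  have pQ: "poly_curve Qe"
    unfolding Qe_def[abs_def] by (rule poly_curve.step[OF Q(1) poly_curve.const[OF \<eta>(1)]])
  have Qe: "admissible (Qe e)" "blk_a (Qe e x) = 0" "blk_d (Qe e x) = 0" for e x
    using poly_curve_admissible[OF pQ] Q \<eta> by (simp_all add: Qe_def)
  have Qe0: "Qe 0 = Q" by (simp add: Qe_def fun_eq_iff)
  have pW: "poly_curve (\<lambda>e. lax_coeff (Qe e) k)" if "k \<ge> 1" for k
    by (rule poly_curve_lax_coeff[OF pQ that])
  \<comment> \<open>The coefficient of order 0 is a nonzero constant, so it is not a curve of
    admissible functions; its variation is 0.\<close>
  have "\<exists>d. admissible d \<and> (\<forall>x. ((\<lambda>e. lax_coeff (Qe e) k x) has_vector_derivative d x) (at 0))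
    \<and> (\<forall>x. ((\<lambda>e. Dx (lax_coeff (Qe e) k) x) has_vector_derivative Dx d x) (at 0))" for k
  proof (cases "k = 0")
    case True
    have "Dx (\<lambda>x. 0::'n bmat) = (\<lambda>x. 0)" by (simp add: Dx_def)
    then show ?thesis using True by (intro exI[of _ "\<lambda>x. 0"]) (simp add: admissible_zero)
  next
    case False
    then show ?thesis using poly_curve_variation[OF pW[of k]] by (metis One_nat_def Suc_leI neq0_conv)
  qed
  then obtain \<delta> where \<delta>: "\<And>k. admissible (\<delta> k)"
    "\<And>k x. ((\<lambda>e. lax_coeff (Qe e) k x) has_vector_derivative \<delta> k x) (at 0)"
    "\<And>k x. ((\<lambda>e. Dx (lax_coeff (Qe e) k) x) has_vector_derivative Dx (\<delta> k) x) (at 0)" by metis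
  have \<delta>0: "\<delta> 0 x = 0" for x
    using vector_derivative_unique_at[OF \<delta>(2)[of 0 x], of 0] by simp
  define W where "W = lax_series Q"
  define W' where "W' = lax_series_x Q"
  define U where "U x = U_series (Q x)" for x
  define dU where "dU x = fps_X * mconst (\<eta> x)" for x
  \<comment> \<open>This is \<open>lambda^3\<close> times the \<open>lambda\<close>-derivative of
    \<open>i lambda^-2 sigma3 + lambda^-1 Q\<close>.\<close>
  define V where "V x = - mconst ((2 * \<i>) *\<^sub>M sigma3) - fps_X * mconst (Q x)" for x
  define D where "D x = mfps (\<lambda>k. \<delta> k x)" for x
  define D' where "D' x = mfps (\<lambda>k. Dx (\<delta> k) x)" for x
  \<comment> \<open>The Euler operator \<open>lambda d/dlambda\<close> multiplies the
    \<open>k\<close>-th coefficient by \<open>k\<close> and keeps all powers in place.\<close>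
  define T where "T x = mfps (\<lambda>k. real k *\<^sub>R lax_coeff Q k x)" for x
  define T' where "T' x = mfps (\<lambda>k. real k *\<^sub>R Dx (lax_coeff Q k) x)" for x
  define X where "X = (fps_X * fps_X :: ('n option) sqm fps)"
  have Xc: "A * X = X * A" for A unfolding X_def by (metis fps_mult_fps_X_commute mult.assoc)
  have WW: "W x * W x = - 1" for x unfolding W_def by (rule lax_series_square[OF Q])
  have W: "X * W' x = U x * W x - W x * U x" for x
    unfolding W_def W'_def U_def X_def by (rule lax_series_stationary[OF Q])
  \<comment> \<open>The constraint \<open>W * W = -1\<close> holds for every \<open>e\<close>;
    differentiation at 0 gives anticommutation.\<close>
  have WD: "W x * D x = - (D x * W x)" for x
  proof -
    have "series_vd (\<lambda>e. lax_series (Qe e) x) (D x) 0"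
      using \<delta>(2) by (simp add: series_vd_def lax_series_def D_def)
    from series_vd_mult[OF this this] have "series_vd (\<lambda>e. - 1) (D x * W x + W x * D x) 0"
      by (simp add: lax_series_square[OF Qe] Qe0 W_def)
    then have "D x * W x + W x * D x = 0"
      using series_vd_unique series_vd_const by blast
    then show ?thesis by (simp add: eq_neg_iff_add_eq_0 add.commute)
  qed
  have WT: "W x * T x = - (T x * W x)" for x
  proof -
    have "W x * T x + T x * W x = 0"
    proof (rule mfps_eqI)
      fix k
      have "mcoeff (W x * T x + T x * W x) k
          = (\<Sum>i=0..k. real (k - i) *\<^sub>R (lax_coeff Q i x ** lax_coeff Q (k - i) x)
              + real i *\<^sub>R (lax_coeff Q i x ** lax_coeff Q (k - i) x))"
        by (simp add: mcoeff_mult W_def lax_series_def T_def sum.distrib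
            matrix_scaleR)
      also have "\<dots> = (\<Sum>i=0..k. real k *\<^sub>R (lax_coeff Q i x ** lax_coeff Q (k - i) x))"
        by (intro sum.cong) (auto simp: of_nat_diff simp flip: scaleR_add_left)
      also have "\<dots> = real k *\<^sub>R mcoeff (W x * W x) k"
        by (simp add: mcoeff_mult W_def lax_series_def scaleR_sum_right)
      \<comment> \<open>For \<open>k > 0\<close> the coefficient of -1 vanishes, for
        \<open>k = 0\<close> the factor \<open>k\<close> does.\<close>
      also have "\<dots> = 0" unfolding WW by simp
      finally show "mcoeff (W x * T x + T x * W x) k = mcoeff 0 k" by simp
    qed
    then show ?thesis by (simp add: eq_neg_iff_add_eq_0)
  qed
  have coef: "mcoeff (X * mfps f) k = (if k \<ge> 2 then f (k - 2) else 0)" for f k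
    by (simp add: X_def mult.assoc numeral_2_eq_2)
  have com: "mcoeff ((mconst A + fps_X * mconst B) * mfps f - mfps f * (mconst A + fps_X * mconst B)) k
      = comm A (f k) + (if k \<ge> 1 then comm B (f (k - 1)) else 0)" for A B f k
    by (simp add: comm_def distrib_left distrib_right mult.assoc fps_X_left[of "mfps _"])
  have comX: "mcoeff (fps_X * mconst B * mfps f - mfps f * (fps_X * mconst B)) k
      = (if k \<ge> 1 then comm B (f (k - 1)) else 0)" for B f k
    by (simp add: comm_def mult.assoc fps_X_left[of "mfps _"])
  interpret c: bounded_bilinear "comm :: 'n bmat \<Rightarrow> _" by (rule bounded_bilinear_comm)
  \<comment> \<open>The stationary equation holds along the whole curve \<open>Qe\<close>,
    coefficient by coefficient; this is its derivative at \<open>e = 0\<close>.\<close>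
  have D: "X * D' x = (dU x * W x - W x * dU x) + (U x * D x - D x * U x)" for x
  proof (rule mfps_eqI)
    fix k
    have "((\<lambda>e. if k \<ge> 2 then Dx (lax_coeff (Qe e) (k - 2)) x else 0) has_vector_derivative
        (if k \<ge> 2 then Dx (\<delta> (k - 2)) x else 0)) (at 0)"
      using \<delta>(3) by simp
    moreover have "((\<lambda>e. Qe e x) has_vector_derivative \<eta> x) (at 0)"
      unfolding Qe_def by (rule horner_vd[OF has_vector_derivative_const])
    then have "((\<lambda>e. comm (\<i> *\<^sub>M sigma3) (lax_coeff (Qe e) k x)
          + (if k \<ge> 1 then comm (Qe e x) (lax_coeff (Qe e) (k - 1) x) else 0)) has_vector_derivative
        (comm (\<i> *\<^sub>M sigma3) (\<delta> k x) + (if k \<ge> 1 then comm (Q x) (\<delta> (k - 1) x) + comm (\<eta> x) (lax_coeff Q (k - 1) x) else 0))) (at 0)"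
      using c.has_vector_derivative[OF _ \<delta>(2), of "\<lambda>e. Qe e x" "\<eta> x" "k - 1" x]
      by (intro has_vector_derivative_add bounded_linear.has_vector_derivative[OF c.bounded_linear_right] \<delta>(2))
         (simp add: Qe0)
    ultimately have "(if k \<ge> 2 then Dx (\<delta> (k - 2)) x else 0) = comm (\<i> *\<^sub>M sigma3) (\<delta> k x)
      + (if k \<ge> 1 then comm (Q x) (\<delta> (k - 1) x) + comm (\<eta> x) (lax_coeff Q (k - 1) x) else 0)"
      unfolding lax_coeff_stationary[OF Qe] by (rule vector_derivative_unique_at)
    then show "mcoeff (X * D' x) k = mcoeff ((dU x * W x - W x * dU x) + (U x * D x - D x * U x)) k"
      unfolding mcoeff_simps(3) D'_def D_def W_def lax_series_def U_def U_series_def dU_def coef com comX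
      by (simp add: algebra_simps)
  qed
  \<comment> \<open>The Euler operator applied to \<open>lambda^2 W' = [lambda^2 U, W]\<close>. The
    factor \<open>lambda^2\<close> on the left yields an extra \<open>2 lambda^2 W'\<close>; moved
    to the right as -2 times the commutator, it turns the Euler derivative of
    \<open>lambda^2 U\<close> into \<open>V\<close>.\<close>
  have T: "X * T' x = (V x * W x - W x * V x) + (U x * T x - T x * U x)" for x
  proof (rule mfps_eqI)
    fix k
    have V: "V x = mconst ((- 2 * \<i>) *\<^sub>M sigma3) + fps_X * mconst (- Q x)"
      by (rule mfps_eqI) (simp add: V_def)
    have st: "(if k \<ge> 2 then Dx (lax_coeff Q (k - 2)) x else 0)
      = comm (\<i> *\<^sub>M sigma3) (lax_coeff Q k x) + (if k \<ge> 1 then comm (Q x) (lax_coeff Q (k - 1) x) else 0)"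
      by (rule lax_coeff_stationary[OF Q])
    have c1: "comm ((- 2 * \<i>) *\<^sub>M sigma3) M = (-2) *\<^sub>R comm (\<i> *\<^sub>M sigma3) M" for M :: "'n bmat"
    proof -
      have "((- 2 * \<i>) *\<^sub>M sigma3 :: 'n bmat) = (-2) *\<^sub>R (\<i> *\<^sub>M sigma3)"
        by (simp add: vec_eq_iff mscale_def scaleR_conv_of_real)
      then show ?thesis by (simp only: c.scaleR_left)
    qed
    have "(if k \<ge> 2 then real (k - 2) *\<^sub>R Dx (lax_coeff Q (k - 2)) x else 0)
         = (-2) *\<^sub>R comm (\<i> *\<^sub>M sigma3) (lax_coeff Q k x) + (if k \<ge> 1 then comm (- Q x) (lax_coeff Q (k - 1) x) else 0)
         + (comm (\<i> *\<^sub>M sigma3) (real k *\<^sub>R lax_coeff Q k x)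
           + (if k \<ge> 1 then comm (Q x) (real (k - 1) *\<^sub>R lax_coeff Q (k - 1) x) else 0))"
    proof -
      consider "k = 0" | "k = 1" | j where "k = Suc (Suc j)" by (metis One_nat_def not0_implies_Suc)
      then show ?thesis
      proof cases
        case (3 j)
        have k2: "real (Suc (Suc j)) = real j + 2" and k1: "real (Suc j) = real j + 1" by simp_all
        have "Dx (lax_coeff Q j) x = comm (\<i> *\<^sub>M sigma3) (lax_coeff Q (Suc (Suc j)) x) + comm (Q x) (lax_coeff Q (Suc j) x)"
          using st by (simp add: 3)
        then show ?thesis
          by (simp add: 3 c.scaleR_right c.add_right c.minus_left k2 k1 scaleR_add_left scaleR_add_right
              del: of_nat_Suc)
      qed (simp_all add: comm_def scaleR_2 algebra_simps)
    qed
    then show "mcoeff (X * T' x) k = mcoeff ((V x * W x - W x * V x) + (U x * T x - T x * U x)) k"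
      unfolding mcoeff_simps(3) T'_def T_def W_def lax_series_def U_def U_series_def V coef com c1 .
  qed
  define F where "F x = mtrace (2 * n) (W x * (D x * T x - T x * D x))" for x
  define F' where "F' x = mtrace (2 * n) (W' x * (D x * T x - T x * D x)
      + W x * (D' x * T x + D x * T' x - T' x * D x - T x * D' x))" for x
  define G where "G x = trace (\<eta> x ** lax_coeff Q (2 * n + 1) x)" for x
  \<comment> \<open>The full variation of the density; \<open>G\<close> is the part coming from its
    explicit factor \<open>Q\<close>.\<close>
  define K where "K x = 2 * \<i> * trace (sigma3 ** \<delta> (2 * n + 2) x)
     + (trace (\<eta> x ** lax_coeff Q (2 * n + 1) x) + trace (Q x ** \<delta> (2 * n + 1) x))" for x
  \<comment> \<open>The trace of \<open>dU * T\<close> gives \<open>(2 n + 1) * G\<close>, that of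
    \<open>- V * D\<close> gives \<open>K - G\<close>; the difference of the two multiples of
    \<open>G\<close> is the \<open>2 n\<close> in the Hamiltonian.\<close>
  have F'_eq: "F' x = 4 * K x + 8 * of_nat n * G x" for x
  proof -
    have "F' x = mtrace (2 * n + 2) (X * (W' x * (D x * T x - T x * D x)
      + W x * (D' x * T x + D x * T' x - T' x * D x - T x * D' x)))"
      by (simp add: F'_def mtrace_def X_def mult.assoc)
    also have "\<dots> = 4 * mtrace (2 * n + 2) (dU x * T x) - 4 * mtrace (2 * n + 2) (V x * D x)"
      by (rule trace_identity_algebra[OF Xc mtrace_add mtrace_commute W D T WW WD WT])
    also have "mtrace (2 * n + 2) (dU x * T x) = (2 * of_nat n + 1) * G x"
    proof -
      have "mcoeff (dU x * T x) (2 * n + 2) = \<eta> x ** mcoeff (T x) (2 * n + 1)"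
        by (simp add: dU_def mult.assoc)
      also have "\<dots> = real (2 * n + 1) *\<^sub>R (\<eta> x ** lax_coeff Q (2 * n + 1) x)"
        unfolding T_def mcoeff_simps(1) matrix_scaleR(2) ..
      finally have "mtrace (2 * n + 2) (dU x * T x) = real (2 * n + 1) *\<^sub>R G x"
        unfolding mtrace_def G_def
        by (simp only: trace_scaleR)
      then show ?thesis by (simp add: scaleR_conv_of_real algebra_simps)
    qed
    also have "mtrace (2 * n + 2) (V x * D x) = - (2 * \<i> * trace (sigma3 ** \<delta> (2 * n + 2) x)) - trace (Q x ** \<delta> (2 * n + 1) x)"
      by (simp add: mtrace_def V_def D_def mult.assoc left_diff_distrib trace_sub trace_mscale trace_uminus)
    finally show ?thesis by (simp add: K_def G_def algebra_simps)
  qed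
  have vdW: "series_vd W (W' x) x" for x
    using lax_coeff_vd[OF Q(1)] by (simp add: series_vd_def W_def W'_def lax_series_def lax_series_x_def)
  have vdD: "series_vd D (D' x) x" for x
    using admissible_vd[OF \<delta>(1)] by (simp add: series_vd_def D_def D'_def)
  have vdT: "series_vd T (T' x) x" for x
    using bounded_linear.has_vector_derivative[OF bounded_linear_scaleR_right lax_coeff_vd[OF Q(1)]]
    by (simp add: series_vd_def T_def T'_def)
  have F_vd: "(F has_vector_derivative F' x) (at x)" for x
  proof -
    have "series_vd (\<lambda>x. W x * (D x * T x - T x * D x))
      (W' x * (D x * T x - T x * D x) + W x * ((D' x * T x + D x * T' x) - (T' x * D x + T x * D' x))) x"
      by (intro series_vd_mult series_vd_diff vdW vdD vdT)
    then have "(F has_vector_derivative mtrace (2 * n) (W' x * (D x * T x - T x * D x)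
        + W x * ((D' x * T x + D x * T' x) - (T' x * D x + T x * D' x)))) (at x)"
      unfolding F_def[abs_def] mtrace_def series_vd_def
      by (intro bounded_linear.has_vector_derivative[OF bounded_linear_trace]) blast
    then show ?thesis by (simp add: F'_def algebra_simps)
  qed
  \<comment> \<open>\<open>W\<close> and \<open>T\<close> are only bounded, but the variation
    \<open>D\<close> decays, and every term contains it.\<close>
  have F_adm: "admissible F"
  proof -
    have bW: "bounded_smooth (\<lambda>x. mcoeff (W x) k)" for k
      by (simp add: W_def lax_series_def lax_coeff_bounded_smooth[OF Q(1)])
    have bT: "bounded_smooth (\<lambda>x. mcoeff (T x) k)" for k
      unfolding T_def mcoeff_simps
      by (rule bounded_smooth_linear[OF bounded_linear_scaleR_right lax_coeff_bounded_smooth[OF Q(1)]])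
    have aD: "admissible (\<lambda>x. mcoeff (D x) k)" for k using \<delta>(1) by (simp add: D_def)
    have "admissible (\<lambda>x. mcoeff (D x * T x - T x * D x) k)" for k
      unfolding mcoeff_simps by (intro admissible_diff mcoeff_mult_admissible bT aD)
    from mcoeff_mult_admissible(1)[where A = W, OF bW this] show ?thesis
      unfolding F_def[abs_def] mtrace_def by (rule admissible_linear[OF bounded_linear_trace])
  qed
  have "integral\<^sup>L lborel F' = 0"
  proof -
    have "Dx F = F'" by (rule Dx_eqI[OF F_vd])
    then show ?thesis using integral_Dx_zero[OF F_adm] by simp
  qed
  moreover have lin: "bounded_linear (\<lambda>M::'n bmat. 2 * \<i> * trace (sigma3 ** M))"
    by (rule bounded_linearI_euclidean)
       (simp_all add: matrix_add_ldistrib trace_add matrix_scaleR(2)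
          trace_scaleR algebra_simps)
  have G_adm: "admissible G"
    unfolding G_def[abs_def] by (intro admissible_bilinear[OF bounded_bilinear_trace_mult] \<eta>(1) lax_coeff_admissible[OF Q(1)]) simp
  have K_adm: "admissible K"
    unfolding K_def[abs_def]
    by (intro admissible_add admissible_linear[OF lin] admissible_bilinear[OF bounded_bilinear_trace_mult] \<eta>(1) Q(1) \<delta>(1)
        lax_coeff_admissible[OF Q(1)]) simp
  have "integral\<^sup>L lborel F' = 4 * integral\<^sup>L lborel K + 8 * of_nat n * integral\<^sup>L lborel G"
    unfolding F'_eq using admissible_integrable[OF K_adm] admissible_integrable[OF G_adm] by simp
  ultimately have "4 * (integral\<^sup>L lborel K + 2 * of_nat n * integral\<^sup>L lborel G) = 0"
    by (simp add: algebra_simps)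
  then have "integral\<^sup>L lborel K + 2 * of_nat n * integral\<^sup>L lborel G = 0"
    by (metis mult_eq_0_iff zero_neq_numeral)
  then have KG: "integral\<^sup>L lborel K = - (2 * of_nat n) * integral\<^sup>L lborel G"
    by (simp add: eq_neg_iff_add_eq_0)
  have pK: "poly_curve (\<lambda>e. lax_density (Qe e) n)"
  proof -
    have "poly_curve (\<lambda>e x. 2 * \<i> * trace (sigma3 ** lax_coeff (Qe e) (2 * n + 2) x))"
      by (rule poly_curve_linear[OF pW lin]) simp
    moreover have "poly_curve (\<lambda>e x. trace (Qe e x ** lax_coeff (Qe e) (2 * n + 1) x))"
      by (rule poly_curve_bilinear[OF bounded_bilinear_trace_mult pQ pW]) simp
    ultimately show ?thesis unfolding lax_density_def[abs_def] by (rule poly_curve_add)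
  qed
  obtain d where "admissible d" and d: "\<And>x. ((\<lambda>e. lax_density (Qe e) n x) has_vector_derivative d x) (at 0)"
    and "\<And>x. ((\<lambda>e. Dx (lax_density (Qe e) n) x) has_vector_derivative Dx d x) (at 0)"
    and Id: "((\<lambda>e. integral\<^sup>L lborel (lax_density (Qe e) n)) has_vector_derivative integral\<^sup>L lborel d) (at 0)"
    by (rule poly_curve_variation[OF pK], rule that)
  have "d = K"
  proof
    fix x
    have "((\<lambda>e. Qe e x) has_vector_derivative \<eta> x) (at 0)"
      unfolding Qe_def by (rule horner_vd[OF has_vector_derivative_const])
    from bounded_bilinear.has_vector_derivative[OF bounded_bilinear_trace_mult this \<delta>(2), of "2 * n + 1" x]
    have "((\<lambda>e. trace (Qe e x ** lax_coeff (Qe e) (2 * n + 1) x)) has_vector_derivative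
       trace (Q x ** \<delta> (2 * n + 1) x) + trace (\<eta> x ** lax_coeff Q (2 * n + 1) x)) (at 0)"
      by (simp add: Qe0)
    from has_vector_derivative_add[OF bounded_linear.has_vector_derivative[OF lin \<delta>(2), of "2 * n + 2" x] this]
    have "((\<lambda>e. lax_density (Qe e) n x) has_vector_derivative K x) (at 0)"
      unfolding lax_density_def by (simp add: K_def add.commute)
    then show "d x = K x" by (rule vector_derivative_unique_at[OF d])
  qed
  then show ?thesis using Id KG unfolding G_def Qe_def by simp
qed

section \<open>Variational derivatives\<close>

lemma admissible_Pair:
  assumes "admissible f" "admissible g"
  shows "admissible (\<lambda>x. (f x, g x))"
proof -
  have "bounded_linear (\<lambda>u::'a. (u, 0::'b))" "bounded_linear (\<lambda>v::'b. (0::'a, v))"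
    by (rule bounded_linearI_euclidean; simp)+
  from admissible_add[OF admissible_linear[OF this(1) assms(1)] admissible_linear[OF this(2) assms(2)]] show ?thesis by simp
qed

lemmas admissible_fst = admissible_linear[OF bounded_linear_fst]
  and admissible_snd = admissible_linear[OF bounded_linear_snd]

text \<open>The primitive lies between 0 and the total integral, so it is identically 0, and so is
  its derivative.\<close>

lemma nonneg_integral_zero:
  fixes h :: "real \<Rightarrow> real"
  assumes h: "integrable lborel h" "continuous_on UNIV h" "\<And>x. 0 \<le> h x" and "integral\<^sup>L lborel h = 0"
  shows "h x = 0"
proof -
  have "primitive h y = 0" for y
    using primitive_nonneg_le[OF h(1,3), of y] assms(4) by simp
  then have "primitive h = (\<lambda>y. 0)" by (simp add: fun_eq_iff)
  then have "((\<lambda>y. 0) has_vector_derivative h x) (at x)"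
    using primitive_has_vector_derivative[OF h(1,2), of x] by simp
  then show ?thesis by (rule vector_derivative_unique_at[OF _ has_vector_derivative_const])
qed

definition vcnj :: "complex^'n \<Rightarrow> complex^'n" where
  "vcnj u = (\<chi> i. cnj (u $ i))"

lemma bounded_linear_vcnj: "bounded_linear vcnj"
  by (rule bounded_linearI_euclidean) (simp_all add: vcnj_def vec_eq_iff)

lemma scalar_product_vcnj: "scalar_product (vcnj u) u = of_real (u \<bullet> u)"
proof -
  have "cnj z * z = of_real (z \<bullet> z)" for z
    by (simp only: dot_square_norm complex_norm_square mult.commute)
  then show ?thesis by (simp add: scalar_product_def vcnj_def inner_vec_def)
qed

lemma pairing_integrable:
  fixes f g :: "'n::finite field2"
  assumes "admissible f" "admissible g"
  shows "admissible (\<lambda>x. scalar_product (fst (f x)) (fst (g x)) + scalar_product (snd (f x)) (snd (g x)))"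
  by (rule admissible_add[OF
        admissible_bilinear[OF bounded_bilinear_scalar_product admissible_fst[OF assms(1)] admissible_fst[OF assms(2)]]
        admissible_bilinear[OF bounded_bilinear_scalar_product admissible_snd[OF assms(1)] admissible_snd[OF assms(2)]]])

text \<open>The pairing is bilinear, so the test field is the complex conjugate of
  \<open>g - h\<close>; it turns the difference of the pairings into the integral of a squared
  norm.\<close>

lemma pairing_nondegenerate:
  fixes g h :: "'n::finite field2"
  assumes g: "admissible g" and h: "admissible h"
    and eq: "\<And>\<eta>. admissible \<eta> \<Longrightarrow> pairing \<eta> g = pairing \<eta> h"
  shows "g = h"
proof
  fix x
  define k where "k x = g x - h x" for x
  define \<eta> where "\<eta> x = (vcnj (fst (k x)), vcnj (snd (k x)))" for x
  have k: "admissible k" unfolding k_def[abs_def] by (rule admissible_diff[OF g h])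
  have \<eta>: "admissible \<eta>"
    unfolding \<eta>_def[abs_def]
    by (rule admissible_Pair[OF admissible_linear[OF bounded_linear_vcnj admissible_fst[OF k]]
          admissible_linear[OF bounded_linear_vcnj admissible_snd[OF k]]])
  have kk: "admissible (\<lambda>x. k x \<bullet> k x)" by (rule admissible_bilinear[OF bounded_bilinear_inner k k])
  have "0 = pairing \<eta> g - pairing \<eta> h" unfolding eq[OF \<eta>] by simp
  also have "\<dots> = integral\<^sup>L lborel (\<lambda>x.
      (scalar_product (fst (\<eta> x)) (fst (g x)) + scalar_product (snd (\<eta> x)) (snd (g x)))
      - (scalar_product (fst (\<eta> x)) (fst (h x)) + scalar_product (snd (\<eta> x)) (snd (h x))))"
    unfolding pairing_def
    by (rule Bochner_Integration.integral_diff[OF admissible_integrable[OF pairing_integrable[OF \<eta> g]]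
          admissible_integrable[OF pairing_integrable[OF \<eta> h]], symmetric])
  also have "\<dots> = integral\<^sup>L lborel (\<lambda>x. of_real (k x \<bullet> k x) :: complex)"
  proof (rule Bochner_Integration.integral_cong[OF refl])
    fix x
    have "fst (g x) = fst (k x) + fst (h x)" "snd (g x) = snd (k x) + snd (h x)" by (simp_all add: k_def)
    then show "(scalar_product (fst (\<eta> x)) (fst (g x)) + scalar_product (snd (\<eta> x)) (snd (g x)))
      - (scalar_product (fst (\<eta> x)) (fst (h x)) + scalar_product (snd (\<eta> x)) (snd (h x))) = of_real (k x \<bullet> k x)"
      by (simp add: \<eta>_def scalar_product_simps scalar_product_vcnj inner_prod_def)
  qed
  also have "\<dots> = of_real (integral\<^sup>L lborel (\<lambda>x. k x \<bullet> k x))" by simp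
  finally have "integral\<^sup>L lborel (\<lambda>x. k x \<bullet> k x) = 0" by simp
  then have "k x \<bullet> k x = 0"
    by (rule nonneg_integral_zero[OF admissible_integrable[OF kk] admissible_continuous[OF kk] inner_ge_zero])
  then show "g x = h x" by (simp add: k_def)
qed

lemma variational_derivative_eqI:
  assumes "has_variational_derivative H w g"
  shows "variational_derivative H w = g"
  unfolding variational_derivative_def
proof (rule the_equality)
  fix g' assume g': "has_variational_derivative H w g'"
  show "g' = g"
  proof (rule pairing_nondegenerate)
    fix \<eta> :: "'a field2" assume \<eta>: "admissible \<eta>"
    have "((\<lambda>e::real. H (\<lambda>x. w x + e *\<^sub>R \<eta> x)) has_vector_derivative pairing \<eta> g') (at 0)"
      using g' \<eta> by (simp add: has_variational_derivative_def)
    moreover have "((\<lambda>e::real. H (\<lambda>x. w x + e *\<^sub>R \<eta> x)) has_vector_derivative pairing \<eta> g) (at 0)"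
      using assms \<eta> by (simp add: has_variational_derivative_def)
    ultimately show "pairing \<eta> g' = pairing \<eta> g" by (rule vector_derivative_unique_at)
  qed (use assms g' in \<open>simp_all add: has_variational_derivative_def\<close>)
qed (rule assms)

lemma trace_blk: "trace M = blk_a M + trace (blk_d M)"
  by (simp add: trace_def sum_option blk_a_def blk_d_def)

lemma trace_outer: "trace (outer u v) = scalar_product u v"
  by (simp add: trace_def outer_def scalar_product_def)

text \<open>\<open>a - trace d\<close> is the trace of \<open>sigma3 ** W\<close>, and the remaining
  terms form the trace of \<open>Q ** W\<close>.\<close>

lemma KN_H_eq_lax_density:
  fixes w :: "'n::finite field2"
  assumes w: "admissible w" and n: "n \<noteq> 0"
  shows "KN_H \<alpha> n w = - (\<alpha> / (2 * of_nat n)) * integral\<^sup>L lborel (lax_density (\<lambda>x. Qmat (fst (w x)) (snd (w x))) n)"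
proof -
  note K = KN_eq[OF admissible_fst[OF w] admissible_snd[OF w], of \<alpha>]
  have idx: "2 * (n + 1) = 2 * n + 2" by simp
  have "KN_H \<alpha> n w = - (1 / (2 * of_nat n)) * integral\<^sup>L lborel
      (\<lambda>x. \<alpha> * lax_density (\<lambda>x. Qmat (fst (w x)) (snd (w x))) n x)"
    unfolding KN_H_def Let_def K idx lax_density_def
    using n by (simp add: trace_blk trace_add trace_mscale trace_uminus trace_outer scalar_product_simps
        scalar_product_commute algebra_simps)
  then show ?thesis by simp
qed

text \<open>In \<open>trace (E ** W)\<close> the variation of \<open>q\<close> meets the block
  \<open>c\<close> and that of \<open>r\<close> the block \<open>b\<close>; hence the gradient is
  \<open>(c, b)\<close> in this order. For \<open>n = 0\<close> the trace identity cannot be divided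
  by \<open>2 n\<close>, and the quadratic functional is varied directly.\<close>

lemma KN_H_variation:
  fixes q r :: "real \<Rightarrow> complex^'n"
  assumes q: "admissible q" and r: "admissible r"
  shows "has_variational_derivative (KN_H \<alpha> n) (\<lambda>x. (q x, r x))
    (\<lambda>x. (KN_c \<alpha> q r n x, KN_b \<alpha> q r n x))"
  unfolding has_variational_derivative_def
proof (intro conjI allI impI)
  show "admissible (\<lambda>x. (KN_c \<alpha> q r n x, KN_b \<alpha> q r n x))"
    by (rule admissible_Pair[OF KN_admissible(4)[OF q r] KN_admissible(3)[OF q r]])
  fix \<eta> :: "'n field2" assume \<eta>: "admissible \<eta>"
  define u where "u x = fst (\<eta> x)" for x
  define v where "v x = snd (\<eta> x)" for x
  have uv: "admissible u" "admissible v"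
    unfolding u_def[abs_def] v_def[abs_def] by (rule admissible_fst[OF \<eta>], rule admissible_snd[OF \<eta>])
  have \<eta>_eq: "\<eta> x = (u x, v x)" for x by (simp add: u_def v_def)
  show "((\<lambda>e::real. KN_H \<alpha> n (\<lambda>x. (q x, r x) + e *\<^sub>R \<eta> x)) has_vector_derivative
      pairing \<eta> (\<lambda>x. (KN_c \<alpha> q r n x, KN_b \<alpha> q r n x))) (at 0)"
  proof (cases "n = 0")
    case True
    have p: "poly_curve (\<lambda>e x. scalar_product (q x + e *\<^sub>R u x) (r x + e *\<^sub>R v x))"
      by (rule poly_curve_bilinear[OF bounded_bilinear_scalar_product
            poly_curve.step[OF q poly_curve.const[OF uv(1)]] poly_curve.step[OF r poly_curve.const[OF uv(2)]]])
    obtain d where "admissible d"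
      and d: "\<And>x. ((\<lambda>e. scalar_product (q x + e *\<^sub>R u x) (r x + e *\<^sub>R v x)) has_vector_derivative d x) (at 0)"
      and "\<And>x. ((\<lambda>e. Dx (\<lambda>x. scalar_product (q x + e *\<^sub>R u x) (r x + e *\<^sub>R v x)) x) has_vector_derivative Dx d x) (at 0)"
      and Id: "((\<lambda>e. integral\<^sup>L lborel (\<lambda>x. scalar_product (q x + e *\<^sub>R u x) (r x + e *\<^sub>R v x))) has_vector_derivative integral\<^sup>L lborel d) (at 0)"
      by (rule poly_curve_variation[OF p], rule that)
    have "d x = scalar_product (q x) (v x) + scalar_product (u x) (r x)" for x
      using bounded_bilinear.has_vector_derivative[OF bounded_bilinear_scalar_product
          horner_vd[OF has_vector_derivative_const[of "u x"], of "q x"]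
          horner_vd[OF has_vector_derivative_const[of "v x"], of "r x"]]
      by (intro vector_derivative_unique_at[OF d]) simp
    then have "d = (\<lambda>x. scalar_product (u x) (r x) + scalar_product (v x) (q x))"
      by (simp add: fun_eq_iff scalar_product_commute)
    with bounded_linear.has_vector_derivative[OF bounded_linear_mult_right[of \<alpha>] Id]
    show ?thesis
      using True by (simp add: KN_H_def pairing_def \<eta>_eq scalar_product_simps flip: distrib_left)
  next
    case False
    define Q where "Q x = Qmat (q x) (r x)" for x
    define E where "E x = Qmat (u x) (v x)" for x
    have QE: "admissible Q" "admissible E"
      unfolding Q_def[abs_def] E_def[abs_def] by (rule admissible_Qmat[OF q r], rule admissible_Qmat[OF uv])
    have adm: "admissible (\<lambda>x. (q x, r x) + e *\<^sub>R \<eta> x)" for e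
      by (rule admissible_add[OF admissible_Pair[OF q r] admissible_linear[OF bounded_linear_scaleR_right \<eta>]])
    have "Qmat (fst ((q x, r x) + e *\<^sub>R \<eta> x)) (snd ((q x, r x) + e *\<^sub>R \<eta> x)) = Q x + e *\<^sub>R E x" for x e
      by (rule blk_eqI) (simp_all add: Q_def E_def \<eta>_eq)
    then have H: "KN_H \<alpha> n (\<lambda>x. (q x, r x) + e *\<^sub>R \<eta> x)
        = - (\<alpha> / (2 * of_nat n)) * integral\<^sup>L lborel (lax_density (\<lambda>x. Q x + e *\<^sub>R E x) n)" for e
      using KN_H_eq_lax_density[OF adm False] by simp
    have "((\<lambda>e. KN_H \<alpha> n (\<lambda>x. (q x, r x) + e *\<^sub>R \<eta> x)) has_vector_derivative
      - (\<alpha> / (2 * of_nat n)) * (- (2 * of_nat n) * integral\<^sup>L lborel (\<lambda>x. trace (E x ** lax_coeff Q (2 * n + 1) x)))) (at 0)"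
      unfolding H
      by (rule bounded_linear.has_vector_derivative[OF bounded_linear_mult_right trace_identity[OF QE(1) _ _ QE(2)]])
         (simp_all add: Q_def E_def)
    moreover have "- (\<alpha> / (2 * of_nat n)) * (- (2 * of_nat n) * integral\<^sup>L lborel (\<lambda>x. trace (E x ** lax_coeff Q (2 * n + 1) x)))
        = pairing \<eta> (\<lambda>x. (KN_c \<alpha> q r n x, KN_b \<alpha> q r n x))"
    proof -
      have "trace (E x ** lax_coeff Q (2 * n + 1) x)
        = scalar_product (u x) (blk_c (lax_coeff Q (2 * n + 1) x)) + scalar_product (v x) (blk_b (lax_coeff Q (2 * n + 1) x))" for x
        by (simp add: trace_blk trace_add trace_outer E_def)
      then show ?thesis
        using False by (simp add: pairing_def KN_eq[OF q r] \<eta>_eq scalar_product_simps Q_def[abs_def] flip: distrib_left)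
    qed
    ultimately show ?thesis by simp
  qed
qed

section \<open>The zero-curvature equation\<close>

lemma Qmat_vd:
  assumes "(f has_vector_derivative f') (at x)" "(g has_vector_derivative g') (at x)"
  shows "((\<lambda>x. Qmat (f x) (g x)) has_vector_derivative Qmat f' (g' :: complex^'n)) (at x)"
proof -
  have "bounded_linear (\<lambda>p. Qmat (fst p) (snd p :: complex^'n))"
    by (rule bounded_linearI_euclidean; rule blk_eqI; simp)
  from bounded_linear.has_vector_derivative[OF this has_vector_derivative_Pair[OF assms]]
  show ?thesis by simp
qed

lemma sum_int_negative: "(\<Sum>k\<in>{- int P..<0}. f k) = (\<Sum>j<P. f (int j - int P))"
  by (rule sum.reindex_bij_witness[of _ "\<lambda>j. int j - int P" "\<lambda>k. nat (k + int P)"]) auto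

lemma Umat_eq: "Umat q r l = (l powi (-2)) *\<^sub>M (\<i> *\<^sub>M sigma3) + (l powi (-1)) *\<^sub>M Qmat q r"
  by (simp add: Umat_def mult.commute)

text \<open>Truncation spoils the stationary equation only in order -1. In order -2 the missing
  coefficient \<open>W P\<close> is block-diagonal and commutes with \<open>sigma3\<close>; order -1
  lacks exactly the commutators that would balance the derivative of the last kept coefficient,
  built from \<open>b\<close> and \<open>c\<close> of index \<open>n\<close>.\<close>

lemma zero_curvature_defect:
  fixes q r :: "real \<Rightarrow> complex^'n"
  assumes q: "admissible q" and r: "admissible r" and l: "l \<noteq> 0"
  shows "Dx (KN_V \<alpha> q r n l) x - comm (Umat (q x) (r x) l) (KN_V \<alpha> q r n l x)
    = (l powi (-1)) *\<^sub>M Qmat (Dx (KN_b \<alpha> q r n) x) (Dx (KN_c \<alpha> q r n) x)"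
proof -
  interpret c: bounded_bilinear "comm :: 'n bmat \<Rightarrow> _" by (rule bounded_bilinear_comm)
  define W where "W k = KN_W \<alpha> q r k" for k
  define S :: "'n bmat" where "S = \<i> *\<^sub>M sigma3"
  define A where "A k = comm S (W k x)" for k
  define B where "B k = comm (Qmat (q x) (r x)) (W k x)" for k
  define P where "P = 2 * (n + 1)"
  have P: "2 * (int n + 1) = int P" "- 2 * (int n + 1) = - int P" by (simp_all add: P_def)
  have st: "(W k has_vector_derivative A (k + 2) + B (k + 1)) (at x)" for k
    using KN_W_stationary[OF q r, of \<alpha>] by (simp add: stationary_zero_curvature_def W_def A_def B_def S_def)
  have V: "KN_V \<alpha> q r n l = (\<lambda>x. \<Sum>j<P. (l powi (int j - int P)) *\<^sub>M W (int j) x)"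
    unfolding KN_V_def P sum_int_negative by (simp add: W_def fun_eq_iff)
  have DV: "Dx (KN_V \<alpha> q r n l) x = (\<Sum>j<P. (l powi (int j - int P)) *\<^sub>M (A (int j + 2) + B (int j + 1)))"
    unfolding V Dx_def
    by (rule vector_derivative_at)
       (intro has_vector_derivative_sum bounded_linear.has_vector_derivative[OF bounded_linear_mscale] st)
  have cs: "comm (s *\<^sub>M M) M' = s *\<^sub>M comm M M'" for s and M M' :: "'n bmat"
    by (simp add: comm_def mscale_distrib)
  have powi: "l powi a * l powi b = l powi (a + b)" for a b
    using l by (simp add: power_int_add)
  have UV: "comm (Umat (q x) (r x) l) (KN_V \<alpha> q r n l x)
      = (\<Sum>j<P. (l powi (int j - int P - 2)) *\<^sub>M A (int j) + (l powi (int j - int P - 1)) *\<^sub>M B (int j))"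
    unfolding V Umat_eq S_def[symmetric] c.sum_right
  proof (rule sum.cong[OF refl])
    fix j
    have "l powi (int j - int P) * l powi (-2) = l powi (int j - int P - 2)"
      "l powi (int j - int P) * l powi (-1) = l powi (int j - int P - 1)"
      unfolding powi by simp_all
    then show "comm ((l powi -2) *\<^sub>M S + (l powi -1) *\<^sub>M Qmat (q x) (r x)) ((l powi (int j - int P)) *\<^sub>M W (int j) x)
      = (l powi (int j - int P - 2)) *\<^sub>M A (int j) + (l powi (int j - int P - 1)) *\<^sub>M B (int j)"
      unfolding c.add_left cs comm_mscale(1) mscale_distrib A_def B_def
      by (simp only: mscale_simps(4) mult.commute)
  qed
  define g where "g j = (l powi (int j - int P - 2)) *\<^sub>M A (int j)" for j
  define h where "h j = (l powi (int j - int P - 1)) *\<^sub>M B (int j)" for j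
  have "Dx (KN_V \<alpha> q r n l) x - comm (Umat (q x) (r x) l) (KN_V \<alpha> q r n l x)
      = (\<Sum>j<P. (g (Suc (Suc j)) + h (Suc j)) - (g j + h j))"
    unfolding DV UV sum_subtractf[symmetric]
  proof (rule sum.cong[OF refl])
    fix j
    have "int (Suc (Suc j)) - int P - 2 = int j - int P" "int (Suc j) - int P - 1 = int j - int P"
      "int (Suc (Suc j)) = int j + 2" "int (Suc j) = int j + 1" by simp_all
    then show "(l powi (int j - int P)) *\<^sub>M (A (int j + 2) + B (int j + 1))
      - ((l powi (int j - int P - 2)) *\<^sub>M A (int j) + (l powi (int j - int P - 1)) *\<^sub>M B (int j))
      = (g (Suc (Suc j)) + h (Suc j)) - (g j + h j)"
      unfolding g_def h_def mscale_distrib by (simp only:)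
  qed
  \<comment> \<open>Inserting \<open>g (Suc j)\<close> twice with opposite signs makes the sum
    telescope, although \<open>g\<close> is shifted by two and \<open>h\<close> by one.\<close>
  also have "\<dots> = (\<Sum>j<P. (g (Suc (Suc j)) + g (Suc j) + h (Suc j)) - (g (Suc j) + g j + h j))"
    by (rule sum.cong) simp_all
  also have "\<dots> = (g (Suc P) + g P + h P) - (g (Suc 0) + g 0 + h 0)"
    by (rule sum_lessThan_telescope)
  also have "g 0 = 0"
    by (simp add: g_def A_def S_def W_def KN_W_eq_lax_coeff[OF q r, of \<alpha> 0, simplified]) (simp add: comm_def mult.commute)
  also have "g P = 0"
  proof -
    have "A (int P) = 0"
      by (rule blk_eqI) (simp_all add: A_def S_def W_def comm_sigma3_parts KN_W_def Let_def P_def)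
    then show ?thesis by (simp add: g_def)
  qed
  \<comment> \<open>The stationary equation in order -1, where the coefficient of \<open>W\<close>
    and its derivative are zero.\<close>
  also have "g (Suc 0) + 0 + h 0 = 0"
  proof -
    have "W (-1) = (\<lambda>x. 0)" by (simp add: W_def KN_W_negative fun_eq_iff)
    then have "A 1 + B 0 = 0"
      using vector_derivative_unique_at[OF st[of "-1"], of 0] by simp
    moreover have e: "int (Suc 0) - int P - 2 = - int P - 1" "int 0 - int P - 1 = - int P - 1" by simp_all
    have "g (Suc 0) + 0 + h 0 = (l powi (- int P - 1)) *\<^sub>M (A 1 + B 0)"
      unfolding g_def h_def e mscale_distrib by simp
    ultimately show ?thesis by simp
  qed
  also have "g (Suc P) + 0 + h P - 0 = (l powi (-1)) *\<^sub>M (A (int P + 1) + B (int P))"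
    unfolding g_def h_def mscale_distrib by (simp add: add.commute)
  also have "A (int P + 1) + B (int P) = Qmat (Dx (KN_b \<alpha> q r n) x) (Dx (KN_c \<alpha> q r n) x)"
  proof -
    have W: "W (int P - 1) = (\<lambda>x. Qmat (KN_b \<alpha> q r n x) (KN_c \<alpha> q r n x))"
    proof
      fix x
      have "nat (int P - 1) div 2 = n" "odd (int P - 1)" "\<not> int P - 1 < 0" by (auto simp: P_def)
      then show "W (int P - 1) x = Qmat (KN_b \<alpha> q r n x) (KN_c \<alpha> q r n x)"
        by (simp add: W_def KN_W_def Let_def Qmat_def)
    qed
    have "(W (int P - 1) has_vector_derivative Qmat (Dx (KN_b \<alpha> q r n) x) (Dx (KN_c \<alpha> q r n) x)) (at x)"
      unfolding W by (rule Qmat_vd[OF admissible_vd[OF KN_admissible(3)[OF q r]] admissible_vd[OF KN_admissible(4)[OF q r]]])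
    then show ?thesis using vector_derivative_unique_at[OF st[of "int P - 1"]] by (simp add: add.commute)
  qed
  finally show ?thesis .
qed

lemma Umat_vd:
  assumes "(\<lambda>s. q s) differentiable (at t)" "(\<lambda>s. r s) differentiable (at (t::real))"
  shows "vector_derivative (\<lambda>s. Umat (q s) (r s :: complex^'n) l) (at t)
    = (l powi (-1)) *\<^sub>M Qmat (vector_derivative q (at t)) (vector_derivative r (at t))"
proof (rule vector_derivative_at)
  have "((\<lambda>s. Qmat (q s) (r s)) has_vector_derivative Qmat (vector_derivative q (at t)) (vector_derivative r (at t))) (at t)"
    using assms by (intro Qmat_vd) (auto simp: vector_derivative_works[symmetric])
  from has_vector_derivative_add[OF has_vector_derivative_const[of "(l powi (-2)) *\<^sub>M (\<i> *\<^sub>M sigma3)"]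
      bounded_linear.has_vector_derivative[OF bounded_linear_mscale[of "l powi (-1)"] this]]
  show "((\<lambda>s. Umat (q s) (r s) l) has_vector_derivative
      (l powi (-1)) *\<^sub>M Qmat (vector_derivative q (at t)) (vector_derivative r (at t))) (at t)"
    unfolding Umat_eq by simp
qed

section \<open>The recursion operator\<close>

abbreviation (input) inv_Dx :: "(real \<Rightarrow> complex) \<Rightarrow> real \<Rightarrow> complex" where
  "inv_Dx \<equiv> formal_inverse Dx"

definition inv_cov :: "(real \<Rightarrow> complex^'n) \<Rightarrow> (real \<Rightarrow> complex^'n) \<Rightarrow> (real \<Rightarrow> complex^'n^'n) \<Rightarrow> real \<Rightarrow> complex^'n^'n" where
  "inv_cov q r = formal_inverse (cov_D (-(\<i>/2)) (\<lambda>y. outer (q y) (r y)))"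

text \<open>Applied to \<open>swap2 w\<close>, the four rank-one entries of \<open>L_1\<close> share
  one scalar primitive and the operators \<open>A, B, C, D\<close> one matrix primitive;
  \<open>scalar_source\<close> and \<open>matrix_source\<close> are the functions being
  integrated.\<close>

definition scalar_source :: "(real \<Rightarrow> complex^'n) \<Rightarrow> (real \<Rightarrow> complex^'n) \<Rightarrow> 'n::finite field2 \<Rightarrow> real \<Rightarrow> complex" where
  "scalar_source q r w = (\<lambda>x. scalar_product (q x) (fst (w x)) + scalar_product (r x) (snd (w x)))"

definition matrix_source :: "(real \<Rightarrow> complex^'n) \<Rightarrow> (real \<Rightarrow> complex^'n) \<Rightarrow> 'n::finite field2 \<Rightarrow> real \<Rightarrow> complex^'n^'n" where
  "matrix_source q r w = (\<lambda>x. outer (snd (w x)) (r x) + outer (q x) (fst (w x)))"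

lemma admissible_swap2: "admissible w \<Longrightarrow> admissible (swap2 w)"
  unfolding swap2_def by (rule admissible_Pair[OF admissible_snd admissible_fst])

lemma swap2_swap2 [simp]: "swap2 (swap2 w) = w"
  by (simp add: swap2_def)

lemma Dx_swap2:
  assumes "admissible w"
  shows "Dx (swap2 w) = swap2 (Dx w)"
proof -
  have "bounded_linear (\<lambda>p :: (complex^'a) \<times> (complex^'a). (snd p, fst p))"
    by (rule bounded_linearI_euclidean; simp)
  from Dx_linear[OF this admissible_tame[OF assms]] show ?thesis by (simp add: swap2_def)
qed

lemma Dx_parts:
  assumes "admissible w"
  shows "Dx (\<lambda>x. fst (w x)) = (\<lambda>x. fst (Dx w x))" "Dx (\<lambda>x. snd (w x)) = (\<lambda>x. snd (Dx w x))"
  by (rule Dx_linear[OF bounded_linear_fst admissible_tame[OF assms]],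
      rule Dx_linear[OF bounded_linear_snd admissible_tame[OF assms]])

lemma op_J_eq: "admissible w \<Longrightarrow> op_J w = swap2 (Dx w)"
  by (simp add: op_J_def Dx_parts swap2_def)

context
  fixes q r :: "real \<Rightarrow> complex^'n"
  assumes q: "admissible q" and r: "admissible r"
begin

lemma connection_qr: "connection (\<lambda>m F. -(\<i>/2) *\<^sub>M comm m F) (\<lambda>y. outer (q y) (r y))"
  by (rule connection_cov_D[OF admissible_bilinear[OF bounded_bilinear_outer q r]])

lemma connection_rq: "connection (\<lambda>m F. (\<i>/2) *\<^sub>M comm m F) (\<lambda>y. outer (r y) (q y))"
  by (rule connection_cov_D[OF admissible_bilinear[OF bounded_bilinear_outer r q]])

lemma scalar_source_admissible:
  assumes "admissible w" shows "admissible (scalar_source q r w)"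
  unfolding scalar_source_def
  by (rule admissible_add[OF
        admissible_bilinear[OF bounded_bilinear_scalar_product q admissible_fst[OF assms]]
        admissible_bilinear[OF bounded_bilinear_scalar_product r admissible_snd[OF assms]]])

lemma matrix_source_admissible:
  assumes "admissible w" shows "admissible (matrix_source q r w)"
  unfolding matrix_source_def
  by (rule admissible_add[OF
        admissible_bilinear[OF bounded_bilinear_outer admissible_snd[OF assms] r]
        admissible_bilinear[OF bounded_bilinear_outer q admissible_fst[OF assms]]])

lemma inv_Dx_bounded_smooth: "admissible f \<Longrightarrow> bounded_smooth (inv_Dx f)"
  unfolding Dx_connection_op by (rule connection.formal_inverse_bounded_smooth[OF connection_Dx])

lemma inv_Dx_add: "admissible f \<Longrightarrow> admissible g \<Longrightarrow> inv_Dx (\<lambda>x. f x + g x) = (\<lambda>x. inv_Dx f x + inv_Dx g x)"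
  unfolding Dx_connection_op by (rule connection.formal_inverse_add[OF connection_Dx])

lemma inv_Dx_mult: "admissible f \<Longrightarrow> inv_Dx (\<lambda>x. s * f x) = (\<lambda>x. s * inv_Dx f x)"
  unfolding Dx_connection_op
  by (rule formal_inverse_intertwine[OF connection_Dx connection_Dx bounded_linear_mult_right]) simp_all

lemma inv_cov_bounded_smooth: "admissible f \<Longrightarrow> bounded_smooth (inv_cov q r f)"
  unfolding inv_cov_def cov_D_connection_op by (rule connection.formal_inverse_bounded_smooth[OF connection_qr])

lemma inv_cov_add: "admissible f \<Longrightarrow> admissible g \<Longrightarrow> inv_cov q r (\<lambda>x. f x + g x) = (\<lambda>x. inv_cov q r f x + inv_cov q r g x)"
  unfolding inv_cov_def cov_D_connection_op by (rule connection.formal_inverse_add[OF connection_qr])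

lemma inv_cov_mscale: "admissible f \<Longrightarrow> inv_cov q r (\<lambda>x. s *\<^sub>M f x) = (\<lambda>x. s *\<^sub>M inv_cov q r f x)"
  unfolding inv_cov_def cov_D_connection_op
  by (rule formal_inverse_intertwine[OF connection_qr connection_qr bounded_linear_mscale]) (simp_all add: mult.commute)

text \<open>Transposition exchanges \<open>outer q r\<close> and \<open>outer r q\<close> and
  reverses commutators, so the sign of \<open>i/2\<close> flips; \<open>B\<close> and
  \<open>D\<close> thus reduce to the inverse used for \<open>A\<close> and
  \<open>C\<close>.\<close>

lemma inv_cov_transpose:
  assumes f: "admissible f"
  shows "formal_inverse (cov_D (\<i>/2) (\<lambda>y. outer (r y) (q y))) (\<lambda>x. transpose (f x))
    = (\<lambda>x. transpose (inv_cov q r f x))"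
  unfolding inv_cov_def cov_D_connection_op
proof (rule formal_inverse_intertwine[OF connection_qr connection_rq bounded_linear_transpose _ f])
  fix x and a :: "complex^'n^'n"
  have "transpose (comm (outer (q x) (r x)) a) = - comm (outer (r x) (q x)) (transpose a)"
  proof -
    have "transpose (A - B) = transpose A - transpose B" for A B :: "complex^'n^'n"
      by (simp add: transpose_def vec_eq_iff)
    then show ?thesis by (simp add: comm_def matrix_transpose_mul transpose_outer)
  qed
  moreover have "transpose (- (\<i>/2) *\<^sub>M A) = - (\<i>/2) *\<^sub>M transpose A" for A :: "complex^'n^'n"
    by (simp add: transpose_def mscale_def vec_eq_iff)
  ultimately show "(\<i>/2) *\<^sub>M comm (outer (r x) (q x)) (transpose a)
      = transpose (- (\<i>/2) *\<^sub>M comm (outer (q x) (r x)) a)"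
    by simp
qed

lemma op_L1_swap2:
  assumes w: "admissible w"
  defines "u \<equiv> inv_Dx (scalar_source q r w)" and "X \<equiv> inv_cov q r (matrix_source q r w)"
  shows "op_L1 q r (swap2 w) = (\<lambda>x.
    ((\<i>/2) *s snd (w x) + (1/4) *s (u x *s q x + X x *v q x),
     (-(\<i>/2)) *s fst (w x) + (1/4) *s (u x *s r x + r x v* X x)))"
proof -
  define f where "f x = fst (w x)" for x
  define g where "g x = snd (w x)" for x
  have fg: "admissible f" "admissible g"
    unfolding f_def[abs_def] g_def[abs_def] by (rule admissible_fst[OF w], rule admissible_snd[OF w])
  note sp = admissible_bilinear[OF bounded_bilinear_scalar_product]
  note ot = admissible_bilinear[OF bounded_bilinear_outer]
  have u: "u x = inv_Dx (\<lambda>x. scalar_product (q x) (f x)) x + inv_Dx (\<lambda>x. scalar_product (r x) (g x)) x" for x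
    unfolding u_def scalar_source_def f_def[symmetric] g_def[symmetric]
    by (simp only: inv_Dx_add[OF sp[OF q fg(1)] sp[OF r fg(2)]])
  have X: "X x = inv_cov q r (\<lambda>x. outer (g x) (r x)) x + inv_cov q r (\<lambda>x. outer (q x) (f x)) x" for x
    unfolding X_def matrix_source_def f_def[symmetric] g_def[symmetric]
    by (simp only: inv_cov_add[OF ot[OF fg(2) r] ot[OF q fg(1)]])
  have AC: "op_A q r g x = inv_cov q r (\<lambda>x. outer (g x) (r x)) x *v q x"
    "op_C q r f x = inv_cov q r (\<lambda>x. outer (q x) (f x)) x *v q x" for x
    by (simp_all add: op_A_def op_C_def inv_cov_def)
  have BD: "op_D q r g x = r x v* inv_cov q r (\<lambda>x. outer (g x) (r x)) x"
    "op_B q r f x = r x v* inv_cov q r (\<lambda>x. outer (q x) (f x)) x" for x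
    using inv_cov_transpose[OF ot[OF fg(2) r]] inv_cov_transpose[OF ot[OF q fg(1)]]
    by (simp_all add: op_D_def op_B_def transpose_outer)
  show ?thesis
  proof
    fix x
    have "r x v* (A + B) = r x v* A + r x v* B" for A B :: "complex^'n^'n"
      by (simp add: vector_matrix_mult_def vec_eq_iff sum.distrib algebra_simps)
    then show "op_L1 q r (swap2 w) x = ((\<i>/2) *s snd (w x) + (1/4) *s (u x *s q x + X x *v q x),
     (-(\<i>/2)) *s fst (w x) + (1/4) *s (u x *s r x + r x v* X x))"
      unfolding op_L1_def Let_def swap2_def fst_conv snd_conv f_def[symmetric] g_def[symmetric]
        AC BD rank1_op_def u X
      by (simp add: vsmult_distrib matrix_vector_mult_add_rdistrib algebra_simps)
  qed
qed

lemma op_L1_admissible: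
  assumes "admissible w" shows "admissible (op_L1 q r w)"
proof -
  have w: "admissible (swap2 w)" by (rule admissible_swap2[OF assms])
  define u where "u = inv_Dx (scalar_source q r (swap2 w))"
  define X where "X = inv_cov q r (matrix_source q r (swap2 w))"
  have u: "bounded_smooth u"
    unfolding u_def by (rule inv_Dx_bounded_smooth[OF scalar_source_admissible[OF w]])
  have X: "bounded_smooth X"
    unfolding X_def by (rule inv_cov_bounded_smooth[OF matrix_source_admissible[OF w]])
  have XT: "bounded_smooth (\<lambda>x. transpose (X x))"
    by (rule bounded_smooth_linear[OF bounded_linear_transpose X])
  note vs = admissible_linear[OF bounded_bilinear.bounded_linear_right[OF bounded_bilinear_vsmult]]
  have "admissible (\<lambda>x. ((\<i>/2) *s snd (swap2 w x) + (1/4) *s (u x *s q x + X x *v q x),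
     (-(\<i>/2)) *s fst (swap2 w x) + (1/4) *s (u x *s r x + transpose (X x) *v r x)))"
    by (rule admissible_Pair[OF
        admissible_add[OF vs[OF admissible_snd[OF w]] vs[OF admissible_add[OF
            admissible_bilinear_left[OF bounded_bilinear_vsmult u q]
            admissible_bilinear_left[OF bounded_bilinear_matrix_vector X q]]]]
        admissible_add[OF vs[OF admissible_fst[OF w]] vs[OF admissible_add[OF
            admissible_bilinear_left[OF bounded_bilinear_vsmult u r]
            admissible_bilinear_left[OF bounded_bilinear_matrix_vector XT r]]]]])
  then show ?thesis
    using op_L1_swap2[OF w, folded u_def X_def] by simp
qed

lemma op_L_admissible: "admissible w \<Longrightarrow> admissible (op_L q r w)"
  unfolding op_L_def by (intro admissible_swap2 op_L1_admissible admissible_Dx)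

lemma op_L_funpow_admissible: "admissible w \<Longrightarrow> admissible ((op_L q r ^^ k) w)"
  by (induction k) (simp_all add: op_L_admissible)

text \<open>Both primitives reappear in the recursion, as \<open>a = (i/2) u\<close> and
  \<open>d = -(i/2) X\<close>; with the factors \<open>1/i\<close> and \<open>1/2\<close> this
  produces the constant \<open>1/4\<close> of \<open>L_1\<close>.\<close>

lemma op_L_step:
  "op_L q r (\<lambda>x. (KN_c \<alpha> q r n x, KN_b \<alpha> q r n x)) = (\<lambda>x. (KN_c \<alpha> q r (Suc n) x, KN_b \<alpha> q r (Suc n) x))"
proof -
  note adm = KN_admissible[OF q r, of \<alpha>]
  define w where "w x = (Dx (KN_c \<alpha> q r n) x, Dx (KN_b \<alpha> q r n) x)" for x
  have w: "admissible w"
    unfolding w_def[abs_def] by (rule admissible_Pair[OF admissible_Dx[OF adm(4)] admissible_Dx[OF adm(3)]])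
  have Dw: "Dx (\<lambda>x. (KN_c \<alpha> q r n x, KN_b \<alpha> q r n x)) = w"
    unfolding w_def[abs_def]
    by (rule Dx_eqI[OF has_vector_derivative_Pair[OF admissible_vd[OF adm(4)] admissible_vd[OF adm(3)]]])
  define u where "u = inv_Dx (scalar_source q r w)"
  define X where "X = inv_cov q r (matrix_source q r w)"
  have a: "KN_a \<alpha> q r (Suc n) = (\<lambda>x. (\<i>/2) * u x)"
  proof -
    have "KN_a \<alpha> q r (Suc n) = inv_Dx (\<lambda>x. (\<i>/2) * scalar_source q r w x)"
      unfolding KN_a.simps scalar_source_def w_def by (simp add: scalar_product_commute add.commute)
    then show ?thesis unfolding u_def by (simp only: inv_Dx_mult[OF scalar_source_admissible[OF w]])
  qed
  have d: "KN_d \<alpha> q r (Suc n) = (\<lambda>x. -(\<i>/2) *\<^sub>M X x)"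
  proof -
    have "KN_d \<alpha> q r (Suc n) = inv_cov q r (\<lambda>x. -(\<i>/2) *\<^sub>M matrix_source q r w x)"
      unfolding KN_d.simps matrix_source_def w_def inv_cov_def by simp
    then show ?thesis unfolding X_def by (simp only: inv_cov_mscale[OF matrix_source_admissible[OF w]])
  qed
  have b: "KN_b \<alpha> q r (Suc n) x = (\<i>/2) *s snd (w x) + (1/4) *s (u x *s q x + X x *v q x)" for x
    unfolding KN_b.simps a d w_def snd_conv matrix_vsmult by (simp add: vec_eq_iff field_simps)
  have c: "KN_c \<alpha> q r (Suc n) x = (-(\<i>/2)) *s fst (w x) + (1/4) *s (u x *s r x + r x v* X x)" for x
    unfolding KN_c.simps a d w_def fst_conv transpose_matrix_vector matrix_vsmult by (simp add: vec_eq_iff field_simps)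
  show ?thesis
    unfolding op_L_def Dw op_L1_swap2[OF w, folded u_def X_def] b[symmetric] c[symmetric] by (simp add: swap2_def)
qed

lemma op_L_funpow:
  "(op_L q r ^^ n) (\<lambda>x. (KN_c \<alpha> q r 0 x, KN_b \<alpha> q r 0 x)) = (\<lambda>x. (KN_c \<alpha> q r n x, KN_b \<alpha> q r n x))"
  by (induction n) (simp_all add: op_L_step del: KN_b.simps KN_c.simps)

section \<open>Skew-symmetry\<close>

lemma inv_Dx_antisymmetric:
  assumes "admissible f" "admissible g"
  shows "integral\<^sup>L lborel (\<lambda>x. f x * inv_Dx g x) = - integral\<^sup>L lborel (\<lambda>x. inv_Dx f x * g x)"
  unfolding Dx_connection_op
  by (rule formal_inverse_antisymmetric[OF connection_Dx connection_Dx bounded_bilinear_mult _ assms]) simp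

text \<open>The trace form is invariant under the adjoint action.\<close>

lemma inv_cov_antisymmetric:
  assumes "admissible f" "admissible g"
  shows "integral\<^sup>L lborel (\<lambda>x. trace (f x ** inv_cov q r g x)) = - integral\<^sup>L lborel (\<lambda>x. trace (inv_cov q r f x ** g x))"
  unfolding inv_cov_def cov_D_connection_op
proof (rule formal_inverse_antisymmetric[OF connection_qr connection_qr bounded_bilinear_trace_mult _ assms])
  fix x and a b :: "complex^'n^'n"
  let ?m = "outer (q x) (r x)"
  have "comm ?m a ** b + a ** comm ?m b = ?m ** (a ** b) - (a ** b) ** ?m"
    using bounded_bilinear.diff_left[OF bounded_bilinear_matrix_matrix, of "?m ** a" "a ** ?m" b]
      bounded_bilinear.diff_right[OF bounded_bilinear_matrix_matrix, of a "?m ** b" "b ** ?m"]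
    by (simp add: comm_def matrix_mul_assoc)
  then have "trace (comm ?m a ** b) + trace (a ** comm ?m b) = 0"
    using trace_mul_sym[of ?m "a ** b"] by (simp add: trace_sub flip: trace_add)
  then have "(-(\<i>/2)) * (trace (comm ?m a ** b) + trace (a ** comm ?m b)) = 0" by simp
  then show "trace ((- (\<i>/2) *\<^sub>M comm ?m a) ** b) + trace (a ** (- (\<i>/2) *\<^sub>M comm ?m b)) = 0"
    by (simp only: mscale_mult trace_mscale distrib_left)
qed

text \<open>The maps from a field to its two sources are adjoint to the maps that multiply the
  primitives back onto \<open>q\<close> and \<open>r\<close>. So the nonlocal part of
  \<open>L_1\<close> after the swap is an antisymmetric inverse between an operator and its adjoint,
  and the local part is visibly antisymmetric.\<close>

lemma pairing_op_L1_swap2: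
  assumes f: "admissible f" and g: "admissible g"
  shows "pairing f (op_L1 q r (swap2 g))
    = (\<i>/2) * integral\<^sup>L lborel (\<lambda>x. scalar_product (fst (f x)) (snd (g x)) - scalar_product (snd (f x)) (fst (g x)))
      + (1/4) * (integral\<^sup>L lborel (\<lambda>x. scalar_source q r f x * inv_Dx (scalar_source q r g) x)
      + integral\<^sup>L lborel (\<lambda>x. trace (matrix_source q r f x ** inv_cov q r (matrix_source q r g) x)))"
proof -
  define u where "u = inv_Dx (scalar_source q r g)"
  define X where "X = inv_cov q r (matrix_source q r g)"
  note sp = admissible_bilinear[OF bounded_bilinear_scalar_product]
  have i1: "integrable lborel (\<lambda>x. scalar_product (fst (f x)) (snd (g x)) - scalar_product (snd (f x)) (fst (g x)))"
    by (rule admissible_integrable[OF admissible_diff[OF sp[OF admissible_fst[OF f] admissible_snd[OF g]]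
            sp[OF admissible_snd[OF f] admissible_fst[OF g]]]])
  have i2: "integrable lborel (\<lambda>x. scalar_source q r f x * u x)"
    unfolding u_def
    by (rule admissible_integrable[OF admissible_bilinear_right[OF bounded_bilinear_mult
          scalar_source_admissible[OF f] inv_Dx_bounded_smooth[OF scalar_source_admissible[OF g]]]])
  have i3: "integrable lborel (\<lambda>x. trace (matrix_source q r f x ** X x))"
    unfolding X_def
    by (rule admissible_integrable[OF admissible_bilinear_right[OF bounded_bilinear_trace_mult
          matrix_source_admissible[OF f] inv_cov_bounded_smooth[OF matrix_source_admissible[OF g]]]])
  have tr: "trace (outer v w ** Y) = scalar_product w (Y *v v)" for v w :: "complex^'n" and Y
    by (simp add: outer_matrix trace_outer scalar_product_vector_matrix scalar_product_commute[of v])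
  have "scalar_product (fst (f x)) (fst (op_L1 q r (swap2 g) x)) + scalar_product (snd (f x)) (snd (op_L1 q r (swap2 g) x))
    = (\<i>/2) * (scalar_product (fst (f x)) (snd (g x)) - scalar_product (snd (f x)) (fst (g x)))
      + (1/4) * (scalar_source q r f x * u x + trace (matrix_source q r f x ** X x))" for x
    unfolding op_L1_swap2[OF g, folded u_def X_def] fst_conv snd_conv
      scalar_source_def[of q r f] matrix_source_def[of q r f]
      matrix_add_rdistrib trace_add tr
    by (simp add: scalar_product_simps scalar_product_commute[of "snd (f x)" "r x v* X x"]
        scalar_product_vector_matrix scalar_product_commute[of "fst (f x)" "q x"]
        scalar_product_commute[of "snd (f x)" "r x"] algebra_simps)
  then show ?thesis
    unfolding pairing_def u_def[symmetric] X_def[symmetric]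
    using i1 i2 i3 by simp
qed

lemma op_L1_swap2_skew:
  assumes f: "admissible f" and g: "admissible g"
  shows "pairing f (op_L1 q r (swap2 g)) = - pairing (op_L1 q r (swap2 f)) g"
proof -
  have pc: "pairing a b = pairing b a" for a b :: "'n field2"
    by (simp add: pairing_def scalar_product_commute)
  have "integral\<^sup>L lborel (\<lambda>x. scalar_product (fst (f x)) (snd (g x)) - scalar_product (snd (f x)) (fst (g x)))
    = - integral\<^sup>L lborel (\<lambda>x. scalar_product (fst (g x)) (snd (f x)) - scalar_product (snd (g x)) (fst (f x)))"
    unfolding Bochner_Integration.integral_minus[symmetric]
    by (simp add: scalar_product_commute[of "fst (g _)"] scalar_product_commute[of "snd (g _)"])
  moreover have "integral\<^sup>L lborel (\<lambda>x. scalar_source q r f x * inv_Dx (scalar_source q r g) x)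
    = - integral\<^sup>L lborel (\<lambda>x. scalar_source q r g x * inv_Dx (scalar_source q r f) x)"
    using inv_Dx_antisymmetric[OF scalar_source_admissible[OF f] scalar_source_admissible[OF g]]
    by (simp add: mult.commute)
  moreover have "integral\<^sup>L lborel (\<lambda>x. trace (matrix_source q r f x ** inv_cov q r (matrix_source q r g) x))
    = - integral\<^sup>L lborel (\<lambda>x. trace (matrix_source q r g x ** inv_cov q r (matrix_source q r f) x))"
    using inv_cov_antisymmetric[OF matrix_source_admissible[OF f] matrix_source_admissible[OF g]]
    by (subst (2) trace_mul_sym)
  ultimately show ?thesis
    unfolding pc[of "op_L1 q r (swap2 f)"] pairing_op_L1_swap2[OF f g] pairing_op_L1_swap2[OF g f]
    by (simp add: algebra_simps)
qed

end

section \<open>Skew-symmetry of \<open>J\<close> and of \<open>J L^k\<close>\<close>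

lemma pairing_swap2: "pairing (swap2 f) (swap2 g) = pairing f g"
  by (simp add: pairing_def swap2_def add.commute)

lemma pairing_Dx:
  fixes f g :: "'n::finite field2"
  assumes f: "admissible f" and g: "admissible g"
  shows "pairing f (Dx g) = - pairing (Dx f) g"
proof -
  define F where "F x = scalar_product (fst (f x)) (fst (g x)) + scalar_product (snd (f x)) (snd (g x))" for x
  note b = bounded_bilinear.has_vector_derivative[OF bounded_bilinear_scalar_product]
  note l = bounded_linear.has_vector_derivative[OF bounded_linear_fst] bounded_linear.has_vector_derivative[OF bounded_linear_snd]
  have F: "admissible F" unfolding F_def[abs_def] by (rule pairing_integrable[OF f g])
  have DF: "Dx F = (\<lambda>x. (scalar_product (fst (f x)) (fst (Dx g x)) + scalar_product (snd (f x)) (snd (Dx g x)))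
      + (scalar_product (fst (Dx f x)) (fst (g x)) + scalar_product (snd (Dx f x)) (snd (g x))))"
  proof (rule Dx_eqI)
    fix x
    from has_vector_derivative_add[OF b[OF l(1)[OF admissible_vd[OF f, of x]] l(1)[OF admissible_vd[OF g, of x]]]
        b[OF l(2)[OF admissible_vd[OF f, of x]] l(2)[OF admissible_vd[OF g, of x]]]]
    show "(F has_vector_derivative (scalar_product (fst (f x)) (fst (Dx g x)) + scalar_product (snd (f x)) (snd (Dx g x)))
      + (scalar_product (fst (Dx f x)) (fst (g x)) + scalar_product (snd (Dx f x)) (snd (g x)))) (at x)"
      unfolding F_def[abs_def] by (simp add: algebra_simps)
  qed
  have "pairing f (Dx g) + pairing (Dx f) g = integral\<^sup>L lborel (Dx F)"
    unfolding DF pairing_def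
    by (rule Bochner_Integration.integral_add[symmetric])
       (rule admissible_integrable[OF pairing_integrable[OF f admissible_Dx[OF g]]],
        rule admissible_integrable[OF pairing_integrable[OF admissible_Dx[OF f] g]])
  then show ?thesis using integral_Dx_zero[OF F] by (simp add: eq_neg_iff_add_eq_0)
qed

lemma op_J_admissible: "admissible w \<Longrightarrow> admissible (op_J w)"
  by (simp add: op_J_eq admissible_swap2 admissible_Dx)

text \<open>\<open>J\<close> is the swap composed with \<open>Dx\<close>; the swap is symmetric for
  the pairing and commutes with \<open>Dx\<close>.\<close>

lemma pairing_op_J:
  assumes f: "admissible f" and g: "admissible g"
  shows "pairing f (op_J g) = - pairing (op_J f) g"
proof -
  have "pairing f (op_J g) = pairing (swap2 f) (Dx g)"
    unfolding op_J_eq[OF g] using pairing_swap2[of "swap2 f" "Dx g"] by simp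
  also have "\<dots> = - pairing (op_J f) g"
    unfolding pairing_Dx[OF admissible_swap2[OF f] g] Dx_swap2[OF f] op_J_eq[OF f] ..
  finally show ?thesis .
qed

lemma skew_symmetric_op_J: "skew_symmetric (op_J :: 'n::finite field2 \<Rightarrow> 'n field2)"
  unfolding skew_symmetric_def using op_J_admissible pairing_op_J by blast

text \<open>\<open>L\<^sup>* = \<partial> L\<^sub>1\<close> because \<open>L\<^sub>1 S\<close> is skew (\<open>S\<close> the swap), and \<open>\<partial> L\<^sub>1 J = J L\<close>.\<close>

lemma pairing_op_L:
  fixes q r :: "real \<Rightarrow> complex^'n"
  assumes q: "admissible q" and r: "admissible r" and f: "admissible f" and g: "admissible g"
  shows "pairing f (op_L q r g) = pairing (Dx (op_L1 q r f)) g"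
proof -
  have "pairing f (op_L q r g) = pairing (swap2 f) (op_L1 q r (swap2 (Dx g)))"
    unfolding op_L_def using pairing_swap2[of "swap2 f" "op_L1 q r (swap2 (Dx g))"] by simp
  also have "\<dots> = - pairing (op_L1 q r f) (Dx g)"
    using op_L1_swap2_skew[OF q r admissible_swap2[OF f] admissible_Dx[OF g]] by simp
  also have "\<dots> = pairing (Dx (op_L1 q r f)) g"
    by (simp add: pairing_Dx[OF op_L1_admissible[OF q r f] g])
  finally show ?thesis .
qed

text \<open>As the swap is an involution commuting with \<open>Dx\<close>, both sides are
  \<open>Dx L_1\<close> applied to the swap of \<open>Dx f\<close>.\<close>

lemma Dx_op_L1_op_J:
  fixes q r :: "real \<Rightarrow> complex^'n"
  assumes q: "admissible q" and r: "admissible r" and f: "admissible f"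
  shows "Dx (op_L1 q r (op_J f)) = op_J (op_L q r f)"
  unfolding op_J_eq[OF op_L_admissible[OF q r f]] op_J_eq[OF f] unfolding op_L_def
  by (simp add: Dx_swap2[OF op_L1_admissible[OF q r admissible_swap2[OF admissible_Dx[OF f]]]])

text \<open>One factor moves at a time, by \<open>L* J = J L\<close> with \<open>L*\<close> the
  adjoint of \<open>L\<close>.\<close>

lemma pairing_op_J_op_L_funpow:
  fixes q r :: "real \<Rightarrow> complex^'n"
  assumes q: "admissible q" and r: "admissible r" and f: "admissible f" and g: "admissible g"
  shows "pairing (op_J f) ((op_L q r ^^ k) g) = pairing (op_J ((op_L q r ^^ k) f)) g"
  using g
proof (induction k arbitrary: g)
  case (Suc k)
  note Lf = op_L_funpow_admissible[OF q r f, of k]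
  have "pairing (op_J f) ((op_L q r ^^ Suc k) g) = pairing (op_J f) ((op_L q r ^^ k) (op_L q r g))"
    by (simp add: funpow_swap1)
  also have "\<dots> = pairing (op_J ((op_L q r ^^ k) f)) (op_L q r g)"
    by (rule Suc.IH[OF op_L_admissible[OF q r Suc.prems]])
  also have "\<dots> = pairing (Dx (op_L1 q r (op_J ((op_L q r ^^ k) f)))) g"
    by (rule pairing_op_L[OF q r op_J_admissible[OF Lf] Suc.prems])
  also have "\<dots> = pairing (op_J ((op_L q r ^^ Suc k) f)) g"
    by (simp add: Dx_op_L1_op_J[OF q r Lf])
  finally show ?case .
qed simp

lemma skew_symmetric_op_J_op_L:
  fixes q r :: "real \<Rightarrow> complex^'n"
  assumes q: "admissible q" and r: "admissible r"
  shows "skew_symmetric (\<lambda>f. op_J ((op_L q r ^^ k) f))"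
  unfolding skew_symmetric_def
proof (intro conjI allI impI)
  fix f g :: "'n field2" assume f: "admissible f" and g: "admissible g"
  show "pairing f (op_J ((op_L q r ^^ k) g)) = - pairing (op_J ((op_L q r ^^ k) f)) g"
    unfolding pairing_op_J[OF f op_L_funpow_admissible[OF q r g]] pairing_op_J_op_L_funpow[OF q r f g] ..
qed (intro op_J_admissible op_L_funpow_admissible[OF q r])

theorem mainTheorem1:
  fixes \<alpha>\<^sub>0 :: complex
    and q r :: "real \<Rightarrow> real \<Rightarrow> complex^'n"  \<comment> \<open>\<open>q t x\<close>, \<open>r t x\<close>: time first\<close>
    and T :: "real set"
    and n :: nat
    and \<omega> :: "real \<Rightarrow> 'n field2"
  assumes \<omega>_def: "\<And>t x. \<omega> t x = (q t x, r t x)"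
    and T: "open T"
    and adm: "\<And>t. t \<in> T \<Longrightarrow> admissible (q t)" "\<And>t. t \<in> T \<Longrightarrow> admissible (r t)"
    and diff_t: "\<And>t x. t \<in> T \<Longrightarrow> (\<lambda>s. q s x) differentiable at t"
      "\<And>t x. t \<in> T \<Longrightarrow> (\<lambda>s. r s x) differentiable at t"
  shows
    \<comment> \<open>the coefficients define a formal solution, with decaying coefficients\<close>
    "(\<forall>t\<in>T. stationary_zero_curvature (q t) (r t) (KN_W \<alpha>\<^sub>0 (q t) (r t))
        \<and> (\<forall>m. admissible (KN_a \<alpha>\<^sub>0 (q t) (r t) (Suc m)) \<and> admissible (KN_d \<alpha>\<^sub>0 (q t) (r t) (Suc m))
             \<and> admissible (KN_b \<alpha>\<^sub>0 (q t) (r t) m) \<and> admissible (KN_c \<alpha>\<^sub>0 (q t) (r t) m)))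
     \<and>
     (\<forall>t\<in>T. has_variational_derivative (KN_H \<alpha>\<^sub>0 n) (\<omega> t)
                (\<lambda>x. (KN_c \<alpha>\<^sub>0 (q t) (r t) n x, KN_b \<alpha>\<^sub>0 (q t) (r t) n x))
           \<and> (\<lambda>x. (KN_c \<alpha>\<^sub>0 (q t) (r t) n x, KN_b \<alpha>\<^sub>0 (q t) (r t) n x))
                = variational_derivative (KN_H \<alpha>\<^sub>0 n) (\<omega> t))
     \<and>
     ((\<forall>t\<in>T. \<forall>x l. l \<noteq> 0 \<longrightarrow>
          vector_derivative (\<lambda>s. Umat (q s x) (r s x) l) (at t)
          - Dx (KN_V \<alpha>\<^sub>0 (q t) (r t) n l) x
          + comm (Umat (q t x) (r t x) l) (KN_V \<alpha>\<^sub>0 (q t) (r t) n l x) = 0)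
      \<longleftrightarrow>
      (\<forall>t\<in>T. \<forall>x. vector_derivative (\<lambda>s. \<omega> s x) (at t)
                   = op_J (variational_derivative (KN_H \<alpha>\<^sub>0 n) (\<omega> t)) x))
     \<and>
     (\<forall>t\<in>T. op_J (variational_derivative (KN_H \<alpha>\<^sub>0 n) (\<omega> t))
             = op_J ((op_L (q t) (r t) ^^ n) (variational_derivative (KN_H \<alpha>\<^sub>0 0) (\<omega> t))))
     \<and>
     skew_symmetric (op_J :: 'n field2 \<Rightarrow> 'n field2)
     \<and>
     (\<forall>t\<in>T. \<forall>k\<ge>1. skew_symmetric (\<lambda>f. op_J ((op_L (q t) (r t) ^^ k) f)))"
proof -
  have var: "has_variational_derivative (KN_H \<alpha>\<^sub>0 m) (\<omega> t)
      (\<lambda>x. (KN_c \<alpha>\<^sub>0 (q t) (r t) m x, KN_b \<alpha>\<^sub>0 (q t) (r t) m x))" if "t \<in> T" for t m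
  proof -
    have "\<omega> t = (\<lambda>x. (q t x, r t x))" by (simp add: \<omega>_def fun_eq_iff)
    then show ?thesis using KN_H_variation[OF adm[OF that]] by simp
  qed
  note var_eq = variational_derivative_eqI[OF var]
  define qt where "qt t x = vector_derivative (\<lambda>s. q s x) (at t)" for t x
  define rt where "rt t x = vector_derivative (\<lambda>s. r s x) (at t)" for t x
  define b where "b t = Dx (KN_b \<alpha>\<^sub>0 (q t) (r t) n)" for t
  define c where "c t = Dx (KN_c \<alpha>\<^sub>0 (q t) (r t) n)" for t
  have zc: "(\<forall>l. l \<noteq> 0 \<longrightarrow> vector_derivative (\<lambda>s. Umat (q s x) (r s x) l) (at t)
          - Dx (KN_V \<alpha>\<^sub>0 (q t) (r t) n l) x
          + comm (Umat (q t x) (r t x) l) (KN_V \<alpha>\<^sub>0 (q t) (r t) n l x) = 0)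
      \<longleftrightarrow> qt t x = b t x \<and> rt t x = c t x" if t: "t \<in> T" for t x
  proof -
    have "vector_derivative (\<lambda>s. Umat (q s x) (r s x) l) (at t)
          - Dx (KN_V \<alpha>\<^sub>0 (q t) (r t) n l) x
          + comm (Umat (q t x) (r t x) l) (KN_V \<alpha>\<^sub>0 (q t) (r t) n l x)
        = (l powi (-1)) *\<^sub>M (Qmat (qt t x) (rt t x) - Qmat (b t x) (c t x))" if "l \<noteq> 0" for l
      using zero_curvature_defect[OF adm[OF t] that, of \<alpha>\<^sub>0 n x] Umat_vd[OF diff_t(1)[OF t, of x] diff_t(2)[OF t, of x], of l]
      by (simp add: qt_def rt_def b_def c_def mscale_distrib algebra_simps)
    moreover have "Qmat (qt t x) (rt t x) - Qmat (b t x) (c t x) = 0 \<longleftrightarrow> qt t x = b t x \<and> rt t x = c t x"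
      by (simp add: blk_eq_iff)
    \<comment> \<open>The factor \<open>l powi (-1)\<close> does not vanish for nonzero
      \<open>l\<close>, so a single value, here 1, already decides.\<close>
    ultimately show ?thesis by (auto intro: exI[of _ 1])
  qed
  have \<omega>t: "vector_derivative (\<lambda>s. \<omega> s x) (at t) = (qt t x, rt t x)" if t: "t \<in> T" for t x
    unfolding \<omega>_def qt_def rt_def
    by (rule vector_derivative_at, rule has_vector_derivative_Pair)
      (use diff_t[OF t] in \<open>simp_all add: vector_derivative_works[symmetric]\<close>)
  have J: "op_J (variational_derivative (KN_H \<alpha>\<^sub>0 n) (\<omega> t)) x = (b t x, c t x)" if "t \<in> T" for t x
    by (simp add: var_eq[OF that] op_J_def b_def c_def)
  show ?thesis
  proof (intro conjI, goal_cases)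
    case 1
    show ?case by (intro ballI conjI allI KN_W_stationary KN_admissible adm)
  next
    case 2
    show ?case using var var_eq by simp
  next
    case 3
    show ?case using zc \<omega>t J by simp
  next
    case 4
    show ?case using op_L_funpow[OF adm] by (simp add: var_eq del: KN_b.simps KN_c.simps)
  next
    case 5
    show ?case by (rule skew_symmetric_op_J)
  next
    case 6
    show ?case using skew_symmetric_op_J_op_L[OF adm] by blast
  qed
qed

end
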